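(* Let $H$ be a separable Hilbert space, let $S\subset B(H)$ be the Bilich--Dor-On operator system, and let $\pi:\mathrm{C}^*(S)\to B(H')$ be the Bilich--Dor-On representation; that is, $S$ is a separable operator system generated by a norm-closed unital subalgebra of $B(H)$ and the following hold: (1) $\mathrm{C}^*(S)$ contains the ideal $\mathfrak{K}$ of compact operators on $H$, and $\mathrm{C}^*(S)/\mathfrak{K}$ is commutative (in particular, $\mathrm{C}^*(S)$ is nuclear); (2) all irreducible $*$-representations of $\mathrm{C}^*(S)$ are boundary representations for $S$; (3) $H'$ is a separable Hilbert space and $\pi:\mathrm{C}^*(S)\to B(H')$ is a unital $*$-representation that does not have the unique extension property with respect to $S$ and satisfies $\mathfrak{K}\subset\ker\pi$. Then the following statements hold. (i) Every unital $*$-representation of $\mathrm{C}^*(S)$ has the unique tight extension property with respect to $S$. (ii) Every unital $*$-representation of $\mathrm{C}^*(S)$ has the Korovkin rigidity property with respect to $S$. (iii) The representation $\pi$ has the strong Korovkin rigidity property with respect to $S$.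
   Context: An operator system in $B(H)$ is a self-adjoint linear subspace containing the identity; the operator system generated by a unital subalgebra $B\subset B(H)$ is the one spanned by $B$ and its adjoints. $\mathrm{C}^*(S)$ is the unital $\mathrm{C}^*$-subalgebra of $B(H)$ generated by $S$. For $X\subset B(H)$, $X''$ denotes its bicommutant. Write $A=\mathrm{C}^*(S)$. A unital $*$-representation $\rho:A\to B(L)$ has the unique extension property with respect to $S$ if the only unital completely positive map $\psi:A\to B(L)$ with $\psi|_S=\rho|_S$ is $\psi=\rho$. An irreducible $*$-representation with this property is called a boundary representation for $S$. A unital $*$-representation $\rho:A\to B(L)$ has the unique tight extension property with respect to $S$ if the only unital completely positive map $\psi:A\to \rho(A)''$ with $\psi|_S=\rho|_S$ is $\psi=\rho$. A unital $*$-representation $\rho$ of $A$ has the Korovkin rigidity property with respect to $S$ if, whenever $\psi_\lambda:A\to\rho(A)$ is a net of unital completely positive maps such that $\psi_\lambda(s)\to\rho(s)$ in the weak topology of the Banach space $\rho(A)$ for every $s\in S$, then $\psi_\lambda(a)\to\rho(a)$ in the weak topology of $\rho(A)$ for every $a\in A$. It has the strong Korovkin rigidity property with respect to $S$ if the same holds with the weak topology replaced (in both hypothesis and conclusion) by the norm topology of $\rho(A)$. *)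

theory Defs
  imports "HOL-Analysis.Analysis"
begin

section \<open>Complex Hilbert spaces\<close>

class scaleC =
  fixes scaleC :: "complex \<Rightarrow> 'a \<Rightarrow> 'a"  (infixr "*\<^sub>C" 75)

text \<open>The inner product is conjugate-linear in the first argument. Separability is not built in,
  and the zero space is allowed.\<close>

class chilbert_space = banach + scaleC +
  fixes cinner :: "'a \<Rightarrow> 'a \<Rightarrow> complex"
  assumes scaleC_add_right: "c *\<^sub>C (x + y) = c *\<^sub>C x + c *\<^sub>C y"
    and scaleC_add_left: "(c + d) *\<^sub>C x = c *\<^sub>C x + d *\<^sub>C x"
    and scaleC_scaleC: "c *\<^sub>C d *\<^sub>C x = (c * d) *\<^sub>C x"
    and scaleR_scaleC: "r *\<^sub>R x = complex_of_real r *\<^sub>C x"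
    and cinner_commute: "cinner x y = cnj (cinner y x)"
    and cinner_add_right: "cinner x (y + z) = cinner x y + cinner x z"
    and cinner_scaleC_right: "cinner x (c *\<^sub>C y) = c * cinner x y"
    and cinner_self: "cinner x x = complex_of_real ((norm x)\<^sup>2)"

instantiation complex :: chilbert_space
begin
definition scaleC_complex :: "complex \<Rightarrow> complex \<Rightarrow> complex" where
  "scaleC_complex c z = c * z"
definition cinner_complex :: "complex \<Rightarrow> complex \<Rightarrow> complex" where
  "cinner_complex w z = cnj w * z"
instance
proof
  fix x :: complex
  show "cinner x x = complex_of_real ((norm x)\<^sup>2)"
    unfolding cinner_complex_def complex_norm_square by (rule mult.commute)
qed (simp_all add: scaleC_complex_def cinner_complex_def algebra_simps scaleR_conv_of_real)
end

lemma norm_scaleC: "norm (c *\<^sub>C x) = cmod c * norm (x :: 'a::chilbert_space)"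
proof -
  have left: "cinner (c *\<^sub>C x) y = cnj c * cinner x y" for y
    by (metis cinner_commute cinner_scaleC_right complex_cnj_mult)
  have "complex_of_real ((norm (c *\<^sub>C x))\<^sup>2) = (c * cnj c) * cinner x x"
    by (simp only: cinner_self[symmetric] cinner_scaleC_right left ac_simps)
  also have "\<dots> = complex_of_real ((cmod c * norm x)\<^sup>2)"
    by (simp add: cinner_self power_mult_distrib flip: complex_norm_square)
  finally have "(norm (c *\<^sub>C x))\<^sup>2 = (cmod c * norm x)\<^sup>2"
    using of_real_eq_iff by blast
  then show ?thesis
    by (simp add: power2_eq_iff_nonneg)
qed

lemma bounded_linear_scaleC: "bounded_linear ((*\<^sub>C) c :: 'a::chilbert_space \<Rightarrow> 'a)"
proof (rule bounded_linear_intro[where K = "cmod c"])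
  show "c *\<^sub>C (r *\<^sub>R x) = r *\<^sub>R (c *\<^sub>C x)" for r and x :: 'a
    by (simp add: scaleR_scaleC scaleC_scaleC mult.commute)
qed (simp_all add: scaleC_add_right norm_scaleC mult.commute)

definition csubspace :: "'a::{scaleC,ab_group_add} set \<Rightarrow> bool" where
  "csubspace V \<longleftrightarrow>
     0 \<in> V \<and> (\<forall>x\<in>V. \<forall>y\<in>V. x + y \<in> V) \<and> (\<forall>c. \<forall>x\<in>V. c *\<^sub>C x \<in> V)"

definition cspan :: "'a::{scaleC,ab_group_add} set \<Rightarrow> 'a set" where
  "cspan X = \<Inter>{V. csubspace V \<and> X \<subseteq> V}"

definition clinear_on :: "'a::{scaleC,ab_group_add} set \<Rightarrow> ('a \<Rightarrow> 'b::{scaleC,ab_group_add}) \<Rightarrow> bool"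
  where
  "clinear_on V f \<longleftrightarrow>
     (\<forall>x\<in>V. \<forall>y\<in>V. f (x + y) = f x + f y) \<and> (\<forall>c. \<forall>x\<in>V. f (c *\<^sub>C x) = c *\<^sub>C f x)"

definition separable :: "'a::topological_space set \<Rightarrow> bool" where
  "separable X \<longleftrightarrow> (\<exists>D. countable D \<and> D \<subseteq> X \<and> X \<subseteq> closure D)"

definition closed_csubspace :: "'a::chilbert_space set \<Rightarrow> bool" where
  "closed_csubspace E \<longleftrightarrow> csubspace E \<and> closed E"

section \<open>Bounded operators\<close>

text \<open>The library type of bounded operators consists of all real-linear ones; complex linearity
  is imposed in \<open>bop\<close> below.\<close>

type_synonym 'a op = "'a \<Rightarrow>\<^sub>L 'a"

instantiation blinfun :: (real_normed_vector, chilbert_space) scaleC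
begin
lift_definition scaleC_blinfun :: "complex \<Rightarrow> 'a \<Rightarrow>\<^sub>L 'b \<Rightarrow> 'a \<Rightarrow>\<^sub>L 'b" is "\<lambda>c T x. c *\<^sub>C T x"
  by (rule bounded_linear_compose[OF bounded_linear_scaleC])
instance ..
end

text \<open>A Hilbert space is a closed complex subspace \<open>E\<close> of a type of class
  \<open>chilbert_space\<close>. This permits quantification over Hilbert spaces inside a formula.
  Up to unitary equivalence, every separable Hilbert space is a closed subspace of any given
  infinite-dimensional one, so the closed subspaces of \<open>H\<close> suffice for all irreducible
  representations of a separable C*-algebra in \<open>B(H)\<close>, also when \<open>H\<close> is finite-dimensional.
  \<open>B(E)\<close> is identified with the corner \<open>P B P\<close> of the operators on the
  whole type, where \<open>P\<close> is the orthogonal projection onto \<open>E\<close>: an operator on \<open>E\<close> is extended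
  by \<open>0\<close> on the orthogonal complement. Products, adjoints and norms are those of the ambient
  operators, while the unit of \<open>B(E)\<close> is \<open>P = unit_op E\<close>.\<close>

definition bop :: "'a::chilbert_space set \<Rightarrow> 'a op set" where
  "bop E = {T :: 'a op. (\<forall>c x. T (c *\<^sub>C x) = c *\<^sub>C T x) \<and> range T \<subseteq> E \<and>
               (\<forall>x. (\<forall>y\<in>E. cinner y x = 0) \<longrightarrow> T x = 0)}"

definition unit_op :: "'a::chilbert_space set \<Rightarrow> 'a op" where
  "unit_op E = (THE P. P \<in> bop E \<and> (\<forall>x\<in>E. P x = x))"

definition adj :: "'a::chilbert_space op \<Rightarrow> 'a op" where
  "adj T = (THE T' :: 'a op. \<forall>x y. cinner (T x) y = cinner x (T' y))"

definition commutant :: "'a::chilbert_space set \<Rightarrow> 'a op set \<Rightarrow> 'a op set" where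
  "commutant E X = {T \<in> bop E. \<forall>R\<in>X. T o\<^sub>L R = R o\<^sub>L T}"

abbreviation bicommutant :: "'a::chilbert_space set \<Rightarrow> 'a op set \<Rightarrow> 'a op set" where
  "bicommutant E X \<equiv> commutant E (commutant E X)"

definition compact_ops :: "'a::chilbert_space op set" where
  "compact_ops = {T \<in> bop UNIV. compact (closure (T ` cball 0 1))}"

section \<open>Subalgebras and operator systems in \<open>B(H)\<close>\<close>

definition unital_subalgebra :: "'h::chilbert_space op set \<Rightarrow> bool" where
  "unital_subalgebra B \<longleftrightarrow> B \<subseteq> bop UNIV \<and> csubspace B \<and> id_blinfun \<in> B \<and>
     (\<forall>a\<in>B. \<forall>b\<in>B. a o\<^sub>L b \<in> B)"

definition operator_system :: "'h::chilbert_space op set \<Rightarrow> bool" where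
  "operator_system S \<longleftrightarrow> S \<subseteq> bop UNIV \<and> csubspace S \<and> (\<forall>s\<in>S. adj s \<in> S) \<and> id_blinfun \<in> S"

definition generated_operator_system :: "'h::chilbert_space op set \<Rightarrow> 'h op set" where
  "generated_operator_system B = cspan (B \<union> adj ` B)"

definition cstar :: "'h::chilbert_space op set \<Rightarrow> 'h op set" where
  "cstar S = \<Inter>{A. S \<subseteq> A \<and> unital_subalgebra A \<and> closed A \<and> (\<forall>a\<in>A. adj a \<in> A)}"

definition op_coset :: "'h::chilbert_space op set \<Rightarrow> 'h op \<Rightarrow> 'h op set" where
  "op_coset J a = {a + k | k. k \<in> J}"

text \<open>\<open>(a + J) (b + J) = (b + J) (a + J)\<close> in \<open>A / J\<close>.\<close>

definition commutative_quotient :: "'h::chilbert_space op set \<Rightarrow> 'h op set \<Rightarrow> bool" where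
  "commutative_quotient A J \<longleftrightarrow> (\<forall>a\<in>A. \<forall>b\<in>A. op_coset J (a o\<^sub>L b) = op_coset J (b o\<^sub>L a))"

section \<open>Representations and unital completely positive maps\<close>

text \<open>Maps defined on \<open>A\<close> are total functions whose values outside \<open>A\<close> are irrelevant.\<close>

definition unital_star_rep ::
  "'h::chilbert_space op set \<Rightarrow> 'l::chilbert_space set \<Rightarrow> ('h op \<Rightarrow> 'l op) \<Rightarrow> bool" where
  "unital_star_rep A E \<rho> \<longleftrightarrow> \<rho> ` A \<subseteq> bop E \<and> clinear_on A \<rho> \<and> \<rho> id_blinfun = unit_op E \<and>
     (\<forall>a\<in>A. \<forall>b\<in>A. \<rho> (a o\<^sub>L b) = \<rho> a o\<^sub>L \<rho> b) \<and> (\<forall>a\<in>A. \<rho> (adj a) = adj (\<rho> a))"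

definition irreducible_rep ::
  "'h::chilbert_space op set \<Rightarrow> 'l::chilbert_space set \<Rightarrow> ('h op \<Rightarrow> 'l op) \<Rightarrow> bool" where
  "irreducible_rep A E \<rho> \<longleftrightarrow> unital_star_rep A E \<rho> \<and> E \<noteq> {0} \<and>
     (\<forall>M. closed_csubspace M \<and> M \<subseteq> E \<and> (\<forall>a\<in>A. \<rho> a ` M \<subseteq> M) \<longrightarrow> M = {0} \<or> M = E)"

text \<open>Positivity of the \<open>n \<times> n\<close> matrix \<open>(a i j)\<close> as an operator on the \<open>n\<close>-fold direct sum.
  For entries in \<open>bop E\<close> it is immaterial whether the vectors range over \<open>E\<close> or over
  the whole type.\<close>

definition positive_matrix :: "nat \<Rightarrow> (nat \<Rightarrow> nat \<Rightarrow> 'a::chilbert_space op) \<Rightarrow> bool" where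
  "positive_matrix n a \<longleftrightarrow>
     (\<forall>x :: nat \<Rightarrow> 'a. (\<Sum>i<n. \<Sum>j<n. cinner (x i) (a i j (x j))) \<in> \<real>\<^sub>\<ge>\<^sub>0)"

text \<open>\<open>ucp A E C \<psi>\<close>: \<open>\<psi>\<close> is a unital completely positive map from \<open>A\<close> into \<open>C\<close>, where \<open>C\<close> is
  a unital C*-subalgebra of \<open>bop E\<close>.\<close>

definition ucp :: "'h::chilbert_space op set \<Rightarrow> 'l::chilbert_space set \<Rightarrow> 'l op set \<Rightarrow>
    ('h op \<Rightarrow> 'l op) \<Rightarrow> bool" where
  "ucp A E C \<psi> \<longleftrightarrow> \<psi> ` A \<subseteq> C \<and> clinear_on A \<psi> \<and> \<psi> id_blinfun = unit_op E \<and>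
     (\<forall>n a. (\<forall>i<n. \<forall>j<n. a i j \<in> A) \<and> positive_matrix n a \<longrightarrow>
            positive_matrix n (\<lambda>i j. \<psi> (a i j)))"

section \<open>Extension and rigidity properties\<close>

definition unique_extension_property ::
  "'h::chilbert_space op set \<Rightarrow> 'l::chilbert_space set \<Rightarrow> ('h op \<Rightarrow> 'l op) \<Rightarrow> bool" where
  "unique_extension_property S E \<rho> \<longleftrightarrow>
     (\<forall>\<psi>. ucp (cstar S) E (bop E) \<psi> \<and> (\<forall>s\<in>S. \<psi> s = \<rho> s) \<longrightarrow> (\<forall>a\<in>cstar S. \<psi> a = \<rho> a))"

definition boundary_rep ::
  "'h::chilbert_space op set \<Rightarrow> 'l::chilbert_space set \<Rightarrow> ('h op \<Rightarrow> 'l op) \<Rightarrow> bool" where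
  "boundary_rep S E \<rho> \<longleftrightarrow> irreducible_rep (cstar S) E \<rho> \<and> unique_extension_property S E \<rho>"

definition unique_tight_extension_property ::
  "'h::chilbert_space op set \<Rightarrow> 'l::chilbert_space set \<Rightarrow> ('h op \<Rightarrow> 'l op) \<Rightarrow> bool" where
  "unique_tight_extension_property S E \<rho> \<longleftrightarrow>
     (\<forall>\<psi>. ucp (cstar S) E (bicommutant E (\<rho> ` cstar S)) \<psi> \<and> (\<forall>s\<in>S. \<psi> s = \<rho> s) \<longrightarrow>
          (\<forall>a\<in>cstar S. \<psi> a = \<rho> a))"

definition directed_set :: "'i set \<Rightarrow> ('i \<Rightarrow> 'i \<Rightarrow> bool) \<Rightarrow> bool" where
  "directed_set I le \<longleftrightarrow> I \<noteq> {} \<and> (\<forall>i\<in>I. le i i) \<and>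
     (\<forall>i\<in>I. \<forall>j\<in>I. \<forall>k\<in>I. le i j \<and> le j k \<longrightarrow> le i k) \<and>
     (\<forall>i\<in>I. \<forall>j\<in>I. \<exists>k\<in>I. le i k \<and> le j k)"

definition tails :: "'i set \<Rightarrow> ('i \<Rightarrow> 'i \<Rightarrow> bool) \<Rightarrow> 'i filter" where
  "tails I le = (INF i\<in>I. principal {j\<in>I. le i j})"

lemma eventually_tails:
  assumes "directed_set I le"
  shows "eventually P (tails I le) \<longleftrightarrow> (\<exists>i\<in>I. \<forall>j\<in>I. le i j \<longrightarrow> P j)"
proof -
  have "eventually P (tails I le) \<longleftrightarrow> (\<exists>i\<in>I. eventually P (principal {j\<in>I. le i j}))"
    unfolding tails_def
  proof (rule eventually_INF_base)
    show "I \<noteq> {}" using assms by (simp add: directed_set_def)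
  next
    fix i j assume "i \<in> I" "j \<in> I"
    then obtain k where "k \<in> I" "le i k" "le j k"
      using assms unfolding directed_set_def by blast
    moreover from this have "{l\<in>I. le k l} \<subseteq> {l\<in>I. le i l} \<inter> {l\<in>I. le j l}"
      using assms \<open>i \<in> I\<close> \<open>j \<in> I\<close> unfolding directed_set_def by blast
    ultimately show "\<exists>k\<in>I. principal {l\<in>I. le k l} \<le>
        inf (principal {l\<in>I. le i l}) (principal {l\<in>I. le j l})"
      by (intro bexI[of _ k]) (simp_all add: inf_principal)
  qed
  then show ?thesis by (auto simp: eventually_principal)
qed

definition bounded_functional_on :: "'a::{scaleC,real_normed_vector} set \<Rightarrow> ('a \<Rightarrow> complex) \<Rightarrow> bool"
  where
  "bounded_functional_on V f \<longleftrightarrow> clinear_on V f \<and> (\<exists>K. \<forall>x\<in>V. cmod (f x) \<le> K * norm x)"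

definition weakly_tendsto_in ::
  "'a::{scaleC,real_normed_vector} set \<Rightarrow> ('i \<Rightarrow> 'a) \<Rightarrow> 'a \<Rightarrow> 'i filter \<Rightarrow> bool" where
  "weakly_tendsto_in V x l F \<longleftrightarrow>
     (\<forall>f. bounded_functional_on V f \<longrightarrow> ((\<lambda>i. f (x i)) \<longlongrightarrow> f l) F)"

text \<open>The type argument fixes the type in which the index sets of the nets live; it is to be left
  as a type variable where the property is asserted.\<close>

definition korovkin_rigid ::
  "'i itself \<Rightarrow> 'h::chilbert_space op set \<Rightarrow> 'l::chilbert_space set \<Rightarrow> ('h op \<Rightarrow> 'l op) \<Rightarrow> bool"
  where
  "korovkin_rigid (_ :: 'i itself) S E \<rho> \<longleftrightarrow>
     (\<forall>(I :: 'i set) le \<psi>. directed_set I le \<and> (\<forall>i\<in>I. ucp (cstar S) E (\<rho> ` cstar S) (\<psi> i)) \<and>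
        (\<forall>s\<in>S. weakly_tendsto_in (\<rho> ` cstar S) (\<lambda>i. \<psi> i s) (\<rho> s) (tails I le)) \<longrightarrow>
        (\<forall>a\<in>cstar S. weakly_tendsto_in (\<rho> ` cstar S) (\<lambda>i. \<psi> i a) (\<rho> a) (tails I le)))"

definition strongly_korovkin_rigid ::
  "'i itself \<Rightarrow> 'h::chilbert_space op set \<Rightarrow> 'l::chilbert_space set \<Rightarrow> ('h op \<Rightarrow> 'l op) \<Rightarrow> bool"
  where
  "strongly_korovkin_rigid (_ :: 'i itself) S E \<rho> \<longleftrightarrow>
     (\<forall>(I :: 'i set) le \<psi>. directed_set I le \<and> (\<forall>i\<in>I. ucp (cstar S) E (\<rho> ` cstar S) (\<psi> i)) \<and>
        (\<forall>s\<in>S. ((\<lambda>i. \<psi> i s) \<longlongrightarrow> \<rho> s) (tails I le)) \<longrightarrow>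
        (\<forall>a\<in>cstar S. ((\<lambda>i. \<psi> i a) \<longlongrightarrow> \<rho> a) (tails I le)))"

end

theory Submission
  imports Defs
begin

text \<open>
  Write \<open>A = C\<^sup>*(S)\<close>. Two kinds of irreducible representations of \<open>A\<close> are boundary
  representations: the identity representation on \<open>H\<close>, and the characters of \<open>A\<close>. For a unital
  completely positive map agreeing with a representation \<open>\<rho>\<close> on \<open>S\<close>, or converging to it there,
  the first kind controls what happens on the part of \<open>\<rho>\<close> generated by the compact operators, and
  the second kind what happens modulo the compact operators. Every statement is obtained by
  combining the two.

  The compact part. If \<open>\<rho>\<close> does not vanish on the compact operators, then \<open>H\<close> embeds isometrically
  into \<open>L\<close> by maps \<open>V\<close> with \<open>\<rho>(a) V = V a\<close> (\<open>exists_intertwiner\<close>). The compressions \<open>V\<^sup>* \<psi>\<^sub>i V\<close> of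
  a net of unital completely positive maps have cluster points in the topology of pointwise
  convergence of sesquilinear forms. A cluster point that is the identity on \<open>S\<close> is the identity
  on \<open>A\<close>, so \<open>V\<^sup>* \<psi>\<^sub>i(a) V\<close> converges to \<open>a\<close> (\<open>compression_converges\<close>).

  The commutative part. A state of \<open>A\<close> which agrees on \<open>S\<close> with a character is equal to it, and by
  compactness a state close to a character on a suitable finite subset of \<open>S\<close> is close to it at a
  given element, uniformly in both (\<open>state_near_character\<close>). Characters are supplied by joint
  approximate eigenvectors: a family of operators which commute up to an error set \<open>J\<close> that almost
  vanishes at suitable unit vectors has a character, and the character does not vanish at a
  prescribed self-adjoint member that stays away from zero at these vectors
  (\<open>exists_character\<close>).

  Tight extensions (\<open>unique_tight_extension\<close>). Let \<open>D = \<psi> - \<rho>\<close>, where \<open>\<psi>\<close> maps into the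
  bicommutant of the range of \<open>\<rho>\<close>. Elements of the bicommutant leave the range of every \<open>V\<close>
  invariant, so the first part yields \<open>D(a) = 0\<close> on the subspace generated by the compact
  operators. On its orthogonal complement the bicommutant is commutative. If \<open>D(a)\<close> did not vanish
  there, a character \<open>\<phi>\<close> of the bicommutant with \<open>\<phi>(D(a)) \<noteq> 0\<close> would give a state \<open>\<phi> \<circ> \<psi>\<close> and a
  different character \<open>\<phi> \<circ> \<rho>\<close> agreeing with it on \<open>S\<close>.

  Strong rigidity (\<open>ucp_near_rep\<close>). If \<open>\<psi>\<close> takes values in the range of \<open>\<rho>\<close> and is close to \<open>\<rho>\<close> in
  norm on a finite subset of \<open>S\<close>, then \<open>\<psi>(a) - \<rho>(a)\<close> is close to the image of the compact
  operators, because characters of the range of \<open>\<rho>\<close> which kill this image compute the distance.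
  For a representation annihilating the compact operators this is convergence in norm.

  Weak rigidity (\<open>korovkin_rigidity\<close>). A functional \<open>f\<close> on the range of \<open>\<rho>\<close> splits as \<open>f(\<rho>(Q) \<cdot>) +
  f((1 - \<rho>(Q)) \<cdot>)\<close> with a finite-rank projection \<open>Q\<close>. By the Riesz theorem the first summand is a
  sum of matrix coefficients of compressions to \<open>H\<close>. For suitable \<open>Q\<close> the second summand almost
  vanishes on the image of the compact operators (\<open>functional_nearly_vanishes_on_compacts\<close>). If it
  failed to converge, it would stay away from its limit on convex combinations of the \<open>\<psi>\<^sub>i\<close>, and
  by the Hahn-Banach theorem some of these are close to \<open>\<rho>\<close> in norm on a given finite subset of
  \<open>S\<close> (\<open>norm_close_on_finite_set\<close>), which contradicts strong rigidity modulo the compact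
  operators.
\<close>

section \<open>Geometry of complex Hilbert spaces\<close>

lemma cinner_add_left: "cinner (x + y) (z::'a::chilbert_space) = cinner x z + cinner y z"
  by (metis cinner_add_right cinner_commute complex_cnj_add)

lemma cinner_scaleC_left: "cinner (c *\<^sub>C x) (y::'a::chilbert_space) = cnj c * cinner x y"
  by (metis cinner_commute cinner_scaleC_right complex_cnj_mult)

lemma cinner_scaleR_right: "cinner x (r *\<^sub>R y) = r *\<^sub>R cinner x (y::'a::chilbert_space)"
  by (simp add: scaleR_scaleC cinner_scaleC_right scaleC_complex_def)

lemma cinner_scaleR_left: "cinner (r *\<^sub>R x) y = r *\<^sub>R cinner x (y::'a::chilbert_space)"
  by (simp add: scaleR_scaleC cinner_scaleC_left scaleC_complex_def)

lemma cinner_zero [simp]: "cinner 0 (y::'a::chilbert_space) = 0" "cinner y (0::'a) = 0"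
  using cinner_scaleR_left[of 0 y y] cinner_scaleR_right[of y 0 y] by auto

lemma cinner_minus: "cinner (- x) (y::'a::chilbert_space) = - cinner x y"
   "cinner x (- y::'a::chilbert_space) = - cinner x y"
  using cinner_scaleR_left[of "-1" x y] cinner_scaleR_right[of x "-1" y] by auto

lemma cinner_diff: "cinner (x - y) (z::'a::chilbert_space) = cinner x z - cinner y z"
  "cinner z (x - y::'a::chilbert_space) = cinner z x - cinner z y"
  using cinner_add_left[of x "- y" z] cinner_add_right[of z x "- y"] by (auto simp: cinner_minus)

lemma norm_sq_cinner: "(norm (x::'a::chilbert_space))\<^sup>2 = Re (cinner x x)"
  by (simp add: cinner_self)

lemma norm_add_sq: "(norm (x + y::'a::chilbert_space))\<^sup>2 = (norm x)\<^sup>2 + 2 * Re (cinner x y)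
    + (norm y)\<^sup>2"
  unfolding norm_sq_cinner
  by (simp add: cinner_add_left cinner_add_right cinner_commute[of y x])

lemma norm_diff_sq: "(norm (x - y::'a::chilbert_space))\<^sup>2 = (norm x)\<^sup>2 - 2 * Re (cinner x y)
    + (norm y)\<^sup>2"
  unfolding norm_sq_cinner
  by (simp add: cinner_diff cinner_commute[of y x])

lemma cinner_self_eq_0 [simp]: "cinner x x = 0 \<longleftrightarrow> x = (0::'a::chilbert_space)"
  by (simp add: cinner_self)

lemma norm_preserves_inner:
  assumes "\<And>x y. cinner (V x) (V y) = cinner x y"
  shows "norm (V x :: 'b::chilbert_space) = norm (x :: 'a::chilbert_space)"
proof -
  have "(norm (V x))\<^sup>2 = (norm x)\<^sup>2" by (simp add: norm_sq_cinner assms)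
  then show ?thesis by (simp add: power2_eq_iff_nonneg)
qed

lemma cinner_ext:
  assumes "\<And>x. cinner x y = cinner x (z::'a::chilbert_space)"
  shows "y = z"
  using assms[of "y - z"] cinner_self_eq_0[of "y - z"] by (simp add: cinner_diff)

lemma cauchy_schwarz: "cmod (cinner x y) \<le> norm x * norm (y::'a::chilbert_space)"
proof (cases "y = 0")
  case False
  let ?n = "(norm y)\<^sup>2" and ?z = "cinner y x"
  have n: "?n > 0" using False by simp
  have "0 \<le> (norm (?n *\<^sub>R x - ?z *\<^sub>C y))\<^sup>2" by simp
  also have "\<dots> = ?n\<^sup>2 * (norm x)\<^sup>2 - 2 * (?n * (cmod ?z)\<^sup>2) + (cmod ?z)\<^sup>2 * ?n"
  proof -
    have "Re (cinner (?n *\<^sub>R x) (?z *\<^sub>C y)) = ?n * (cmod ?z)\<^sup>2"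
      unfolding cmod_power2
      by (simp add: cinner_scaleR_left cinner_scaleC_right cinner_commute[of x y])
        (simp add: power2_eq_square)
    then show ?thesis
      by (simp add: norm_diff_sq norm_scaleC power_mult_distrib)
  qed
  also have "\<dots> = ?n * (?n * (norm x)\<^sup>2 - (cmod ?z)\<^sup>2)" by (simp add: algebra_simps power2_eq_square)
  finally have "(cmod ?z)\<^sup>2 \<le> ?n * (norm x)\<^sup>2" using n by (simp add: zero_le_mult_iff)
  then have "cmod ?z \<le> norm y * norm x"
    by (metis mult_nonneg_nonneg norm_ge_zero power2_le_imp_le power_mult_distrib)
  then show ?thesis by (metis cinner_commute complex_mod_cnj mult.commute)
qed simp

interpretation cinner: bounded_bilinear "cinner :: 'a::chilbert_space \<Rightarrow> 'a \<Rightarrow> complex"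
  by unfold_locales
    (auto simp: cinner_add_left cinner_add_right cinner_scaleR_left cinner_scaleR_right
      intro!: exI[of _ 1] cauchy_schwarz)

interpretation scaleC: bounded_bilinear "scaleC :: complex \<Rightarrow> 'a::chilbert_space \<Rightarrow> 'a"
  by unfold_locales
    (auto simp: scaleC_add_left scaleC_add_right scaleR_scaleC scaleC_scaleC norm_scaleC
      scaleC_complex_def mult.commute intro!: exI[of _ 1])

lemma scaleC_zero [simp]: "0 *\<^sub>C (x::'a::chilbert_space) = 0" "c *\<^sub>C (0::'a) = 0"
  by (simp_all add: scaleC.zero_left scaleC.zero_right)

lemma scaleC_one [simp]: "1 *\<^sub>C (x::'a::chilbert_space) = x"
  using scaleR_scaleC[of 1 x] by simp

lemma csubspaceD:
  assumes "csubspace V"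
  shows "0 \<in> V" "x \<in> V \<Longrightarrow> y \<in> V \<Longrightarrow> x + y \<in> V" "x \<in> V \<Longrightarrow> c *\<^sub>C x \<in> V"
  using assms by (auto simp: csubspace_def)

lemma csubspace_diff:
  assumes "csubspace (V::'a::chilbert_space set)" "x \<in> V" "y \<in> V"
  shows "x - y \<in> V"
  using csubspaceD(2)[OF assms(1,2) csubspaceD(3)[OF assms(1,3), of "-1"]]
  by (simp add: scaleC.minus_left)

text \<open>A minimising sequence for the distance is Cauchy by the parallelogram law, and a nearest
  point is orthogonal because moving it along the subspace cannot help.\<close>

lemma orthogonal_decomposition:
  fixes M :: "'a::chilbert_space set"
  assumes "closed_csubspace M"
  shows "\<exists>m\<in>M. \<forall>y\<in>M. cinner y (x - m) = 0"
proof -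
  have sub: "csubspace M" and cl: "closed M" using assms by (auto simp: closed_csubspace_def)
  have ne: "M \<noteq> {}" using csubspaceD(1)[OF sub] by auto
  define d where "d = infdist x M"
  have d0: "0 \<le> d" by (simp add: d_def infdist_nonneg)
  have dle: "d \<le> norm (x - a)" if "a \<in> M" for a
    using infdist_le[OF that, of x] by (simp add: d_def dist_norm)
  have "\<exists>a\<in>M. norm (x - a) < d + 1 / Suc n" for n
  proof -
    have "(INF a\<in>M. dist x a) < d + 1 / Suc n" using ne by (simp add: d_def infdist_notempty)
    then show ?thesis
      using ne by (subst (asm) cINF_less_iff) (auto simp: dist_norm intro: bdd_belowI[of _ 0])
  qed
  then obtain s where s: "\<And>n. s n \<in> M" "\<And>n. norm (x - s n) < d + 1 / Suc n" by metis
  have lim: "(\<lambda>n. norm (x - s n)) \<longlonglongrightarrow> d"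
  proof (rule tendsto_sandwich[of "\<lambda>_. d" _ _ "\<lambda>n. d + 1 / Suc n"])
    show "(\<lambda>n. d + 1 / real (Suc n)) \<longlonglongrightarrow> d"
      using tendsto_add[OF tendsto_const[of d] LIMSEQ_inverse_real_of_nat]
      by (simp add: inverse_eq_divide)
  qed (use s dle in \<open>auto intro!: always_eventually less_imp_le\<close>)
  have par: "(norm (s m - s n))\<^sup>2 \<le> 2 * ((norm (x - s m))\<^sup>2 - d\<^sup>2)
      + 2 * ((norm (x - s n))\<^sup>2 - d\<^sup>2)" for m n
  proof -
    have mid: "(1/2) *\<^sub>R (s m + s n) \<in> M"
      using s sub by (simp add: scaleR_scaleC csubspaceD)
    have "(norm (s m - s n))\<^sup>2 + (norm ((x - s m) + (x - s n)))\<^sup>2 = 2 * (norm (x - s m))\<^sup>2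
        + 2 * (norm (x - s n))\<^sup>2"
    proof -
      have "s m - s n = (x - s n) - (x - s m)" by simp
      then have "(norm (s m - s n))\<^sup>2 = (norm (x - s n))\<^sup>2 - 2 * Re (cinner (x - s n) (x - s m))
          + (norm (x - s m))\<^sup>2"
        by (metis norm_diff_sq)
      moreover have "Re (cinner (x - s n) (x - s m)) = Re (cinner (x - s m) (x - s n))"
        by (subst cinner_commute) simp
      ultimately show ?thesis by (simp add: norm_add_sq)
    qed
    moreover have "norm ((x - s m) + (x - s n)) = 2 * norm (x - (1/2) *\<^sub>R (s m + s n))"
    proof -
      have "(x - s m) + (x - s n) = 2 *\<^sub>R (x - (1/2) *\<^sub>R (s m + s n))"
        by (simp add: algebra_simps scaleR_2)
      then show ?thesis by simp
    qed
    moreover have "d\<^sup>2 \<le> (norm (x - (1/2) *\<^sub>R (s m + s n)))\<^sup>2"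
      using dle[OF mid] d0 by (simp add: power_mono)
    ultimately show ?thesis by (simp add: power_mult_distrib)
  qed
  have "Cauchy s"
  proof (rule metric_CauchyI)
    fix e :: real assume "0 < e"
    have "(\<lambda>n. (norm (x - s n))\<^sup>2 - d\<^sup>2) \<longlonglongrightarrow> d\<^sup>2 - d\<^sup>2" by (intro tendsto_intros lim)
    then have "\<forall>\<^sub>F n in sequentially. (norm (x - s n))\<^sup>2 - d\<^sup>2 < e\<^sup>2 / 4"
      using \<open>0 < e\<close> by (intro order_tendstoD(2)) auto
    then obtain N where N: "\<And>n. n \<ge> N \<Longrightarrow> (norm (x - s n))\<^sup>2 - d\<^sup>2 < e\<^sup>2 / 4"
      by (auto simp: eventually_sequentially)
    show "\<exists>N. \<forall>m\<ge>N. \<forall>n\<ge>N. dist (s m) (s n) < e"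
    proof (intro exI allI impI)
      fix m n assume "m \<ge> N" "n \<ge> N"
      then have "(norm (s m - s n))\<^sup>2 < e\<^sup>2" using par[of m n] N[of m] N[of n] by simp
      then show "dist (s m) (s n) < e"
        using \<open>0 < e\<close> by (simp add: dist_norm power2_less_imp_less)
    qed
  qed
  then obtain m where m: "s \<longlonglongrightarrow> m" by (auto simp: Cauchy_convergent_iff convergent_def)
  have mM: "m \<in> M" using cl s(1) m by (metis closed_sequentially)
  have dm: "norm (x - m) = d"
    by (rule LIMSEQ_unique[OF _ lim]) (intro tendsto_intros m)
  have "cinner y (x - m) = 0" if y: "y \<in> M" for y
  proof (rule ccontr)
    define z where "z = cinner y (x - m)"
    assume "cinner y (x - m) \<noteq> 0"
    then have z: "(cmod z)\<^sup>2 > 0" by (simp add: z_def)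
    have ineq: "2 * t * (cmod z)\<^sup>2 \<le> t\<^sup>2 * (cmod z)\<^sup>2 * (norm y)\<^sup>2" for t :: real
    proof -
      let ?c = "of_real t * z"
      have "m + ?c *\<^sub>C y \<in> M" using mM y sub by (simp add: csubspaceD)
      then have "d\<^sup>2 \<le> (norm (x - (m + ?c *\<^sub>C y)))\<^sup>2" using dle d0 by (simp add: power_mono)
      also have "x - (m + ?c *\<^sub>C y) = (x - m) - ?c *\<^sub>C y" by simp
      also have "(norm \<dots>)\<^sup>2 = d\<^sup>2 - 2 * (t * (cmod z)\<^sup>2) + t\<^sup>2 * (cmod z)\<^sup>2 * (norm y)\<^sup>2"
      proof -
        have "cinner (x - m) (?c *\<^sub>C y) = of_real t * (z * cnj z)"
          by (simp add: cinner_scaleC_right cinner_commute[of "x - m" y] flip: z_def)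
        then have "Re (cinner (x - m) (?c *\<^sub>C y)) = t * (cmod z)\<^sup>2"
          by (simp flip: complex_norm_square of_real_mult)
        then show ?thesis
          by (simp add: norm_diff_sq norm_scaleC norm_mult power_mult_distrib dm)
      qed
      finally show ?thesis by simp
    qed
    have "2 * t \<le> t\<^sup>2 * (norm y)\<^sup>2" for t :: real
      using ineq[of t] z by (simp add: mult.assoc mult.left_commute[of _ "(cmod z)\<^sup>2"])
    then have "2 * t \<le> t * (t * (norm y)\<^sup>2)" for t :: real
      by (simp add: power2_eq_square mult.assoc)
    from this[of "1 / ((norm y)\<^sup>2 + 1)"]
    have "2 * (1 / ((norm y)\<^sup>2 + 1)) \<le> 1 / ((norm y)\<^sup>2 + 1) * 1"
      by (rule order_trans) (intro mult_left_mono, simp_all add: divide_le_eq add_nonneg_pos)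
    moreover have "1 / ((norm y)\<^sup>2 + 1) > 0" by (simp add: add_nonneg_pos)
    ultimately show False by linarith
  qed
  then show ?thesis using mM by blast
qed

section \<open>Bounded operators and their adjoints\<close>

lemma blinfun_scaleC [simp]: "blinfun_apply (c *\<^sub>C T) x = c *\<^sub>C (blinfun_apply T x)"
  by (simp add: scaleC_blinfun.rep_eq)

lemma bop_UNIV: "(T::'a::chilbert_space op) \<in> bop UNIV \<longleftrightarrow> (\<forall>c x. T (c *\<^sub>C x) = c *\<^sub>C T x)"
proof -
  have "x = 0" if "\<forall>y. cinner y x = 0" for x :: 'a using that cinner_ext[of x 0] by simp
  then have "(\<forall>y. cinner y x = 0) \<longleftrightarrow> x = 0" for x :: 'a by auto
  then show ?thesis by (auto simp: bop_def blinfun.zero_right)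
qed

lemma bop_subset_UNIV: "T \<in> bop E \<Longrightarrow> T \<in> bop UNIV"
  by (simp add: bop_UNIV) (simp add: bop_def)

lemma bop_scaleC: "T \<in> bop E \<Longrightarrow> T (c *\<^sub>C x) = c *\<^sub>C T x"
  by (simp add: bop_def)

lemma bop_range: "T \<in> bop E \<Longrightarrow> T x \<in> E"
  by (auto simp: bop_def)


lemma bounded_linear_clinearI:
  fixes f :: "'a::chilbert_space \<Rightarrow> 'b::chilbert_space"
  assumes "\<And>x y. f (x + y) = f x + f y" "\<And>c x. f (c *\<^sub>C x) = c *\<^sub>C f x"
    "\<And>x. norm (f x) \<le> K * norm x"
  shows "bounded_linear f"
  by (rule bounded_linear_intro[of _ K]) (use assms in \<open>auto simp: scaleR_scaleC mult.commute\<close>)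

text \<open>The definite description defining \<open>unit_op\<close> is satisfied by the orthogonal projection only:
  an operator in \<open>bop E\<close> is determined by its values on \<open>E\<close>, since it vanishes on the complement.\<close>

lemma unit_op:
  fixes E :: "'a::chilbert_space set"
  assumes E: "closed_csubspace E"
  shows "unit_op E \<in> bop E" "\<And>x. x \<in> E \<Longrightarrow> unit_op E x = x"
    "\<And>x y. y \<in> E \<Longrightarrow> cinner y (unit_op E x) = cinner y x"
proof -
  have sub: "csubspace E" using E by (simp add: closed_csubspace_def)
  obtain p where p: "\<And>x. p x \<in> E" "\<And>x y. y \<in> E \<Longrightarrow> cinner y (x - p x) = 0"
    using orthogonal_decomposition[OF E] by metis
  have puniq: "p x = m" if "m \<in> E" "\<And>y. y \<in> E \<Longrightarrow> cinner y (x - m) = 0" for x m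
  proof -
    have d: "p x - m \<in> E" using csubspace_diff[OF sub p(1) that(1)] .
    have "cinner (p x - m) (p x - m) = cinner (p x - m) (x - m) - cinner (p x - m) (x - p x)"
      by (simp add: cinner_diff)
    then show ?thesis using p(2)[OF d] that(2)[OF d] by simp
  qed
  have padd: "p (x + y) = p x + p y" for x y
  proof (rule puniq)
    show "cinner z (x + y - (p x + p y)) = 0" if "z \<in> E" for z
      using p(2)[OF that, of x] p(2)[OF that, of y] by (simp add: cinner_diff cinner_add_right)
  qed (use sub p in \<open>simp add: csubspaceD\<close>)
  have pscale: "p (c *\<^sub>C x) = c *\<^sub>C p x" for c x
  proof (rule puniq)
    show "cinner z (c *\<^sub>C x - c *\<^sub>C p x) = 0" if "z \<in> E" for z
      using p(2)[OF that, of x] by (simp add: cinner_diff cinner_scaleC_right)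
  qed (use sub p in \<open>simp add: csubspaceD\<close>)
  have pnorm: "norm (p x) \<le> 1 * norm x" for x
  proof -
    have "(norm x)\<^sup>2 = (norm (p x + (x - p x)))\<^sup>2" by simp
    also have "\<dots> = (norm (p x))\<^sup>2 + (norm (x - p x))\<^sup>2"
      by (subst norm_add_sq) (simp add: p)
    finally show ?thesis
      by (simp add: power2_le_imp_le)
  qed
  have bl: "bounded_linear p" by (rule bounded_linear_clinearI[OF padd pscale pnorm])
  let ?P = "Blinfun p"
  have Papp: "?P x = p x" for x by (simp add: bounded_linear_Blinfun_apply bl)
  have P: "?P \<in> bop E"
    by (auto simp: bop_def Papp pscale p(1)) (rule puniq, auto simp: csubspaceD(1)[OF sub])
  have Pid: "?P x = x" if "x \<in> E" for x
    unfolding Papp by (rule puniq) (use that in auto)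
  have eq: "unit_op E = ?P"
    unfolding unit_op_def
  proof (rule the_equality)
    fix R assume R: "R \<in> bop E \<and> (\<forall>x\<in>E. R x = x)"
    show "R = ?P"
    proof (rule blinfun_eqI)
      fix x
      have "R (x - p x) = 0" using R p(2) by (auto simp: bop_def)
      then have "R x = R (p x)" by (simp add: blinfun.diff_right)
      then show "R x = ?P x" using R p(1) by (simp add: Papp)
    qed
  qed (use P Pid in auto)
  show "unit_op E \<in> bop E" "\<And>x. x \<in> E \<Longrightarrow> unit_op E x = x" using P Pid eq by auto
  show "cinner y (unit_op E x) = cinner y x" if "y \<in> E" for x y
    using p(2)[OF that, of x] by (simp add: eq Papp cinner_diff)
qed

lemma unit_op_UNIV: "unit_op UNIV = id_blinfun"
  using unit_op(2)[of UNIV] by (intro blinfun_eqI) (simp add: closed_csubspace_def csubspace_def)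

lemma unit_op_selfadjoint:
  assumes "closed_csubspace E"
  shows "cinner (unit_op E x) y = cinner x (unit_op E y)"
proof -
  have "cinner (unit_op E x) y = cinner (unit_op E x) (unit_op E y)"
    using unit_op[OF assms] bop_range by metis
  also have "\<dots> = cnj (cinner (unit_op E y) (unit_op E x))" by (rule cinner_commute)
  also have "\<dots> = cnj (cinner (unit_op E y) x)"
    using unit_op[OF assms] bop_range by metis
  finally show ?thesis by (simp flip: cinner_commute)
qed

lemma norm_unit_op:
  assumes "closed_csubspace E"
  shows "norm (unit_op E x) \<le> norm x"
proof (cases "unit_op E x = 0")
  case False
  have "(norm (unit_op E x))\<^sup>2 = Re (cinner (unit_op E x) x)"
    using unit_op(3)[OF assms bop_range[OF unit_op(1)[OF assms]]] by (simp add: norm_sq_cinner)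
  also have "\<dots> \<le> norm (unit_op E x) * norm x"
    by (rule order_trans[OF complex_Re_le_cmod cauchy_schwarz])
  finally show ?thesis using False by (simp add: power2_eq_square)
qed simp

lemma bop_unit_right:
  assumes E: "closed_csubspace E" and T: "T \<in> bop E"
  shows "T (unit_op E x) = T x"
proof -
  have "T (x - unit_op E x) = 0"
    using T unit_op(3)[OF E] by (auto simp: bop_def cinner_diff)
  then show ?thesis by (simp add: blinfun.diff_right)
qed

lemma bop_unit_left:
  assumes E: "closed_csubspace E" and T: "T \<in> bop E"
  shows "unit_op E (T x) = T x"
  by (rule unit_op(2)[OF E bop_range[OF T]])

text \<open>The representing vector is a multiple of a vector orthogonal to the kernel of \<open>f\<close>.\<close>

lemma riesz_representation:
  fixes f :: "'a::chilbert_space \<Rightarrow> complex"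
  assumes add: "\<And>x y. f (x + y) = f x + f y" and scale: "\<And>c x. f (c *\<^sub>C x) = c * f x"
    and bd: "\<And>x. cmod (f x) \<le> K * norm x"
  shows "\<exists>z. \<forall>x. f x = cinner z x"
proof (cases "\<forall>x. f x = 0")
  case False
  then obtain x0 where x0: "f x0 \<noteq> 0" by blast
  have bl: "bounded_linear f"
    by (rule bounded_linear_clinearI[where K = K]) (use assms in \<open>auto simp: scaleC_complex_def\<close>)
  let ?M = "{x. f x = 0}"
  have f0: "f 0 = 0" using linear_simps(3)[OF bl] .
  have "closed ?M"
    by (intro closed_Collect_eq linear_continuous_on bl continuous_intros)
  then have M: "closed_csubspace ?M"
    by (auto simp: closed_csubspace_def csubspace_def add scale f0)
  obtain m where m: "f m = 0" "\<And>y. f y = 0 \<Longrightarrow> cinner y (x0 - m) = 0"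
    using orthogonal_decomposition[OF M, of x0] by auto
  define w where "w = x0 - m"
  have fw: "f w = f x0" using linear_simps(2)[OF bl] m by (simp add: w_def)
  have w: "w \<noteq> 0" using fw x0 f0 by auto
  have "f x = cinner ((cnj (f w) / of_real ((norm w)\<^sup>2)) *\<^sub>C w) x" for x
  proof -
    have "f (f w *\<^sub>C x - f x *\<^sub>C w) = 0" using linear_simps(2)[OF bl] by (simp add: scale)
    then have "cinner (f w *\<^sub>C x - f x *\<^sub>C w) w = 0" using m(2) by (simp add: w_def)
    then have "cinner w (f w *\<^sub>C x - f x *\<^sub>C w) = 0" using cinner_commute[of w] by simp
    then have "f w * cinner w x = f x * of_real ((norm w)\<^sup>2)"
      by (simp add: cinner_diff cinner_scaleC_right cinner_self)
    then show ?thesis using w by (simp add: cinner_scaleC_left field_simps)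
  qed
  then show ?thesis by blast
qed (auto intro: exI[of _ 0])

text \<open>Adjoints arise from this, and so do cluster points of completely positive maps, which are
  first obtained as limits of sesquilinear forms.\<close>

lemma operator_of_form:
  fixes B :: "'a::chilbert_space \<Rightarrow> 'a \<Rightarrow> complex"
  assumes add1: "\<And>x x' y. B (x + x') y = B x y + B x' y"
      and add2: "\<And>x y y'. B x (y + y') = B x y + B x y'"
    and scale1: "\<And>c x y. B (c *\<^sub>C x) y = cnj c * B x y"
    and scale2: "\<And>c x y. B x (c *\<^sub>C y) = c * B x y"
    and bd: "\<And>x y. cmod (B x y) \<le> K * norm x * norm y"
  shows "\<exists>T\<in>bop UNIV. \<forall>x y. cinner x (T y) = B x y"
proof -
  have "\<exists>z. \<forall>x. cnj (B x y) = cinner z x" for y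
    by (rule riesz_representation[where K = "K * norm y"])
        (use bd in \<open>auto simp: add1 scale1 algebra_simps\<close>)
  then obtain t where "\<And>x y. cnj (B x y) = cinner (t y) x" by metis
  then have t: "cinner x (t y) = B x y" for x y by (metis cinner_commute complex_cnj_cnj)
  have bl: "bounded_linear t"
  proof (rule bounded_linear_clinearI[where K = K])
    show "t (x + y) = t x + t y" for x y by (rule cinner_ext) (simp add: t cinner_add_right add2)
    show "t (c *\<^sub>C x) = c *\<^sub>C t x" for c x
      by (rule cinner_ext) (simp add: t cinner_scaleC_right scale2)
    show "norm (t x) \<le> K * norm x" for x
    proof (cases "t x = 0")
      case True
      have "0 \<le> K * norm x * norm x" using order_trans[OF norm_ge_zero bd] .
      then show ?thesis using True by (cases "x = 0") (auto simp: zero_le_mult_iff)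
    next
      case False
      have "norm (t x) * norm (t x) = cmod (B (t x) x)"
        unfolding t[symmetric] cinner_self by (simp add: power2_eq_square norm_mult)
      also have "\<dots> \<le> K * norm (t x) * norm x" by (rule bd)
      finally show ?thesis using False by (simp add: mult.assoc mult.left_commute[of K])
    qed
  qed
  have "Blinfun t \<in> bop UNIV"
    by (auto simp: bop_UNIV bounded_linear_Blinfun_apply bl intro!: cinner_ext[of "t _"])
      (simp add: t cinner_scaleC_right scale2)
  then show ?thesis by (rule bexI[rotated]) (simp add: bounded_linear_Blinfun_apply bl t)
qed

lemma adj_eqI:
  fixes T R :: "'a::chilbert_space op"
  assumes "\<And>x y. cinner (T x) y = cinner x (R y)"
  shows "adj T = R"
  unfolding adj_def
proof (rule the_equality)
  show "\<forall>x y. cinner (T x) y = cinner x (R y)" by (intro allI assms)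
  fix R' :: "'a op" assume R': "\<forall>x y. cinner (T x) y = cinner x (R' y)"
  have "cinner x (R' y) = cinner x (R y)" for x y
    using R'[rule_format, of x y] assms[of x y] by (rule trans[OF sym])
  then show "R' = R" by (intro blinfun_eqI) (rule cinner_ext)
qed

lemma adj_bop_UNIV_cinner:
  assumes T: "T \<in> bop UNIV"
  shows "adj T \<in> bop UNIV \<and> (\<forall>x y. cinner (T x) y = cinner x (adj T y))"
proof -
  have "\<exists>R\<in>bop UNIV. \<forall>x y. cinner x (R y) = cinner (T x) y"
  proof (rule operator_of_form[where K = "norm T"])
    fix x y
    show "cmod (cinner (T x) y) \<le> norm T * norm x * norm y"
      by (rule order_trans[OF cauchy_schwarz mult_right_mono[OF norm_blinfun norm_ge_zero]])
  qed (use T in \<open>auto simp: bop_UNIV blinfun.add_right cinner_add_left cinner_add_right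
      cinner_scaleC_left cinner_scaleC_right\<close>)
  then obtain R where R: "R \<in> bop UNIV" "\<And>x y. cinner x (R y) = cinner (T x) y" by blast
  then have "adj T = R" by (intro adj_eqI R(2)[symmetric])
  then show ?thesis using R(1) by (simp add: R(2))
qed

lemma cinner_adj:
  assumes "T \<in> bop UNIV"
  shows "cinner x (adj T y) = cinner (T x) y" "cinner (adj T x) y = cinner x (T y)"
proof -
  show *: "cinner x (adj T y) = cinner (T x) y" for x y using adj_bop_UNIV_cinner[OF assms] by simp
  show "cinner (adj T x) y = cinner x (T y)"
    by (simp add: cinner_commute[of "adj T x" y] cinner_commute[of x "T y"] *)
qed

lemma adj_bop_UNIV: "T \<in> bop UNIV \<Longrightarrow> adj T \<in> bop UNIV"
  using adj_bop_UNIV_cinner by blast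

lemma adj_bop:
  assumes E: "closed_csubspace E" and T: "T \<in> bop E"
  shows "adj T \<in> bop E"
proof -
  have TU: "T \<in> bop UNIV" by (rule bop_subset_UNIV[OF T])
  have "unit_op E (adj T y) = adj T y" for y
    by (rule cinner_ext)
      (simp add: unit_op_selfadjoint[OF E, symmetric] cinner_adj[OF TU] bop_unit_right[OF E T])
  then have "range (adj T) \<subseteq> E" by (metis (lifting) bop_range[OF unit_op(1)[OF E]] image_subsetI)
  moreover have "adj T x = 0" if "\<forall>y\<in>E. cinner y x = 0" for x
    by (rule cinner_ext) (simp add: cinner_adj[OF TU] that bop_range[OF T])
  ultimately show ?thesis using adj_bop_UNIV[OF TU] by (auto simp: bop_def)
qed

lemma adj_adj [simp]: "T \<in> bop UNIV \<Longrightarrow> adj (adj T) = T"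
  by (rule adj_eqI) (simp add: cinner_adj)

lemma bop_compose: "T \<in> bop UNIV \<Longrightarrow> R \<in> bop UNIV \<Longrightarrow> T o\<^sub>L R \<in> bop UNIV"
  by (simp add: bop_UNIV)


lemma csubspace_bop:
  assumes "csubspace E"
  shows "csubspace (bop E)"
  unfolding csubspace_def
proof (intro conjI ballI allI)
  show "0 \<in> bop E" using csubspaceD(1)[OF assms] by (auto simp: bop_def)
next
  fix T R assume "T \<in> bop E" "R \<in> bop E"
  then show "T + R \<in> bop E" using csubspaceD(2)[OF assms]
    by (auto simp: bop_def blinfun.add_left scaleC_add_right image_subset_iff)
next
  fix c T assume "T \<in> bop E"
  then show "c *\<^sub>C T \<in> bop E" using csubspaceD(3)[OF assms]
    by (auto simp: bop_def scaleC_scaleC mult.commute image_subset_iff)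
qed

lemma csubspace_UNIV: "csubspace (UNIV :: 'a::chilbert_space set)"
  by (simp add: csubspace_def)

lemma closed_csubspace_UNIV: "closed_csubspace (UNIV :: 'a::chilbert_space set)"
  by (simp add: closed_csubspace_def csubspace_UNIV)

lemma adj_add: "T \<in> bop UNIV \<Longrightarrow> R \<in> bop UNIV \<Longrightarrow> adj (T + R) = adj T + adj R"
  by (rule adj_eqI) (simp add: cinner_adj blinfun.add_left cinner_add_left cinner_add_right)

lemma adj_scaleC: "T \<in> bop UNIV \<Longrightarrow> adj (c *\<^sub>C T) = cnj c *\<^sub>C adj T"
  by (rule adj_eqI) (simp add: cinner_adj cinner_scaleC_left cinner_scaleC_right)


lemma adj_zero [simp]: "adj 0 = 0"
  by (rule adj_eqI) simp

lemma norm_adj: "T \<in> bop UNIV \<Longrightarrow> norm (adj T) \<le> norm T"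
proof (rule norm_blinfun_bound)
  fix x assume T: "T \<in> bop UNIV"
  show "norm (adj T x) \<le> norm T * norm x"
  proof (cases "adj T x = 0")
    case False
    have "(norm (adj T x))\<^sup>2 = Re (cinner (T (adj T x)) x)"
      by (simp add: norm_sq_cinner cinner_adj[OF T])
    also have "\<dots> \<le> norm (T (adj T x)) * norm x"
      by (rule order_trans[OF complex_Re_le_cmod cauchy_schwarz])
    also have "\<dots> \<le> norm T * norm (adj T x) * norm x" by (simp add: mult_right_mono norm_blinfun)
    finally show ?thesis using False by (simp add: power2_eq_square)
  qed simp
qed simp

text \<open>The type of bounded operators carries the scalar multiplication only as syntax, so its
  vector space laws have to be stated.\<close>

lemma scaleC_op_simps:
  fixes T R :: "'a::real_normed_vector \<Rightarrow>\<^sub>L 'b::chilbert_space"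
  shows "c *\<^sub>C (T + R) = c *\<^sub>C T + c *\<^sub>C R" "c *\<^sub>C (T - R) = c *\<^sub>C T - c *\<^sub>C R"
    "(c + d) *\<^sub>C T = c *\<^sub>C T + d *\<^sub>C T" "c *\<^sub>C d *\<^sub>C T = (c * d) *\<^sub>C T"
    "1 *\<^sub>C T = T" "(- 1) *\<^sub>C T = - T" "c *\<^sub>C (0 :: 'a \<Rightarrow>\<^sub>L 'b) = 0" "0 *\<^sub>C T = 0"
    "complex_of_real r *\<^sub>C T = r *\<^sub>R T"
  by (auto intro!: blinfun_eqI simp: blinfun.add_left blinfun.diff_left blinfun.minus_left
      blinfun.scaleR_left
      scaleC_add_right scaleC_add_left scaleC_scaleC scaleC.diff_right scaleC.minus_left
          scaleR_scaleC)

lemma norm_scaleC_op: "norm (c *\<^sub>C T)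
    \<le> cmod c * norm (T :: 'a::real_normed_vector \<Rightarrow>\<^sub>L 'b::chilbert_space)"
  by (rule norm_blinfun_bound)
    (auto simp: norm_scaleC mult.assoc intro!: mult_left_mono norm_blinfun)

lemma csubspace_op_diff:
  fixes V :: "('a::real_normed_vector \<Rightarrow>\<^sub>L 'b::chilbert_space) set"
  assumes "csubspace V" "x \<in> V" "y \<in> V"
  shows "x - y \<in> V"
  using csubspaceD(2)[OF assms(1,2) csubspaceD(3)[OF assms(1,3), of "-1"]]
  by (simp add: scaleC_op_simps)

lemma compose_scaleC:
  "(c *\<^sub>C T) o\<^sub>L R = c *\<^sub>C (T o\<^sub>L R)"
  "T \<in> bop E \<Longrightarrow> T o\<^sub>L (c *\<^sub>C R) = c *\<^sub>C (T o\<^sub>L R)"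
  by (auto intro!: blinfun_eqI simp: bop_scaleC)

lemma compose_add:
  "(T + T') o\<^sub>L R = (T o\<^sub>L R) + (T' o\<^sub>L R)" "T o\<^sub>L (R + R') = (T o\<^sub>L R) + (T o\<^sub>L R')"
  "(T - T') o\<^sub>L R = (T o\<^sub>L R) - (T' o\<^sub>L R)" "T o\<^sub>L (R - R') = (T o\<^sub>L R) - (T o\<^sub>L R')"
  by (auto intro!: blinfun_eqI simp: blinfun.add_left blinfun.add_right blinfun.diff_left
      blinfun.diff_right)

section \<open>Compact operators and finite rank\<close>

lemma norm_blinfun_unit_ball:
  fixes T :: "'a::real_normed_vector \<Rightarrow>\<^sub>L 'b::real_normed_vector"
  assumes "\<And>x. norm x \<le> 1 \<Longrightarrow> norm (T x) \<le> e" "0 \<le> e"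
  shows "norm T \<le> e"
proof (rule norm_blinfun_bound[OF \<open>0 \<le> e\<close>])
  fix x
  show "norm (T x) \<le> e * norm x"
  proof (cases "x = 0")
    case False
    then show ?thesis using assms(1)[of "x /\<^sub>R norm x"]
      by (simp add: blinfun.scaleR_right divide_simps)
  qed (simp add: blinfun.zero_right)
qed

lemma norm_blinfun_less:
  fixes T :: "'a::real_normed_vector \<Rightarrow>\<^sub>L 'b::real_normed_vector"
  assumes "0 \<le> r" "r < norm T"
  shows "\<exists>x. r * norm x < norm (T x)"
  using norm_blinfun_bound[of r T] assms by (meson not_le)


lemma compact_opsI:
  assumes "T \<in> bop UNIV" "compact C" "T ` cball 0 1 \<subseteq> C"
  shows "T \<in> compact_ops"
proof -
  have "closure (T ` cball 0 1) \<subseteq> C"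
    using assms by (simp add: closure_minimal compact_imp_closed)
  then have "compact (closure (T ` cball 0 1))"
    using compact_Int_closed[OF assms(2) closed_closure[of "T ` cball 0 1"]]
        by (simp add: Int_absorb1)
  then show ?thesis using assms(1) by (simp add: compact_ops_def)
qed

lemma compact_opsE:
  assumes "T \<in> compact_ops"
  obtains C where "T \<in> bop UNIV" "compact C" "T ` cball 0 1 \<subseteq> C"
  using assms that[OF _ _ closure_subset] by (simp add: compact_ops_def)

lemma compact_ops_bop: "T \<in> compact_ops \<Longrightarrow> T \<in> bop UNIV"
  by (simp add: compact_ops_def)

lemma csubspace_compact_ops: "csubspace (compact_ops :: 'a::chilbert_space op set)"
  unfolding csubspace_def
proof (intro conjI ballI allI)
  note sub = csubspaceD[OF csubspace_bop[OF csubspace_UNIV]]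
  show "(0 :: 'a op) \<in> compact_ops"
    by (rule compact_opsI[of _ "{0}"]) (auto simp: sub)
  fix T R :: "'a op" assume TR: "T \<in> compact_ops" "R \<in> compact_ops"
  obtain C where C: "compact C" "T ` cball 0 1 \<subseteq> C" using TR(1) by (rule compact_opsE)
  obtain D where D: "compact D" "R ` cball 0 1 \<subseteq> D" using TR(2) by (rule compact_opsE)
  show "T + R \<in> compact_ops"
    by (rule compact_opsI[OF _ compact_sums[OF C(1) D(1)]])
      (use TR C(2) D(2) in \<open>auto 0 4 simp: sub compact_ops_bop blinfun.add_left image_subset_iff\<close>)
next
  fix c and T :: "'a op" assume T: "T \<in> compact_ops"
  obtain C where C: "compact C" "T ` cball 0 1 \<subseteq> C" using T by (rule compact_opsE)
  show "c *\<^sub>C T \<in> compact_ops"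
  proof (rule compact_opsI)
    show "compact ((*\<^sub>C) c ` C)"
      by (intro compact_continuous_image C linear_continuous_on bounded_linear_scaleC)
  qed (use C T in \<open>auto simp: compact_ops_bop csubspaceD(3)[OF csubspace_bop[OF csubspace_UNIV]]\<close>)
qed

lemma compact_compose_left:
  assumes "T \<in> bop UNIV" "k \<in> compact_ops"
  shows "T o\<^sub>L k \<in> compact_ops"
proof -
  obtain C where C: "compact C" "k ` cball 0 1 \<subseteq> C" using assms(2) by (rule compact_opsE)
  show ?thesis
  proof (rule compact_opsI)
    show "compact (T ` C)"
      by (intro compact_continuous_image C linear_continuous_on blinfun.bounded_linear_right)
  qed (use C assms in \<open>auto simp: bop_compose compact_ops_bop\<close>)
qed

lemma compact_compose_right:
  assumes "T \<in> bop UNIV" "k \<in> compact_ops"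
  shows "k o\<^sub>L T \<in> compact_ops"
proof -
  obtain C where C: "compact C" "k ` cball 0 1 \<subseteq> C" using assms(2) by (rule compact_opsE)
  define r where "r = norm T + 1"
  have r: "r > 0" by (simp add: r_def add_nonneg_pos)
  show ?thesis
  proof (rule compact_opsI)
    show "compact ((*\<^sub>R) r ` C)" by (rule compact_scaling[OF C(1)])
    show "(k o\<^sub>L T) ` cball 0 1 \<subseteq> (*\<^sub>R) r ` C"
    proof clarsimp
      fix x :: 'a assume "norm x \<le> 1"
      then have "norm (T x) \<le> norm T" by (meson mult_left_le norm_blinfun norm_ge_zero order_trans)
      then have "norm (T x /\<^sub>R r) \<le> 1" using r by (simp add: r_def divide_simps)
      then have "k (T x /\<^sub>R r) \<in> C" using C(2) by auto
      moreover have "k (T x) = r *\<^sub>R k (T x /\<^sub>R r)" using r by (simp add: blinfun.scaleR_right)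
      ultimately show "k (T x) \<in> (*\<^sub>R) r ` C" by blast
    qed
  qed (use assms in \<open>auto simp: bop_compose compact_ops_bop\<close>)
qed

definition rank1 :: "'a::chilbert_space \<Rightarrow> 'a \<Rightarrow> 'a op" where
  "rank1 u v = Blinfun (\<lambda>x. cinner v x *\<^sub>C u)"

lemma rank1_apply [simp]: "rank1 u v x = cinner v x *\<^sub>C u"
  unfolding rank1_def
  by (rule bounded_linear_Blinfun_apply[THEN fun_cong])
    (rule bounded_linear_compose[OF scaleC.bounded_linear_left cinner.bounded_linear_right])

lemma rank1_bop: "rank1 u v \<in> bop UNIV"
  by (simp add: bop_UNIV cinner_scaleC_right scaleC_scaleC)

lemma norm_rank1: "norm (rank1 u v) \<le> norm u * norm v"
proof (rule norm_blinfun_bound)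
  fix x
  have "norm u * cmod (cinner v x) \<le> norm u * (norm v * norm x)"
    by (intro mult_left_mono cauchy_schwarz) simp
  then show "norm (rank1 u v x) \<le> norm u * norm v * norm x" by (simp add: norm_scaleC ac_simps)
qed simp

lemma adj_rank1: "adj (rank1 u v) = rank1 v u"
  by (rule adj_eqI) (simp add: cinner_scaleC_left cinner_scaleC_right flip: cinner_commute)

lemma compose_rank1: "T \<in> bop UNIV \<Longrightarrow> T o\<^sub>L rank1 u v = rank1 (T u) v"
  by (rule blinfun_eqI) (simp add: bop_UNIV)

lemma rank1_compose: "T \<in> bop UNIV \<Longrightarrow> rank1 u v o\<^sub>L T = rank1 u (adj T v)"
  by (rule blinfun_eqI) (simp add: cinner_adj)

lemma rank1_add_right: "rank1 u (v + w) = rank1 u v + rank1 u w"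
  by (rule blinfun_eqI) (simp add: cinner_add_left scaleC_add_left blinfun.add_left)

lemma rank1_add_left: "rank1 (u + v) w = rank1 u w + rank1 v w"
  by (rule blinfun_eqI) (simp add: scaleC_add_right blinfun.add_left)

lemma rank1_scaleC_right: "rank1 u (c *\<^sub>C v) = cnj c *\<^sub>C rank1 u v"
  by (rule blinfun_eqI) (simp add: cinner_scaleC_left scaleC_scaleC)

lemma rank1_scaleC_left: "rank1 (c *\<^sub>C u) v = c *\<^sub>C rank1 u v"
  by (rule blinfun_eqI) (simp add: scaleC_scaleC mult.commute)

lemma rank1_compact: "rank1 u v \<in> compact_ops"
proof (rule compact_opsI[OF rank1_bop])
  show "compact ((\<lambda>c. c *\<^sub>C u) ` cball 0 (norm v))"
    by (intro compact_continuous_image compact_cball linear_continuous_on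
        scaleC.bounded_linear_left)
  show "rank1 u v ` cball 0 1 \<subseteq> (\<lambda>c. c *\<^sub>C u) ` cball 0 (norm v)"
    by (auto intro!: imageI order_trans[OF cauchy_schwarz] mult_left_le)
qed

inductive_set finite_rank :: "'a::chilbert_space op set" where
  zero: "0 \<in> finite_rank"
| add: "q \<in> finite_rank \<Longrightarrow> rank1 u v + q \<in> finite_rank"

lemma finite_rank_compact: "q \<in> finite_rank \<Longrightarrow> q \<in> compact_ops"
  by (induction rule: finite_rank.induct)
    (auto simp: csubspaceD[OF csubspace_compact_ops] rank1_compact)

lemma finite_rank_compose_right: "q \<in> finite_rank \<Longrightarrow> T \<in> bop UNIV \<Longrightarrow> q o\<^sub>L T \<in> finite_rank"
proof (induction rule: finite_rank.induct)
  case zero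
  have "0 o\<^sub>L T = 0" by (rule blinfun_eqI) simp
  then show ?case by (simp add: finite_rank.zero)
qed (auto simp: compose_add rank1_compose intro: finite_rank.add)

definition is_projection :: "'a::chilbert_space op \<Rightarrow> bool" where
  "is_projection Q \<longleftrightarrow> Q \<in> bop UNIV \<and> Q o\<^sub>L Q = Q \<and> adj Q = Q"

lemma is_projectionD:
  assumes "is_projection Q"
  shows "Q \<in> bop UNIV" "Q (Q x) = Q x" "cinner (Q x) y = cinner x (Q y)"
proof -
  show 1: "Q \<in> bop UNIV" using assms by (simp add: is_projection_def)
  show "Q (Q x) = Q x" using assms by (metis blinfun_apply_blinfun_compose is_projection_def)
  show "cinner (Q x) y = cinner x (Q y)" using assms cinner_adj(2)[OF 1]
    by (simp add: is_projection_def)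
qed

lemma projection_pythagoras:
  assumes "is_projection Q"
  shows "(norm (Q x + (y - Q y)))\<^sup>2 = (norm (Q x))\<^sup>2 + (norm (y - Q y))\<^sup>2"
  by (subst norm_add_sq) (simp add: is_projectionD[OF assms] blinfun.diff_right)

lemma norm_projection:
  assumes "is_projection Q"
  shows "norm (Q x) \<le> norm x" "norm (x - Q x) \<le> norm x"
  using projection_pythagoras[OF assms, of x x] by (simp_all add: power2_le_imp_le)

lemma exists_finite_rank_projection:
  assumes "finite W"
  shows "\<exists>Q\<in>finite_rank. is_projection Q \<and> (\<forall>w\<in>W. Q w = w)"
  using assms
proof (induction rule: finite_induct)
  case empty
  show ?case
    by (rule bexI[OF _ finite_rank.zero])
      (auto simp: is_projection_def csubspaceD(1)[OF csubspace_bop[OF csubspace_UNIV]]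
          intro!: blinfun_eqI)
next
  case (insert w W)
  then obtain Q where Q: "Q \<in> finite_rank" "is_projection Q" "\<And>x. x \<in> W \<Longrightarrow> Q x = x" by blast
  note Qp = is_projectionD[OF Q(2)]
  show ?case
  proof (cases "Q w = w")
    case True
    then show ?thesis using Q by blast
  next
    case False
    \<comment> \<open>Gram-Schmidt: \<open>e\<close> is the normalised component of the new vector orthogonal to the range of
      \<open>Q\<close>.\<close>
    define e where "e = (w - Q w) /\<^sub>R norm (w - Q w)"
    have e: "cinner e e = 1" using False by (simp add: e_def cinner_self)
    have Qe: "Q e = 0" by (simp add: e_def blinfun.scaleR_right blinfun.diff_right Qp)
    have eQ: "cinner e (Q x) = 0" for x using Qp(3)[of e x] Qe by simp
    have ew: "cinner e w *\<^sub>C e = w - Q w"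
    proof -
      have "cinner e w = cinner e (w - Q w)" by (simp add: cinner_diff eQ)
      also have "w - Q w = norm (w - Q w) *\<^sub>R e" using False by (simp add: e_def)
      finally have "cinner e w = norm (w - Q w)"
        by (simp add: cinner_scaleR_right e scaleR_conv_of_real)
      then show ?thesis using False by (simp add: e_def flip: scaleR_scaleC)
    qed
    let ?Q = "rank1 e e + Q"
    have 1: "?Q \<in> bop UNIV"
      using rank1_bop Qp(1) csubspaceD(2)[OF csubspace_bop[OF csubspace_UNIV]] by blast
    have 2: "?Q o\<^sub>L ?Q = ?Q"
      by (rule blinfun_eqI)
        (simp add: blinfun.add_left blinfun.add_right cinner_add_right cinner_scaleC_right e eQ
          bop_scaleC[OF Qp(1)] Qe Qp(2))
    have 3: "adj ?Q = ?Q"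
      using Q(2) by (simp add: adj_add rank1_bop Qp(1) adj_rank1 is_projection_def)
    have 4: "?Q x = x" if "x \<in> W" for x
      using Q(3)[OF that] eQ[of x] by (simp add: blinfun.add_left)
    have 5: "?Q w = w" by (simp add: blinfun.add_left ew)
    show ?thesis
      by (rule bexI[OF _ finite_rank.add[OF Q(1)]])
          (use 1 2 3 4 5 in \<open>auto simp: is_projection_def\<close>)
  qed
qed

text \<open>The range of the projection contains a finite net \<open>Y\<close> for the image of the unit ball under
  each operator \<open>k\<close>, together with \<open>k\<^sup>* Y\<close>. The net points give \<open>k \<approx> Q k\<close>. For \<open>z\<close> in the unit
  ball with \<open>Q z = 0\<close> the vector \<open>k z\<close> is orthogonal to \<open>Y\<close>, so zero is as close to \<open>k z\<close> as the
  nearest net point, which gives \<open>k \<approx> k Q\<close>.\<close>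

lemma compact_finite_rank_approximation:
  assumes "finite F" "F \<subseteq> (compact_ops :: 'a::chilbert_space op set)" "0 < e"
  shows "\<exists>Q\<in>finite_rank. is_projection Q \<and>
    (\<forall>k\<in>F. norm (k - (Q o\<^sub>L k)) \<le> e \<and> norm (k - (k o\<^sub>L Q)) \<le> e)"
proof -
  have "\<exists>Y. finite Y \<and> (\<forall>x. norm x \<le> 1 \<longrightarrow> (\<exists>y\<in>Y. norm (k x - y) \<le> e))" if k: "k \<in> F" for k
  proof -
    have "k \<in> compact_ops" using k assms by blast
    then obtain C where C: "compact C" "k ` cball 0 1 \<subseteq> C" by (rule compact_opsE)
    then obtain Y where Y: "finite Y" "C \<subseteq> (\<Union>y\<in>Y. ball y e)"
      using \<open>0 < e\<close> by (auto simp: compact_eq_totally_bounded)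
    have "\<exists>y\<in>Y. norm (k x - y) \<le> e" if "norm x \<le> 1" for x
    proof -
      have "k x \<in> C" using C(2) that by (auto simp: image_subset_iff)
      then obtain y where "y \<in> Y" "dist y (k x) < e" using Y(2) by auto
      then show ?thesis by (auto simp: dist_norm norm_minus_commute intro: less_imp_le)
    qed
    then show ?thesis using Y by blast
  qed
  then obtain Y where Y: "\<And>k. k \<in> F \<Longrightarrow> finite (Y k)"
    "\<And>k x. k \<in> F \<Longrightarrow> norm x \<le> 1 \<Longrightarrow> \<exists>y\<in>Y k. norm (k x - y) \<le> e" by metis
  obtain Q where Q: "Q \<in> finite_rank" "is_projection Q"
    and QY: "\<And>k y. k \<in> F \<Longrightarrow> y \<in> Y k \<Longrightarrow> Q y = y" "\<And>k y. k \<in> F \<Longrightarrow> y \<in> Y k \<Longrightarrow> Q (adj k y) = adj k y"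
    using exists_finite_rank_projection[of "\<Union>k\<in>F. Y k \<union> adj k ` Y k"] Y(1) assms(1) by blast
  note Qp = is_projectionD[OF Q(2)]
  show ?thesis
  proof (intro bexI[OF _ Q(1)] conjI ballI Q(2))
    fix k assume k: "k \<in> F"
    then have kb: "k \<in> bop UNIV" using assms compact_ops_bop by blast
    show "norm (k - (Q o\<^sub>L k)) \<le> e"
    proof (rule norm_blinfun_unit_ball)
      fix x :: 'a assume "norm x \<le> 1"
      then obtain y where y: "y \<in> Y k" "norm (k x - y) \<le> e" using Y(2)[OF k] by blast
      have "(k - (Q o\<^sub>L k)) x = (k x - y) - Q (k x - y)"
        by (simp add: blinfun.diff_left blinfun.diff_right QY(1)[OF k y(1)])
      then show "norm ((k - (Q o\<^sub>L k)) x) \<le> e"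
        using norm_projection(2)[OF Q(2), of "k x - y"] y(2) by simp
    qed (use \<open>0 < e\<close> in simp)
    show "norm (k - (k o\<^sub>L Q)) \<le> e"
    proof (rule norm_blinfun_unit_ball)
      fix x :: 'a assume x: "norm x \<le> 1"
      define z where "z = x - Q x"
      have "norm z \<le> 1" using norm_projection(2)[OF Q(2), of x] x by (simp add: z_def)
      then obtain y where y: "y \<in> Y k" "norm (k z - y) \<le> e" using Y(2)[OF k] by blast
      have "cinner (k z) y = cinner z (Q (adj k y))"
        using QY(2)[OF k y(1)] by (simp add: cinner_adj[OF kb])
      also have "\<dots> = cinner (Q z) (adj k y)" by (simp add: Qp)
      also have "Q z = 0" by (simp add: z_def blinfun.diff_right Qp)
      finally have "(norm (k z - y))\<^sup>2 = (norm (k z))\<^sup>2 + (norm y)\<^sup>2"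
        by (simp add: norm_diff_sq)
      then have "norm (k z) \<le> norm (k z - y)" by (simp add: power2_le_imp_le)
      moreover have "(k - (k o\<^sub>L Q)) x = k z"
        by (simp add: z_def blinfun.diff_left blinfun.diff_right)
      ultimately show "norm ((k - (k o\<^sub>L Q)) x) \<le> e" using y(2) by simp
    qed (use \<open>0 < e\<close> in simp)
  qed
qed

section \<open>Representations and unital completely positive maps\<close>

definition cstar_algebra :: "'a::chilbert_space op set \<Rightarrow> bool" where
  "cstar_algebra A \<longleftrightarrow> unital_subalgebra A \<and> closed A \<and> (\<forall>a\<in>A. adj a \<in> A)"

lemma cstar_algebraD:
  assumes "cstar_algebra A"
  shows "a \<in> A \<Longrightarrow> a \<in> bop UNIV" "csubspace A" "id_blinfun \<in> A"
    "a \<in> A \<Longrightarrow> b \<in> A \<Longrightarrow> a o\<^sub>L b \<in> A" "a \<in> A \<Longrightarrow> adj a \<in> A" "closed A"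
    "a \<in> A \<Longrightarrow> b \<in> A \<Longrightarrow> a + b \<in> A" "a \<in> A \<Longrightarrow> b \<in> A \<Longrightarrow> a - b \<in> A"
    "a \<in> A \<Longrightarrow> c *\<^sub>C a \<in> A" "a \<in> A \<Longrightarrow> r *\<^sub>R a \<in> A" "0 \<in> A"
  using assms csubspaceD[of A] csubspace_op_diff[of A]
  by (auto simp: cstar_algebra_def unital_subalgebra_def simp flip: scaleC_op_simps(9))

lemma closed_bop_UNIV: "closed (bop UNIV :: 'a::chilbert_space op set)"
proof -
  have "closed {T :: 'a op. \<forall>c x. T (c *\<^sub>C x) = c *\<^sub>C T x}"
    by (intro closed_Collect_all closed_Collect_eq linear_continuous_on
        blinfun.bounded_linear_left bounded_linear_compose[OF bounded_linear_scaleC])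
  also have "{T :: 'a op. \<forall>c x. T (c *\<^sub>C x) = c *\<^sub>C T x} = bop UNIV" by (auto simp: bop_UNIV)
  finally show ?thesis .
qed

lemma cstar_algebra_bop: "cstar_algebra (bop UNIV :: 'a::chilbert_space op set)"
  by (auto simp: cstar_algebra_def unital_subalgebra_def closed_bop_UNIV adj_bop_UNIV bop_compose
      csubspace_bop csubspace_UNIV) (simp add: bop_UNIV)

lemma cstar:
  assumes "S \<subseteq> bop UNIV"
  shows "cstar_algebra (cstar S)" "S \<subseteq> cstar S"
proof -
  have eq: "cstar S = \<Inter>{A. S \<subseteq> A \<and> cstar_algebra A}"
    by (simp add: cstar_def cstar_algebra_def conj_assoc)
  have "csubspace (cstar S)"
    unfolding eq using cstar_algebraD(2) by (auto simp: csubspace_def)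
  moreover have "cstar S \<subseteq> bop UNIV" unfolding eq using assms cstar_algebra_bop by blast
  moreover have "closed (cstar S)" unfolding eq using cstar_algebraD(6) by blast
  ultimately show "cstar_algebra (cstar S)"
    unfolding cstar_algebra_def unital_subalgebra_def
    by (auto simp: eq cstar_algebraD)
  show "S \<subseteq> cstar S" by (auto simp: cstar_def)
qed

lemma adj_diff: "T \<in> bop UNIV \<Longrightarrow> R \<in> bop UNIV \<Longrightarrow> adj (T - R) = adj T - adj R"
  by (rule adj_eqI) (simp add: cinner_adj blinfun.diff_left cinner_diff)

lemma selfadjoint_decomposition:
  fixes A :: "'a::chilbert_space op set"
  assumes A: "csubspace A" "A \<subseteq> bop UNIV" "\<And>b. b \<in> A \<Longrightarrow> adj b \<in> A" and a: "a \<in> A"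
  shows "\<exists>h k. h \<in> A \<and> k \<in> A \<and> adj h = h \<and> adj k = k \<and> a = h + \<i> *\<^sub>C k"
proof -
  have aU: "a \<in> bop UNIV" "adj a \<in> bop UNIV"
    using A a by auto
  let ?h = "(1/2) *\<^sub>C (a + adj a)" and ?k = "(- \<i>/2) *\<^sub>C (a - adj a)"
  note sub = csubspaceD[OF csubspace_bop[OF csubspace_UNIV]]
    csubspace_op_diff[OF csubspace_bop[OF csubspace_UNIV]]
  have "adj ?h = ?h" using aU by (simp add: adj_scaleC adj_add sub add.commute)
  moreover have "adj ?k = ?k"
  proof -
    have "adj ?k = (\<i>/2) *\<^sub>C (adj a - a)" using aU by (simp add: adj_scaleC adj_diff sub)
    also have "\<dots> = (- (\<i>/2)) *\<^sub>C ((-1) *\<^sub>C (adj a - a))" by (simp only: scaleC_op_simps(4)) simp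
    also have "(-1) *\<^sub>C (adj a - a) = a - adj a" by (simp add: scaleC_op_simps)
    finally show ?thesis by simp
  qed
  moreover have "a = ?h + \<i> *\<^sub>C ?k"
  proof -
    have "?h + \<i> *\<^sub>C ?k = (1/2) *\<^sub>C ((a + adj a) + (a - adj a))"
      by (simp add: scaleC_op_simps(4) flip: scaleC_op_simps(1))
    also have "(a + adj a) + (a - adj a) = 2 *\<^sub>C a"
      using scaleC_op_simps(3)[of 1 1 a] by (simp add: scaleC_op_simps(5))
    finally show ?thesis by (simp add: scaleC_op_simps)
  qed
  moreover have "?h \<in> A" "?k \<in> A"
    using csubspaceD[OF A(1)] csubspace_op_diff[OF A(1)] A(3) a by auto
  ultimately show ?thesis by blast
qed

lemma clinear_onD:
  fixes f :: "'a::chilbert_space op \<Rightarrow> 'b::chilbert_space op"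
  assumes "clinear_on A f" "csubspace A"
  shows "x \<in> A \<Longrightarrow> y \<in> A \<Longrightarrow> f (x + y) = f x + f y" "x \<in> A \<Longrightarrow> f (c *\<^sub>C x) = c *\<^sub>C f x"
    "x \<in> A \<Longrightarrow> y \<in> A \<Longrightarrow> f (x - y) = f x - f y" "f 0 = 0"
proof -
  show 1: "x \<in> A \<Longrightarrow> y \<in> A \<Longrightarrow> f (x + y) = f x + f y"
    and 2: "x \<in> A \<Longrightarrow> f (c *\<^sub>C x) = c *\<^sub>C f x" for x y c using assms by (auto simp: clinear_on_def)
  show "f (x - y) = f x - f y" if "x \<in> A" "y \<in> A"
    using 1[OF that(1) csubspaceD(3)[OF assms(2) that(2), of "-1"]] 2[OF that(2), of "-1"]
    by (simp add: scaleC_op_simps)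
  show "f 0 = 0" using 2[OF csubspaceD(1)[OF assms(2)], of 0] by (simp add: scaleC_op_simps)
qed

lemma unital_star_repD:
  assumes "unital_star_rep A E \<rho>" "cstar_algebra A"
  shows "a \<in> A \<Longrightarrow> \<rho> a \<in> bop E" "\<rho> id_blinfun = unit_op E"
    "a \<in> A \<Longrightarrow> b \<in> A \<Longrightarrow> \<rho> (a o\<^sub>L b) = \<rho> a o\<^sub>L \<rho> b" "a \<in> A \<Longrightarrow> \<rho> (adj a) = adj (\<rho> a)"
    "a \<in> A \<Longrightarrow> b \<in> A \<Longrightarrow> \<rho> (a + b) = \<rho> a + \<rho> b" "a \<in> A \<Longrightarrow> \<rho> (c *\<^sub>C a) = c *\<^sub>C \<rho> a"
    "a \<in> A \<Longrightarrow> b \<in> A \<Longrightarrow> \<rho> (a - b) = \<rho> a - \<rho> b" "\<rho> 0 = 0"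
    "a \<in> A \<Longrightarrow> \<rho> (r *\<^sub>R a) = r *\<^sub>R \<rho> a"
  using assms clinear_onD[of A \<rho>] cstar_algebraD[of A]
  by (auto simp: unital_star_rep_def simp flip: scaleC_op_simps(9))

text \<open>The sum of the Neumann series is the fixed point of \<open>c \<mapsto> (1 + c h) / r\<close>, a contraction of
  the closed set \<open>A\<close>.\<close>

lemma left_inverse:
  assumes A: "cstar_algebra A" and h: "h \<in> A" "norm h < r"
  shows "\<exists>c\<in>A. c o\<^sub>L (r *\<^sub>R id_blinfun - h) = id_blinfun"
proof -
  have r: "r > 0" using h(2) norm_ge_zero[of h] by linarith
  note AD = cstar_algebraD[OF A]
  define f where "f c = inverse r *\<^sub>R (id_blinfun + (c o\<^sub>L h))" for c
  have "\<exists>!c\<in>A. f c = c"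
  proof (rule Banach_fix)
    show "complete A" using AD(6) by (simp add: complete_eq_closed)
    show "A \<noteq> {}" using AD(3) by blast
    show "0 \<le> norm h / r" "norm h / r < 1" using r h by auto
    show "f ` A \<subseteq> A" using AD h by (auto simp: f_def)
    fix x y
    have "f x - f y = inverse r *\<^sub>R ((x - y) o\<^sub>L h)"
      by (simp add: f_def compose_add algebra_simps)
    then have "norm (f x - f y) \<le> inverse r * (norm (x - y) * norm h)"
      using r by (simp add: norm_blinfun_compose)
    then show "dist (f x) (f y) \<le> norm h / r * dist x y"
      by (simp add: dist_norm divide_inverse mult.commute mult.left_commute)
  qed
  then obtain c where c: "c \<in> A" "f c = c" by blast
  have "r *\<^sub>R f c = id_blinfun + (c o\<^sub>L h)" using r by (simp add: f_def)
  then have "r *\<^sub>R c = id_blinfun + (c o\<^sub>L h)" using c by simp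
  moreover have "c o\<^sub>L (r *\<^sub>R id_blinfun) = r *\<^sub>R c"
    by (rule blinfun_eqI) (simp add: blinfun.scaleR_left blinfun.scaleR_right)
  ultimately have "c o\<^sub>L (r *\<^sub>R id_blinfun - h) = id_blinfun" by (simp add: compose_add)
  then show ?thesis using c by blast
qed

text \<open>For \<open>d > \<parallel>a\<parallel>\<close> the element \<open>d\<^sup>2 - a\<^sup>* a\<close> has a left inverse in the algebra, so \<open>d\<^sup>2 - \<rho>(a)\<^sup>*
  \<rho>(a)\<close> is bounded below, which prevents \<open>d\<close> from being the norm of \<open>\<rho>(a)\<close>.\<close>

lemma star_rep_contractive:
  assumes A: "cstar_algebra A" and E: "closed_csubspace E" and rep: "unital_star_rep A E \<rho>"
    and a: "a \<in> A"
  shows "norm (\<rho> a) \<le> norm a"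
proof (rule ccontr)
  note AD = cstar_algebraD[OF A] and RD = unital_star_repD[OF rep A]
  define T where "T = \<rho> a"
  define d where "d = norm T"
  assume "\<not> norm (\<rho> a) \<le> norm a"
  then have d: "norm a < d" by (simp add: d_def T_def)
  then have d0: "0 < d" using norm_ge_zero[of a] by linarith
  note d = d d0
  let ?h = "adj a o\<^sub>L a"
  have T: "T \<in> bop E" and TU: "T \<in> bop UNIV" using RD(1)[OF a] bop_subset_UNIV by (auto simp: T_def)
  have "norm ?h \<le> norm (adj a) * norm a" by (rule norm_blinfun_compose)
  also have "\<dots> \<le> norm a * norm a" using norm_adj[OF AD(1)[OF a]] by (simp add: mult_right_mono)
  also have "\<dots> < d\<^sup>2" using d by (simp add: power2_eq_square mult_strict_mono)
  finally have "norm ?h < d\<^sup>2" .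
  then obtain c where c: "c \<in> A" "c o\<^sub>L (d\<^sup>2 *\<^sub>R id_blinfun - ?h) = id_blinfun"
    using left_inverse[OF A, of ?h "d\<^sup>2"] AD(4)[OF AD(5)[OF a] a] by blast
  have "unit_op E = \<rho> (c o\<^sub>L (d\<^sup>2 *\<^sub>R id_blinfun - ?h))" by (simp add: c RD)
  also have "\<dots> = \<rho> c o\<^sub>L (d\<^sup>2 *\<^sub>R unit_op E - (adj T o\<^sub>L T))"
    using AD(3-10) a c(1) by (simp add: RD T_def)
  finally have inv: "unit_op E = \<rho> c o\<^sub>L (d\<^sup>2 *\<^sub>R unit_op E - (adj T o\<^sub>L T))" .
  define K where "K = norm (\<rho> c) + 1"
  have K: "K > 0" by (simp add: K_def add_nonneg_pos)
  have low: "(norm x)\<^sup>2 \<le> K\<^sup>2 * (d\<^sup>2 * (d\<^sup>2 * (norm x)\<^sup>2 - (norm (T x))\<^sup>2))" if x: "x \<in> E" for x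
  proof -
    let ?y = "d\<^sup>2 *\<^sub>R x - adj T (T x)"
    have "x = \<rho> c ?y"
      using arg_cong[OF inv, of "\<lambda>T. blinfun_apply T x"] unit_op(2)[OF E x]
      by (simp add: blinfun.diff_left blinfun.scaleR_left)
    then have "norm x \<le> norm (\<rho> c) * norm ?y" by (metis norm_blinfun)
    also have "\<dots> \<le> K * norm ?y" by (simp add: K_def mult_right_mono)
    finally have "(norm x)\<^sup>2 \<le> (K * norm ?y)\<^sup>2" by (rule power_mono) simp
    then have "(norm x)\<^sup>2 \<le> K\<^sup>2 * (norm ?y)\<^sup>2" by (simp add: power_mult_distrib)
    moreover have "(norm ?y)\<^sup>2 \<le> d\<^sup>2 * (d\<^sup>2 * (norm x)\<^sup>2 - (norm (T x))\<^sup>2)"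
    proof -
      have "norm (adj T (T x)) \<le> norm (adj T) * norm (T x)" by (rule norm_blinfun)
      also have "\<dots> \<le> d * norm (T x)" using norm_adj[OF TU] by (simp add: d_def mult_right_mono)
      finally have "(norm (adj T (T x)))\<^sup>2 \<le> (d * norm (T x))\<^sup>2" by (rule power_mono) simp
      then have "(norm (adj T (T x)))\<^sup>2 \<le> d\<^sup>2 * (norm (T x))\<^sup>2" by (simp add: power_mult_distrib)
      moreover have "Re (cinner (d\<^sup>2 *\<^sub>R x) (adj T (T x))) = d\<^sup>2 * (norm (T x))\<^sup>2"
        by (simp add: cinner_scaleR_left cinner_adj[OF TU] norm_sq_cinner blinfun.scaleR_right)
      moreover have "(norm (d\<^sup>2 *\<^sub>R x))\<^sup>2 = d\<^sup>2 * (d\<^sup>2 * (norm x)\<^sup>2)"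
        by (simp add: power2_eq_square)
      moreover have "(norm ?y)\<^sup>2 = (norm (d\<^sup>2 *\<^sub>R x))\<^sup>2
          - 2 * Re (cinner (d\<^sup>2 *\<^sub>R x) (adj T (T x))) + (norm (adj T (T x)))\<^sup>2"
        by (rule norm_diff_sq)
      ultimately show ?thesis by (simp add: right_diff_distrib)
    qed
    ultimately show ?thesis by (rule order_trans[OF _ mult_left_mono[OF _ zero_le_power2]])
  qed
  \<comment> \<open>The lower bound, solved for \<open>\<parallel>T x\<parallel>\<^sup>2\<close>; the maximum keeps the square root of \<open>s\<close> meaningful.\<close>
  define s where "s = max 0 (d\<^sup>2 - 1 / (K\<^sup>2 * d\<^sup>2))"
  have up: "(norm (T x))\<^sup>2 \<le> s * (norm x)\<^sup>2" if x: "x \<in> E" for x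
  proof -
    have "(norm (T x))\<^sup>2 \<le> (d\<^sup>2 - 1 / (K\<^sup>2 * d\<^sup>2)) * (norm x)\<^sup>2"
      using low[OF x] K d by (simp add: field_simps)
    also have "\<dots> \<le> s * (norm x)\<^sup>2" by (simp add: s_def mult_right_mono)
    finally show ?thesis .
  qed
  have "norm T \<le> sqrt s"
  proof (rule norm_blinfun_bound)
    fix x
    have "(norm (T x))\<^sup>2 = (norm (T (unit_op E x)))\<^sup>2" by (simp add: bop_unit_right[OF E T])
    also have "\<dots> \<le> s * (norm (unit_op E x))\<^sup>2" by (rule up[OF bop_range[OF unit_op(1)[OF E]]])
    also have "\<dots> \<le> s * (norm x)\<^sup>2"
      using norm_unit_op[OF E, of x] by (intro mult_left_mono power_mono) (auto simp: s_def)
    finally show "norm (T x) \<le> sqrt s * norm x"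
      using real_le_rsqrt[of "norm (T x)" "s * (norm x)\<^sup>2"] by (simp add: real_sqrt_mult)
  qed (simp add: s_def)
  then have "d\<^sup>2 \<le> (sqrt s)\<^sup>2" using d by (intro power_mono) (simp_all add: d_def)
  then have "d\<^sup>2 \<le> s" by (simp add: s_def)
  moreover have "s < d\<^sup>2" using d K by (simp add: s_def)
  ultimately show False by simp
qed

text \<open>The matrix with rows \<open>(\<parallel>a\<parallel>, a)\<close> and \<open>(a\<^sup>*, \<parallel>a\<parallel>)\<close> is positive. Positivity of its image bounds
  the off-diagonal entries and makes them adjoint to each other.\<close>

lemma ucp_adj_norm:
  assumes A: "cstar_algebra A" and E: "closed_csubspace E" and u: "ucp A E C \<psi>"
    and C: "C \<subseteq> bop E" and a: "a \<in> A"
  shows "\<psi> (adj a) = adj (\<psi> a)" "norm (\<psi> a) \<le> norm a"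
proof -
  note AD = cstar_algebraD[OF A]
  let ?n = "norm a"
  define m where "m i j = (if i = j then ?n *\<^sub>R id_blinfun else if i = 0 then a else adj a)"
      for i j :: nat
  have aU: "a \<in> bop UNIV" by (rule AD(1)[OF a])
  have \<psi>U: "\<psi> b \<in> bop UNIV" if "b \<in> A" for b
    by (rule bop_subset_UNIV[of _ E]) (use u C that in \<open>auto simp: ucp_def\<close>)
  have two: "{..<2::nat} = {0, 1}" by auto
  have "positive_matrix 2 m"
    unfolding positive_matrix_def
  proof
    fix x :: "nat \<Rightarrow> 'a"
    have "(\<Sum>i<2. \<Sum>j<2. cinner (x i) (m i j (x j))) =
        of_real (?n * (norm (x 0))\<^sup>2 + ?n * (norm (x 1))\<^sup>2) +
            (cinner (x 0) (a (x 1)) + cnj (cinner (x 0) (a (x 1))))"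
      by (simp add: two m_def blinfun.scaleR_left cinner_scaleR_right cinner_self
          scaleR_conv_of_real cinner_adj[OF aU] flip: cinner_commute)
    also have "\<dots> = of_real (?n * (norm (x 0))\<^sup>2 + ?n * (norm (x 1))\<^sup>2
        + 2 * Re (cinner (x 0) (a (x 1))))"
      by (simp add: complex_add_cnj)
    finally have eq: "(\<Sum>i<2. \<Sum>j<2. cinner (x i) (m i j (x j))) = \<dots>" .
    have "\<bar>Re (cinner (x 0) (a (x 1)))\<bar> \<le> norm (x 0) * norm (a (x 1))"
      by (rule order_trans[OF abs_Re_le_cmod cauchy_schwarz])
    also have "\<dots> \<le> norm (x 0) * (?n * norm (x 1))" by (intro mult_left_mono norm_blinfun) auto
    finally have "2 * Re (cinner (x 0) (a (x 1))) \<ge> - (2 * ?n * (norm (x 0) * norm (x 1)))"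
      by (simp add: abs_le_iff ac_simps)
    moreover have "?n * (norm (x 0) - norm (x 1))\<^sup>2 \<ge> 0" by simp
    ultimately have "?n * (norm (x 0))\<^sup>2 + ?n * (norm (x 1))\<^sup>2
        + 2 * Re (cinner (x 0) (a (x 1))) \<ge> 0"
      by (simp add: power2_eq_square algebra_simps)
    then show "(\<Sum>i<2. \<Sum>j<2. cinner (x i) (m i j (x j))) \<in> \<real>\<^sub>\<ge>\<^sub>0"
      unfolding eq by (subst nonneg_Reals_of_real_iff)
  qed
  moreover have "\<forall>i<2. \<forall>j<2. m i j \<in> A" using AD a by (simp add: m_def)
  ultimately have pos: "positive_matrix 2 (\<lambda>i j. \<psi> (m i j))" using u by (auto simp: ucp_def)
  have \<psi>n: "\<psi> (?n *\<^sub>R id_blinfun) = ?n *\<^sub>R unit_op E"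
    using u clinear_onD(2)[of A \<psi>] AD by (simp add: ucp_def flip: scaleC_op_simps(9))
  have P: "cinner x (unit_op E x) = of_real ((norm (unit_op E x))\<^sup>2)" for x
    using unit_op_selfadjoint[OF E, of x "unit_op E x"]
        unit_op(2)[OF E bop_range[OF unit_op(1)[OF E]]]
    by (simp add: cinner_self)
  let ?p = "\<lambda>x y. cinner x (\<psi> a y)" and ?q = "\<lambda>x y. cinner y (\<psi> (adj a) x)"
  let ?r = "\<lambda>x y. ?n * (norm (unit_op E x))\<^sup>2 + ?n * (norm (unit_op E y))\<^sup>2"
  have key: "of_real (?r x y) + (?p x y + ?q x y) \<in> \<real>\<^sub>\<ge>\<^sub>0" for x y
    using pos[unfolded positive_matrix_def, rule_format, of "\<lambda>i. if i = 0 then x else y"]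
    by (simp add: two m_def \<psi>n blinfun.scaleR_left cinner_scaleR_right P scaleR_conv_of_real
        algebra_simps)
  then have im: "Im (?p x y + ?q x y) = 0" and re: "?r x y + Re (?p x y + ?q x y) \<ge> 0" for x y
    using key[of x y] by (simp_all add: complex_nonneg_Reals_iff)
  have pq: "?q x y = cnj (?p x y)" for x y
  proof (rule complex_eqI)
    show "Im (?q x y) = Im (cnj (?p x y))" using im[of x y] by simp
    \<comment> \<open>Multiplying \<open>x\<close> by \<open>\<i>\<close> turns the statement on imaginary parts into one on real parts.\<close>
    have "Im (- \<i> * ?p x y + \<i> * ?q x y) = 0"
      using im[of "\<i> *\<^sub>C x" y] \<psi>U[OF AD(5)[OF a]]
      by (simp add: cinner_scaleC_left cinner_scaleC_right bop_scaleC)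
    then show "Re (?q x y) = Re (cnj (?p x y))" by simp
  qed
  show "\<psi> (adj a) = adj (\<psi> a)"
    by (rule adj_eqI[symmetric]) (subst pq, simp flip: cinner_commute)
  show "norm (\<psi> a) \<le> norm a"
  proof (rule norm_blinfun_bound)
    fix y
    show "norm (\<psi> a y) \<le> ?n * norm y"
    proof (cases "\<psi> a y = 0 \<or> y = 0")
      case False
      \<comment> \<open>The vector of the same norm as \<open>y\<close> that makes \<open>?p x y\<close> as negative as possible.\<close>
      define x where "x = - (norm y / norm (\<psi> a y)) *\<^sub>R \<psi> a y"
      have nx: "norm x = norm y" using False by (simp add: x_def)
      have "?p x y = of_real (- norm y * norm (\<psi> a y))"
        using False by (simp add: x_def cinner_scaleR_left cinner_minus cinner_self
            scaleR_conv_of_real power2_eq_square)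
      then have "2 * (norm y * norm (\<psi> a y)) \<le> ?r x y"
        using re[where x = x and y = y] pq[where x = x and y = y] by simp
      also have "\<dots> \<le> ?n * (norm x)\<^sup>2 + ?n * (norm y)\<^sup>2"
        using norm_unit_op[OF E] by (intro add_mono mult_left_mono power_mono) auto
      finally show ?thesis using False nx by (simp add: power2_eq_square mult.commute)
    qed (auto simp: blinfun.zero_right)
  qed simp
qed

section \<open>Commutants\<close>

lemma commutant_bop: "T \<in> commutant E X \<Longrightarrow> T \<in> bop E"
  by (simp add: commutant_def)

lemma commutantD: "T \<in> commutant E X \<Longrightarrow> (R::'a::chilbert_space op) \<in> X \<Longrightarrow> T (R x) = R (T x)"
  by (auto simp: commutant_def) (metis blinfun_apply_blinfun_compose)

lemma commutantI:
  fixes X :: "'a::chilbert_space op set"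
  shows "T \<in> bop E \<Longrightarrow> (\<And>R x. R \<in> X \<Longrightarrow> T (R x) = R (T x)) \<Longrightarrow> T \<in> commutant E X"
  by (auto simp: commutant_def intro!: blinfun_eqI)

lemma csubspace_commutant:
  assumes "csubspace E" "X \<subseteq> bop E"
  shows "csubspace (commutant E X)"
  unfolding csubspace_def
proof (intro conjI ballI allI)
  note sub = csubspaceD[OF csubspace_bop[OF assms(1)]]
  show "0 \<in> commutant E X" by (rule commutantI) (auto simp: sub blinfun.zero_right)
  show "T + R \<in> commutant E X" if "T \<in> commutant E X" "R \<in> commutant E X" for T R
    by (rule commutantI) (use that in
        \<open>auto simp: sub commutant_bop blinfun.add_left blinfun.add_right commutantD\<close>)
  show "c *\<^sub>C T \<in> commutant E X" if T: "T \<in> commutant E X" for c T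
  proof (rule commutantI)
    fix R x assume R: "R \<in> X"
    then have "R \<in> bop E" using assms by blast
    then show "(c *\<^sub>C T) (R x) = R ((c *\<^sub>C T) x)"
      using R T by (simp add: bop_scaleC commutantD)
  qed (use T in \<open>simp add: sub commutant_bop\<close>)
qed

lemma commutant_compose:
  assumes "T \<in> commutant E X" "R \<in> commutant E X"
  shows "T o\<^sub>L R \<in> commutant E X"
proof (rule commutantI)
  show "T o\<^sub>L R \<in> bop E" using assms by (auto simp: commutant_def bop_def blinfun.zero_right)
qed (use assms in \<open>simp add: commutantD\<close>)

lemma commutant_adj:
  fixes T :: "'a::chilbert_space op"
  assumes E: "closed_csubspace E" and X: "X \<subseteq> bop E" "\<And>R. R \<in> X \<Longrightarrow> adj R \<in> X"
      and T: "T \<in> commutant E X"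
  shows "adj T \<in> commutant E X"
proof (rule commutantI)
  have Tb: "T \<in> bop UNIV" using commutant_bop[OF T] bop_subset_UNIV by blast
  show "adj T \<in> bop E" by (rule adj_bop[OF E commutant_bop[OF T]])
  fix R x assume R: "R \<in> X"
  then have Rb: "R \<in> bop UNIV" using X(1) bop_subset_UNIV by blast
  show "adj T (R x) = R (adj T x)"
  proof (rule cinner_ext)
    fix y
    have "cinner y (adj T (R x)) = cinner (adj R (T y)) x" by (simp add: cinner_adj Tb Rb)
    also have "adj R (T y) = T (adj R y)" using commutantD[OF T X(2)[OF R]] by simp
    also have "cinner (T (adj R y)) x = cinner y (R (adj T x))"
      by (simp only: cinner_adj(1)[OF Tb, symmetric] cinner_adj(2)[OF Rb])
    finally show "cinner y (adj T (R x)) = cinner y (R (adj T x))" .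
  qed
qed

lemma unit_op_commutant:
  assumes "closed_csubspace E" "X \<subseteq> bop E"
  shows "unit_op E \<in> commutant E X"
  by (rule commutantI[OF unit_op(1)[OF assms(1)]])
    (use assms in \<open>simp add: bop_unit_left bop_unit_right subset_iff\<close>)

lemma subset_bicommutant: "X \<subseteq> bop E \<Longrightarrow> X \<subseteq> bicommutant E X"
  by (auto intro!: commutantI simp: commutantD)

text \<open>Invariance says \<open>P R P = R P\<close> for the projection \<open>P\<close> onto \<open>M\<close>. As \<open>X\<close> is self-adjoint, taking
  adjoints gives \<open>P R P = P R\<close> as well.\<close>

lemma invariant_projection_commutant:
  fixes X :: "'a::chilbert_space op set"
  assumes E: "closed_csubspace E" and M: "closed_csubspace M" "M \<subseteq> E"
    and X: "X \<subseteq> bop E" "\<And>R. R \<in> X \<Longrightarrow> adj R \<in> X" and inv: "\<And>R x. R \<in> X \<Longrightarrow> x \<in> M \<Longrightarrow> R x \<in> M"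
  shows "unit_op M \<in> commutant E X"
proof (rule commutantI)
  let ?P = "unit_op M"
  note PM = bop_range[OF unit_op(1)[OF M(1)]]
  have "?P x = 0" if "\<forall>y\<in>E. cinner y x = 0" for x
    using unit_op(1)[OF M(1)] M(2) that by (simp add: bop_def subset_iff)
  then show "?P \<in> bop E" using unit_op(1)[OF M(1)] PM M(2) by (auto simp: bop_def)
  fix R x assume R: "R \<in> X"
  then have Rb: "R \<in> bop UNIV" using X(1) bop_subset_UNIV by blast
  show "?P (R x) = R (?P x)"
  proof (rule cinner_ext)
    fix y
    have "cinner y (?P (R x)) = cinner (adj R (?P y)) x"
      by (simp add: unit_op_selfadjoint[OF M(1), symmetric] cinner_adj[OF Rb])
    also have "adj R (?P y) = ?P (adj R (?P y))"
      by (rule unit_op(2)[OF M(1) inv[OF X(2)[OF R] PM], symmetric])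
    also have "cinner \<dots> x = cinner y (?P (R (?P x)))"
      by (simp add: unit_op_selfadjoint[OF M(1)] cinner_adj[OF Rb])
    also have "?P (R (?P x)) = R (?P x)" by (rule unit_op(2)[OF M(1) inv[OF R PM]])
    finally show "cinner y (?P (R x)) = cinner y (R (?P x))" .
  qed
qed

section \<open>Joint approximate eigenvectors\<close>

text \<open>A filter on unit vectors along which every operator of a family behaves like the assigned
  scalar. There is a largest such filter, and it inherits every transformation of vectors which
  respects the condition.\<close>

definition eigenfilter :: "('a::chilbert_space op \<times> complex) set \<Rightarrow> 'a filter \<Rightarrow> bool" where
  "eigenfilter G \<Phi> \<longleftrightarrow> eventually (\<lambda>\<xi>. norm \<xi> = 1) \<Phi> \<and>
     (\<forall>T t. (T, t) \<in> G \<longrightarrow> ((\<lambda>\<xi>. T \<xi> - t *\<^sub>C \<xi>) \<longlongrightarrow> 0) \<Phi>)"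

text \<open>This is the improper filter if there is no proper eigenfilter.\<close>

definition largest_eigenfilter :: "('a::chilbert_space op \<times> complex) set \<Rightarrow> 'a filter" where
  "largest_eigenfilter G = Sup {\<Phi>. eigenfilter G \<Phi>}"

lemma eigenfilter_largest: "eigenfilter G (largest_eigenfilter G)"
  by (auto simp: eigenfilter_def largest_eigenfilter_def tendsto_def eventually_Sup)

lemma eigenfilter_le_largest: "eigenfilter G \<Phi> \<Longrightarrow> \<Phi> \<le> largest_eigenfilter G"
  by (simp add: largest_eigenfilter_def Sup_upper)

lemma eigenfilter_mono: "eigenfilter G \<Phi> \<Longrightarrow> \<Psi> \<le> \<Phi> \<Longrightarrow> G' \<subseteq> G \<Longrightarrow> eigenfilter G' \<Psi>"
  unfolding eigenfilter_def by (meson filter_leD subset_iff tendsto_mono)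

lemma inf_principal_neq_bot:
  "frequently P F \<Longrightarrow> inf F (principal {x. P x}) \<noteq> bot"
  by (auto simp: trivial_limit_def eventually_inf_principal frequently_def)

lemma eigenfilter_transform:
  fixes U :: "'a::chilbert_space op"
  assumes \<Psi>: "eigenfilter G \<Psi>" and U: "U \<in> bop UNIV"
    and comm: "\<And>V v. (V, v) \<in> G \<Longrightarrow> ((\<lambda>\<xi>. V (U \<xi>) - U (V \<xi>)) \<longlongrightarrow> 0) \<Psi>"
    and m: "0 < m" "eventually (\<lambda>\<xi>. m \<le> norm (U \<xi>)) \<Psi>"
  shows "eigenfilter G (filtermap (\<lambda>\<xi>. U \<xi> /\<^sub>R norm (U \<xi>)) \<Psi>)"
  unfolding eigenfilter_def
proof (intro conjI allI impI)
  show "eventually (\<lambda>\<xi>. norm \<xi> = 1) (filtermap (\<lambda>\<xi>. U \<xi> /\<^sub>R norm (U \<xi>)) \<Psi>)"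
    unfolding eventually_filtermap
  proof (rule eventually_mono[OF m(2)])
    fix \<xi> assume "m \<le> norm (U \<xi>)"
    then have "norm (U \<xi>) > 0" using m(1) by linarith
    then show "norm (U \<xi> /\<^sub>R norm (U \<xi>)) = 1" by simp
  qed
  fix V v assume V: "(V, v) \<in> G"
  have "((\<lambda>\<xi>. V \<xi> - v *\<^sub>C \<xi>) \<longlongrightarrow> 0) \<Psi>" using \<Psi> V by (auto simp: eigenfilter_def)
  from tendsto_add[OF comm[OF V] blinfun.tendsto[OF tendsto_const[of U] this]]
  have "((\<lambda>\<xi>. V (U \<xi>) - v *\<^sub>C U \<xi>) \<longlongrightarrow> 0) \<Psi>"
    using U by (simp add: blinfun.diff_right bop_scaleC blinfun.zero_right)
  then have lim: "((\<lambda>\<xi>. norm (V (U \<xi>) - v *\<^sub>C U \<xi>) / m) \<longlongrightarrow> 0) \<Psi>"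
    by (intro tendsto_divide_zero tendsto_norm_zero)
  have "((\<lambda>\<xi>. V (U \<xi> /\<^sub>R norm (U \<xi>)) - v *\<^sub>C (U \<xi> /\<^sub>R norm (U \<xi>))) \<longlongrightarrow> 0) \<Psi>"
  proof (rule Lim_null_comparison[OF eventually_mono[OF m(2)] lim])
    fix \<xi> assume le: "m \<le> norm (U \<xi>)"
    have "V (U \<xi> /\<^sub>R norm (U \<xi>)) - v *\<^sub>C (U \<xi> /\<^sub>R norm (U \<xi>))
        = (V (U \<xi>) - v *\<^sub>C U \<xi>) /\<^sub>R norm (U \<xi>)"
      by (simp add: blinfun.scaleR_right scaleR_right_diff_distrib scaleC.scaleR_right)
    then have "norm (V (U \<xi> /\<^sub>R norm (U \<xi>)) - v *\<^sub>C (U \<xi> /\<^sub>R norm (U \<xi>)))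
        = norm (V (U \<xi>) - v *\<^sub>C U \<xi>) / norm (U \<xi>)"
      by (simp add: divide_inverse mult.commute)
    also have "\<dots> \<le> norm (V (U \<xi>) - v *\<^sub>C U \<xi>) / m"
      using m(1) le by (intro divide_left_mono mult_pos_pos less_le_trans[OF m(1)]) simp_all
    finally show "norm (V (U \<xi> /\<^sub>R norm (U \<xi>)) - v *\<^sub>C (U \<xi> /\<^sub>R norm (U \<xi>)))
        \<le> norm (V (U \<xi>) - v *\<^sub>C U \<xi>) / m" .
  qed
  then show "((\<lambda>\<xi>. V \<xi> - v *\<^sub>C \<xi>) \<longlongrightarrow> 0) (filtermap (\<lambda>\<xi>. U \<xi> /\<^sub>R norm (U \<xi>)) \<Psi>)"
    by (simp add: filterlim_filtermap)
qed

text \<open>Let \<open>c\<close> be the upper limit of \<open>\<parallel>T \<xi>\<parallel>\<close> along the largest eigenfilter. Since \<open>T\<close>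
  asymptotically commutes with the family, \<open>\<xi> \<mapsto> T \<xi> / \<parallel>T \<xi>\<parallel>\<close> preserves the eigenfilter, so \<open>\<parallel>T\<^sup>2
  \<xi>\<parallel>\<close> cannot exceed \<open>c \<parallel>T \<xi>\<parallel>\<close> asymptotically. Where \<open>\<parallel>T \<xi>\<parallel>\<close> is close to \<open>c\<close> this forces \<open>T\<^sup>2 \<xi>\<close> to
  be close to \<open>c\<^sup>2 \<xi>\<close>, and factoring \<open>T\<^sup>2 - c\<^sup>2\<close> yields approximate eigenvectors for \<open>c\<close> or \<open>-c\<close>.\<close>

lemma eigenfilter_extend:
  fixes T :: "'a::chilbert_space op"
  assumes T: "T \<in> bop UNIV" "adj T = T"
    and comm: "\<And>V v \<Psi>. (V, v) \<in> G \<Longrightarrow> eigenfilter G \<Psi> \<Longrightarrow> ((\<lambda>\<xi>. V (T \<xi>) - T (V \<xi>)) \<longlongrightarrow> 0) \<Psi>"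
    and \<Phi>: "\<Phi> \<noteq> bot" "eigenfilter G \<Phi>" and c0: "eventually (\<lambda>\<xi>. c0 \<le> norm (T \<xi>)) \<Phi>"
  shows "\<exists>t \<Psi>. \<Psi> \<noteq> bot \<and> eigenfilter (insert (T, complex_of_real t) G) \<Psi> \<and> c0 \<le> \<bar>t\<bar>"
proof -
  define F where "F = largest_eigenfilter G"
  have \<Phi>F: "\<Phi> \<le> F" using \<Phi> by (simp add: F_def eigenfilter_le_largest)
  have eF: "eigenfilter G F" by (simp add: F_def eigenfilter_largest)
  have Fnb: "F \<noteq> bot" using \<Phi>F \<Phi>(1) by (auto simp: bot_unique)
  have unit: "eventually (\<lambda>\<xi>. norm \<xi> = 1) F" using eF by (simp add: eigenfilter_def)
  define R where "R = {r. eventually (\<lambda>\<xi>. norm (T \<xi>) \<le> r) F}"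
  have Rne: "norm T \<in> R"
    unfolding R_def
    by (simp, rule eventually_mono[OF unit]) (metis mult.right_neutral norm_blinfun)
  have Rlow: "max 0 c0 \<le> r" if "r \<in> R" for r
  proof -
    have "eventually (\<lambda>\<xi>. norm (T \<xi>) \<le> r) \<Phi>"
      using that \<Phi>F by (auto simp: R_def le_filter_def)
    then have "eventually (\<lambda>\<xi>. max 0 c0 \<le> r) \<Phi>"
      using c0 by eventually_elim (auto intro: order_trans[OF norm_ge_zero])
    then show ?thesis using \<Phi>(1) by (simp add: eventually_const_iff)
  qed
  define c where "c = Inf R"
  have c: "max 0 c0 \<le> c" unfolding c_def by (rule cInf_greatest) (use Rne Rlow in auto)
  have upper: "eventually (\<lambda>\<xi>. norm (T \<xi>) \<le> c + d) F" if d: "d > 0" for d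
  proof -
    obtain r where r: "r \<in> R" "r < c + d"
      using cInf_lessD[of R "c + d"] Rne d unfolding c_def by auto
    then have "eventually (\<lambda>\<xi>. norm (T \<xi>) \<le> r) F" by (simp add: R_def)
    then show ?thesis by (rule eventually_mono) (use r in simp)
  qed
  have freq: "frequently (\<lambda>\<xi>. c - d < norm (T \<xi>)) F" if "d > 0" for d
    unfolding frequently_def
  proof
    assume "eventually (\<lambda>\<xi>. \<not> c - d < norm (T \<xi>)) F"
    then have "c - d \<in> R" by (simp add: R_def not_less)
    then have "c \<le> c - d" unfolding c_def
      by (rule cInf_lower) (use Rlow in \<open>auto intro!: bdd_belowI[of _ 0]\<close>)
    then show False using that by simp
  qed
  \<comment> \<open>The restriction of \<open>F\<close> to vectors along which \<open>\<parallel>T \<xi>\<parallel>\<close> tends to \<open>c\<close>.\<close>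
  define F' where "F' = (INF d\<in>{0<..}. inf F (principal {\<xi>. c - d < norm (T \<xi>)}))"
  have F'nb: "F' \<noteq> bot"
    unfolding F'_def
  proof (subst INF_filter_bot_base)
    show "\<exists>k\<in>{0<..}. inf F (principal {\<xi>. c - k < norm (T \<xi>)}) \<le>
        inf (inf F (principal {\<xi>. c - i < norm (T \<xi>)})) (inf F (principal {\<xi>. c - j < norm (T \<xi>)}))"
      if "i \<in> {0<..}" "j \<in> {0<..}" for i j :: real
      by (rule bexI[of _ "min i j"], rule inf_greatest; (rule inf_mono[OF order_refl])?)
          (use that in auto)
    show "\<not> (\<exists>d\<in>{0<..}. inf F (principal {\<xi>. c - d < norm (T \<xi>)}) = bot)"
      using freq inf_principal_neq_bot by auto
  qed
  have F'F: "F' \<le> F" unfolding F'_def by (rule INF_lower2[of 1]) auto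
  have eF': "eigenfilter G F'" using eF F'F by (rule eigenfilter_mono) simp
  have unit': "eventually (\<lambda>\<xi>. norm \<xi> = 1) F'" using eF' by (simp add: eigenfilter_def)
  have up': "eventually (\<lambda>\<xi>. norm (T \<xi>) \<le> c + d) F'" if "d > 0" for d
    using upper[OF that] F'F by (auto simp: le_filter_def)
  have low': "eventually (\<lambda>\<xi>. c - d < norm (T \<xi>)) F'" if "d > 0" for d
  proof -
    have "F' \<le> principal {\<xi>. c - d < norm (T \<xi>)}"
      unfolding F'_def by (rule INF_lower2[of d]) (use that in auto)
    then show ?thesis by (simp add: le_principal)
  qed
  have TT: "cinner (T x) y = cinner x (T y)" for x y using cinner_adj(2)[OF T(1)] T(2) by simp
  show ?thesis
  proof (cases "c = 0")
    case True
    have "((\<lambda>\<xi>. T \<xi>) \<longlongrightarrow> 0) F'"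
    proof (rule tendstoI)
      fix e :: real assume "e > 0"
      then have "eventually (\<lambda>\<xi>. norm (T \<xi>) \<le> 0 + e/2) F'" using up'[of "e/2"] True by simp
      then show "eventually (\<lambda>\<xi>. dist (T \<xi>) 0 < e) F'"
        by (rule eventually_mono) (use \<open>e > 0\<close> in simp)
    qed
    then have "eigenfilter (insert (T, complex_of_real 0) G) F'" using eF'
      by (auto simp: eigenfilter_def)
    then show ?thesis using F'nb c True by (metis abs_zero max.bounded_iff)
  next
    case False
    then have c0': "c > 0" using c by simp
    have half: "eventually (\<lambda>\<xi>. c/2 \<le> norm (T \<xi>)) F'"
      by (rule eventually_mono[OF low'[of "c/2"]]) (use c0' in auto)
    have "eigenfilter G (filtermap (\<lambda>\<xi>. T \<xi> /\<^sub>R norm (T \<xi>)) F')"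
      by (rule eigenfilter_transform[OF eF' T(1) comm[OF _ eF'] _ half]) (use c0' in auto)
    then have le: "filtermap (\<lambda>\<xi>. T \<xi> /\<^sub>R norm (T \<xi>)) F' \<le> F"
      by (simp add: F_def eigenfilter_le_largest)
    have sq: "((\<lambda>\<xi>. T (T \<xi>) - (c\<^sup>2) *\<^sub>R \<xi>) \<longlongrightarrow> 0) F'"
    proof (rule tendstoI)
      fix e :: real assume e: "e > 0"
      have "((\<lambda>d. (c + d)^4 - 2 * c\<^sup>2 * (c - d)\<^sup>2 + c^4) \<longlongrightarrow> (c + 0)^4 - 2 * c\<^sup>2 * (c - 0)\<^sup>2 + c^4)
          (at_right 0)"
        by (intro tendsto_intros)
      moreover have "(c + 0)^4 - 2 * c\<^sup>2 * (c - 0)\<^sup>2 + c^4 = 0"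
        by (simp add: power2_eq_square power4_eq_xxxx)
      ultimately have "((\<lambda>d. (c + d)^4 - 2 * c\<^sup>2 * (c - d)\<^sup>2 + c^4) \<longlongrightarrow> 0) (at_right 0)"
        by (simp only:)
      then have "eventually (\<lambda>d. (c + d)^4 - 2 * c\<^sup>2 * (c - d)\<^sup>2 + c^4 < e\<^sup>2) (at_right 0)"
        using e by (intro order_tendstoD(2)[of _ 0]) auto
      moreover have "eventually (\<lambda>d. d < c) (at_right (0::real))"
        using c0' eventually_at_right_field by blast
      moreover have "eventually (\<lambda>d. d > 0) (at_right (0::real))" by (rule eventually_at_right_less)
      ultimately have "eventually (\<lambda>d. (c + d)^4 - 2 * c\<^sup>2 * (c - d)\<^sup>2 + c^4 < e\<^sup>2 \<and> d < c
          \<and> d > 0) (at_right 0)"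
        by eventually_elim (intro conjI)
      from eventually_happens'[OF trivial_limit_at_right_real this]
      obtain d where d: "(c + d)^4 - 2 * c\<^sup>2 * (c - d)\<^sup>2 + c^4 < e\<^sup>2" "d < c" "d > 0"
        by blast
      have "eventually (\<lambda>\<xi>. norm (T \<xi>) \<le> c + d) (filtermap (\<lambda>\<xi>. T \<xi> /\<^sub>R norm (T \<xi>)) F')"
        using upper[OF d(3)] le by (auto simp: le_filter_def)
      then have "eventually (\<lambda>\<xi>. norm (T (T \<xi> /\<^sub>R norm (T \<xi>))) \<le> c + d) F'"
        by (simp add: eventually_filtermap)
      then show "eventually (\<lambda>\<xi>. dist (T (T \<xi>) - (c\<^sup>2) *\<^sub>R \<xi>) 0 < e) F'"
        using half up'[OF d(3)] low'[OF d(3)] unit'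
      proof eventually_elim
        case (elim \<xi>)
        have pos: "norm (T \<xi>) > 0" using elim(2) c0' by linarith
        then have "norm (T (T \<xi>)) \<le> (c + d) * norm (T \<xi>)"
          using elim(1) by (simp add: blinfun.scaleR_right divide_simps)
        also have "\<dots> \<le> (c + d) * (c + d)" using elim(3) c0' d by (intro mult_left_mono) auto
        finally have "(norm (T (T \<xi>)))\<^sup>2 \<le> ((c + d) * (c + d))\<^sup>2" by (rule power_mono) simp
        then have 1: "(norm (T (T \<xi>)))\<^sup>2 \<le> (c + d)^4"
          by (simp add: power2_eq_square power4_eq_xxxx mult.assoc)
        have "(c - d)\<^sup>2 \<le> (norm (T \<xi>))\<^sup>2" using elim(4) d by (intro power_mono) auto
        then have 2: "c\<^sup>2 * (c - d)\<^sup>2 \<le> c\<^sup>2 * (norm (T \<xi>))\<^sup>2" by (intro mult_left_mono) auto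
        have "(norm (T (T \<xi>) - (c\<^sup>2) *\<^sub>R \<xi>))\<^sup>2 = (norm (T (T \<xi>)))\<^sup>2 - 2 * (c\<^sup>2 * (norm (T \<xi>))\<^sup>2)
            + c^4"
          by (simp add: norm_diff_sq cinner_scaleR_right TT[of "T \<xi>"] norm_sq_cinner[of "T \<xi>"]
              elim(5))
        then have "(norm (T (T \<xi>) - (c\<^sup>2) *\<^sub>R \<xi>))\<^sup>2 < e\<^sup>2" using 1 2 d(1) by linarith
        then show ?case using e by (simp add: power2_less_imp_less)
      qed
    qed
    \<comment> \<open>If \<open>(T + c) \<xi>\<close> tends to zero, \<open>-c\<close> is an approximate eigenvalue. Otherwise the normalised
      vectors \<open>(T + c) \<xi>\<close> are approximate eigenvectors for \<open>c\<close>.\<close>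
    define U where "U = T + c *\<^sub>R id_blinfun"
    have Uapp: "U x = T x + c *\<^sub>R x" for x by (simp add: U_def blinfun.add_left blinfun.scaleR_left)
    have U_eq: "blinfun_apply U = (\<lambda>x. T x + complex_of_real c *\<^sub>C x)"
      by (rule ext) (simp add: Uapp scaleR_scaleC)
    have U: "U \<in> bop UNIV" using T(1)
      by (simp add: bop_UNIV Uapp scaleC_add_right scaleC.scaleR_right)
    show ?thesis
    proof (cases "(U \<longlongrightarrow> 0) F'")
      case True
      then have "eigenfilter (insert (T, complex_of_real (- c)) G) F'"
        using eF' by (auto simp: eigenfilter_def scaleC.minus_left U_eq)
      then show ?thesis using F'nb c by (metis abs_minus_cancel abs_of_nonneg max.bounded_iff)
    next
      case False
      then obtain m where m: "m > 0" "\<not> eventually (\<lambda>\<xi>. dist (U \<xi>) 0 < m) F'"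
        by (auto simp: tendsto_iff)
      then have "frequently (\<lambda>\<xi>. m \<le> norm (U \<xi>)) F'" by (simp add: frequently_def not_le)
      define \<Psi> where "\<Psi> = inf F' (principal {\<xi>. m \<le> norm (U \<xi>)})"
      have \<Psi>: "\<Psi> \<noteq> bot" "\<Psi> \<le> F'"
        using inf_principal_neq_bot[OF \<open>frequently _ F'\<close>] by (simp_all add: \<Psi>_def)
      have ev: "eventually (\<lambda>\<xi>. m \<le> norm (U \<xi>)) \<Psi>" by (simp add: \<Psi>_def eventually_inf_principal)
      have e\<Psi>: "eigenfilter G \<Psi>" using eF' \<Psi>(2) by (rule eigenfilter_mono) simp
      let ?\<Psi> = "filtermap (\<lambda>\<xi>. U \<xi> /\<^sub>R norm (U \<xi>)) \<Psi>"
      have e1: "eigenfilter G ?\<Psi>"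
      proof (rule eigenfilter_transform[OF e\<Psi> U _ m(1) ev])
        fix V v assume "(V, v) \<in> G"
        from comm[OF this e\<Psi>] show "((\<lambda>\<xi>. V (U \<xi>) - U (V \<xi>)) \<longlongrightarrow> 0) \<Psi>"
          by (simp add: Uapp blinfun.add_right blinfun.scaleR_right)
      qed
      have "((\<lambda>\<xi>. T (U \<xi> /\<^sub>R norm (U \<xi>)) - complex_of_real c *\<^sub>C (U \<xi> /\<^sub>R norm (U \<xi>))) \<longlongrightarrow> 0) \<Psi>"
      proof (rule Lim_null_comparison[OF eventually_mono[OF ev]])
        show "((\<lambda>\<xi>. norm (T (T \<xi>) - (c\<^sup>2) *\<^sub>R \<xi>) / m) \<longlongrightarrow> 0) \<Psi>"
          by (intro tendsto_divide_zero tendsto_norm_zero tendsto_mono[OF \<Psi>(2) sq])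
        fix \<xi> assume le: "m \<le> norm (U \<xi>)"
        have "T (U \<xi> /\<^sub>R norm (U \<xi>)) - c *\<^sub>R (U \<xi> /\<^sub>R norm (U \<xi>))
            = (T (T \<xi>) - (c\<^sup>2) *\<^sub>R \<xi>) /\<^sub>R norm (U \<xi>)"
          by (simp add: Uapp blinfun.scaleR_right blinfun.add_right algebra_simps power2_eq_square)
        then have "norm (T (U \<xi> /\<^sub>R norm (U \<xi>)) - c *\<^sub>R (U \<xi> /\<^sub>R norm (U \<xi>)))
            = norm (T (T \<xi>) - (c\<^sup>2) *\<^sub>R \<xi>) / norm (U \<xi>)"
          by (simp add: divide_inverse mult.commute)
        also have "\<dots> \<le> norm (T (T \<xi>) - (c\<^sup>2) *\<^sub>R \<xi>) / m"
          using m(1) le by (intro divide_left_mono mult_pos_pos less_le_trans[OF m(1)]) simp_all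
        finally show "norm (T (U \<xi> /\<^sub>R norm (U \<xi>)) - complex_of_real c *\<^sub>C (U \<xi> /\<^sub>R norm (U \<xi>)))
            \<le> norm (T (T \<xi>) - (c\<^sup>2) *\<^sub>R \<xi>) / m"
          by (simp add: scaleR_scaleC)
      qed
      then have "eigenfilter (insert (T, complex_of_real c) G) ?\<Psi>"
        using e1 by (auto simp: eigenfilter_def filterlim_filtermap)
      moreover have "?\<Psi> \<noteq> bot" using \<Psi>(1) by (simp add: filtermap_bot_iff)
      ultimately show ?thesis using c by (metis abs_of_nonneg max.bounded_iff)
    qed
  qed
qed

text \<open>The hypothesis on finite sets says that \<open>J\<close> almost vanishes at suitable unit vectors where
  \<open>x\<close> has norm at least \<open>c\<close>. Modulo \<open>J\<close> the family \<open>N\<close> is commutative, so approximate eigenvalues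
  can be added one operator at a time, \<open>x\<close> first; Zorn's lemma reaches all of \<open>N\<close>.\<close>

lemma exists_joint_eigenfilter:
  fixes N :: "'a::chilbert_space op set"
  assumes N: "csubspace N" "N \<subseteq> bop UNIV" "\<And>T. T \<in> N \<Longrightarrow> adj T \<in> N"
    and J: "J \<subseteq> N" "\<And>T R. T \<in> N \<Longrightarrow> R \<in> N \<Longrightarrow> (T o\<^sub>L R) - (R o\<^sub>L T) \<in> J"
    and x: "x \<in> N" "adj x = x"
    and start: "\<And>F e. finite F \<Longrightarrow> F \<subseteq> J \<Longrightarrow> 0 < e \<Longrightarrow>
       \<exists>\<xi>. norm \<xi> = 1 \<and> (\<forall>j\<in>F. norm (blinfun_apply j \<xi>) \<le> e) \<and> c \<le> norm (x \<xi>)"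
  shows "\<exists>(\<phi> :: 'a op \<Rightarrow> complex) \<Phi>. \<Phi> \<noteq> bot \<and> eventually (\<lambda>\<xi>. norm \<xi> = 1) \<Phi> \<and>
     (\<forall>T\<in>N. ((\<lambda>\<xi>. blinfun_apply T \<xi> - \<phi> T *\<^sub>C \<xi>) \<longlongrightarrow> 0) \<Phi>) \<and> c \<le> cmod (\<phi> x)"
proof -
  let ?J = "J \<times> {0 :: complex}"
  have comm: "((\<lambda>\<xi>. V (T \<xi>) - T (V \<xi>)) \<longlongrightarrow> 0) \<Psi>"
    if "eigenfilter G \<Psi>" "?J \<subseteq> G" "G \<subseteq> N \<times> UNIV" "(V, v) \<in> G" "T \<in> N" for V v T \<Psi> G
  proof -
    have "V \<in> N" using that(3,4) by blast
    then have "((V o\<^sub>L T) - (T o\<^sub>L V), 0) \<in> G" using J(2)[OF _ that(5)] that(2) by blast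
    then have "((\<lambda>\<xi>. ((V o\<^sub>L T) - (T o\<^sub>L V)) \<xi> - 0 *\<^sub>C \<xi>) \<longlongrightarrow> 0) \<Psi>"
      using that(1) unfolding eigenfilter_def by blast
    then show ?thesis by (simp add: blinfun.diff_left)
  qed
  define X :: "'a op set \<times> real \<Rightarrow> 'a set" where
      "X = (\<lambda>(F, e). {\<xi>. norm \<xi> = 1 \<and> (\<forall>j\<in>F. norm (blinfun_apply j \<xi>) \<le> e) \<and> c \<le> norm (x \<xi>)})"
  define I where "I = {(F, e). finite F \<and> F \<subseteq> J \<and> (0::real) < e}"
  define \<Phi>0 where "\<Phi>0 = (INF p\<in>I. principal (X p))"
  have "\<Phi>0 \<noteq> bot"
    unfolding \<Phi>0_def
  proof (subst INF_filter_bot_base)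
    show "\<exists>k\<in>I. principal (X k) \<le> inf (principal (X i)) (principal (X j))" if "i \<in> I" "j \<in> I"
        for i j
    proof -
      obtain F e F' e' where ij: "i = (F, e)" "j = (F', e')" by (cases i, cases j) auto
      show ?thesis
        by (rule bexI[of _ "(F \<union> F', min e e')"]) (use that ij in \<open>auto simp: X_def I_def\<close>)
    qed
    show "\<not> (\<exists>i\<in>I. principal (X i) = bot)"
    proof clarsimp
      fix F e assume "(F, e) \<in> I" "principal (X (F, e)) = bot"
      then have "X (F, e) = {}" by (simp add: principal_eq_bot_iff)
      then show False using start[of F e] \<open>(F, e) \<in> I\<close> by (auto simp: X_def I_def)
    qed
  qed
  have ev0: "eventually (\<lambda>\<xi>. \<xi> \<in> X p) \<Phi>0" if "p \<in> I" for p
  proof -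
    have "\<Phi>0 \<le> principal (X p)" unfolding \<Phi>0_def by (rule INF_lower[OF that])
    then show ?thesis by (simp add: le_principal)
  qed
  have e0: "eigenfilter ?J \<Phi>0"
    unfolding eigenfilter_def
  proof (intro conjI allI impI)
    show "eventually (\<lambda>\<xi>. norm \<xi> = 1) \<Phi>0"
      by (rule eventually_mono[OF ev0[of "({}, 1)"]]) (auto simp: X_def I_def)
    fix T t assume "(T, t) \<in> ?J"
    then have T: "T \<in> J" "t = 0" by auto
    have "(T \<longlongrightarrow> 0) \<Phi>0"
    proof (rule tendstoI)
      fix e :: real assume "e > 0"
      then show "eventually (\<lambda>\<xi>. dist (T \<xi>) 0 < e) \<Phi>0"
        by (intro eventually_mono[OF ev0[of "({T}, e/2)"]]) (use T in \<open>auto simp: X_def I_def\<close>)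
    qed
    then show "((\<lambda>\<xi>. T \<xi> - t *\<^sub>C \<xi>) \<longlongrightarrow> 0) \<Phi>0" using T by simp
  qed
  have c0: "eventually (\<lambda>\<xi>. c \<le> norm (x \<xi>)) \<Phi>0"
    by (rule eventually_mono[OF ev0[of "({}, 1)"]]) (auto simp: X_def I_def)
  have JN: "?J \<subseteq> N \<times> UNIV" using J(1) by auto
  have "\<exists>t \<Psi>. \<Psi> \<noteq> bot \<and> eigenfilter (insert (x, complex_of_real t) ?J) \<Psi> \<and> c \<le> \<bar>t\<bar>"
    by (rule eigenfilter_extend[OF _ x(2) _ \<open>\<Phi>0 \<noteq> bot\<close> e0 c0])
        (use x(1) N(2) comm[OF _ _ JN] in blast)+
  then obtain t \<Psi>0 where t: "\<Psi>0 \<noteq> bot" "eigenfilter (insert (x, complex_of_real t) ?J) \<Psi>0"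
      "c \<le> \<bar>t\<bar>" by blast
  define \<G> where "\<G> = {G. G \<subseteq> N \<times> UNIV \<and> insert (x, complex_of_real t) ?J \<subseteq> G
      \<and> (\<exists>\<Phi>. \<Phi> \<noteq> bot \<and> eigenfilter G \<Phi>)}"
  have "\<exists>M\<in>\<G>. \<forall>X\<in>\<G>. M \<subseteq> X \<longrightarrow> X = M"
  proof (rule subset_Zorn_nonempty)
    have "insert (x, complex_of_real t) ?J \<in> \<G>" using t x(1) J(1) by (auto simp: \<G>_def)
    then show "\<G> \<noteq> {}" by blast
    fix C assume C: "C \<noteq> {}" "subset.chain \<G> C"
    then have C\<G>: "C \<subseteq> \<G>" and lin: "\<And>G H. G \<in> C \<Longrightarrow> H \<in> C \<Longrightarrow> G \<subseteq> H \<or> H \<subseteq> G"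
      by (auto simp: subset.chain_def)
    define \<Phi> where "\<Phi> = (INF G\<in>C. largest_eigenfilter G)"
    have "\<Phi> \<noteq> bot"
      unfolding \<Phi>_def
    proof (subst INF_filter_bot_base)
      fix G H assume GH: "G \<in> C" "H \<in> C"
      have mono: "largest_eigenfilter H' \<le> largest_eigenfilter G'" if "G' \<subseteq> H'"
          for G' H' :: "('a op \<times> complex) set"
        using eigenfilter_mono[OF eigenfilter_largest order_refl that]
            by (rule eigenfilter_le_largest)
      show "\<exists>k\<in>C. largest_eigenfilter k \<le> inf (largest_eigenfilter G) (largest_eigenfilter H)"
        using lin[OF GH] mono GH by (metis inf.absorb1 inf.absorb2 order_refl)
    next
      show "\<not> (\<exists>G\<in>C. largest_eigenfilter G = bot)"
      proof
        assume "\<exists>G\<in>C. largest_eigenfilter G = bot"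
        then obtain G where G: "G \<in> C" "largest_eigenfilter G = bot" by blast
        then obtain \<Phi>' where "\<Phi>' \<noteq> bot" "eigenfilter G \<Phi>'" using C\<G> by (auto simp: \<G>_def)
        then show False using eigenfilter_le_largest[of G \<Phi>'] G(2) by (simp add: bot_unique)
      qed
    qed
    moreover have "eigenfilter (\<Union>C) \<Phi>"
      unfolding eigenfilter_def
    proof (intro conjI allI impI)
      have le: "\<Phi> \<le> largest_eigenfilter G" if "G \<in> C" for G unfolding \<Phi>_def
        by (rule INF_lower[OF that])
      obtain G where "G \<in> C" using C by blast
      then show "eventually (\<lambda>\<xi>. norm \<xi> = 1) \<Phi>"
        using eigenfilter_mono[OF eigenfilter_largest le order_refl] by (auto simp: eigenfilter_def)
      fix T t assume "(T, t) \<in> \<Union>C"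
      then obtain G where "G \<in> C" "(T, t) \<in> G" by blast
      then show "((\<lambda>\<xi>. T \<xi> - t *\<^sub>C \<xi>) \<longlongrightarrow> 0) \<Phi>"
        using eigenfilter_mono[OF eigenfilter_largest le order_refl] by (auto simp: eigenfilter_def)
    qed
    ultimately show "\<Union>C \<in> \<G>"
      using C(1) C\<G> unfolding \<G>_def by blast
  qed
  then obtain G where G: "G \<in> \<G>" and max: "\<And>H. H \<in> \<G> \<Longrightarrow> G \<subseteq> H \<Longrightarrow> H = G" by blast
  obtain \<Phi> where \<Phi>: "\<Phi> \<noteq> bot" "eigenfilter G \<Phi>" using G by (auto simp: \<G>_def)
  have GN: "G \<subseteq> N \<times> UNIV" and JG: "?J \<subseteq> G" and xG: "(x, complex_of_real t) \<in> G"
    using G by (auto simp: \<G>_def)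
  have sa: "\<exists>t. (T, t) \<in> G" if T: "T \<in> N" "adj T = T" for T
  proof -
    have "\<exists>t \<Psi>. \<Psi> \<noteq> bot \<and> eigenfilter (insert (T, complex_of_real t) G) \<Psi> \<and> 0 \<le> \<bar>t\<bar>"
      by (rule eigenfilter_extend[OF _ T(2) _ \<Phi>])
          (use T(1) N(2) comm[OF _ JG GN] in \<open>auto intro: always_eventually\<close>)
    then obtain t where "insert (T, complex_of_real t) G \<in> \<G>" using G T(1) by (auto simp: \<G>_def)
    then have "insert (T, complex_of_real t) G = G" by (rule max) auto
    then show ?thesis by blast
  qed
  have lim: "((\<lambda>\<xi>. T \<xi> - t *\<^sub>C \<xi>) \<longlongrightarrow> 0) \<Phi>" if "(T, t) \<in> G" for T t
    using \<Phi>(2) that by (simp add: eigenfilter_def)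
  have all: "\<exists>\<tau>. ((\<lambda>\<xi>. T \<xi> - \<tau> *\<^sub>C \<xi>) \<longlongrightarrow> 0) \<Phi>" if TN: "T \<in> N" for T
  proof -
    obtain h k where hk: "h \<in> N" "k \<in> N" "adj h = h" "adj k = k" "T = h + \<i> *\<^sub>C k"
      using selfadjoint_decomposition[OF N TN] by blast
    obtain s r where sr: "(h, s) \<in> G" "(k, r) \<in> G" using sa hk by blast
    have "((\<lambda>\<xi>. (h \<xi> - s *\<^sub>C \<xi>) + \<i> *\<^sub>C (k \<xi> - r *\<^sub>C \<xi>)) \<longlongrightarrow> 0 + \<i> *\<^sub>C 0) \<Phi>"
      by (intro tendsto_add lim sr scaleC.tendsto tendsto_const)
    moreover have "(h \<xi> - s *\<^sub>C \<xi>) + \<i> *\<^sub>C (k \<xi> - r *\<^sub>C \<xi>) = T \<xi> - (s + \<i> * r) *\<^sub>C \<xi>" for \<xi>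
      by (simp add: hk(5) blinfun.add_left scaleC_add_left scaleC.diff_right scaleC_scaleC)
    ultimately show ?thesis by (auto simp: scaleC.zero_right)
  qed
  define \<phi> :: "'a op \<Rightarrow> complex" where
      "\<phi> T = (if T = x then complex_of_real t else SOME \<tau>. ((\<lambda>\<xi>. T \<xi> - \<tau> *\<^sub>C \<xi>) \<longlongrightarrow> 0) \<Phi>)" for T
  have "((\<lambda>\<xi>. T \<xi> - \<phi> T *\<^sub>C \<xi>) \<longlongrightarrow> 0) \<Phi>" if "T \<in> N" for T
    using someI_ex[OF all[OF that]] lim[OF xG] by (auto simp: \<phi>_def)
  moreover have "c \<le> cmod (\<phi> x)" using t(3) by (simp add: \<phi>_def)
  moreover have "eventually (\<lambda>\<xi>. norm \<xi> = 1) \<Phi>" using \<Phi>(2) by (simp add: eigenfilter_def)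
  ultimately show ?thesis using \<Phi>(1) by blast
qed

definition positive_op :: "'a::chilbert_space op \<Rightarrow> bool" where
  "positive_op T \<longleftrightarrow> (\<forall>y. cinner y (T y) \<in> \<real>\<^sub>\<ge>\<^sub>0)"


text \<open>Unitality is kept separate, since the unit of an algebra of operators on a closed subspace
  is the projection onto it.\<close>

definition character_on :: "'a::chilbert_space op set \<Rightarrow> ('a op \<Rightarrow> complex) \<Rightarrow> bool" where
  "character_on N \<phi> \<longleftrightarrow>
     (\<forall>T\<in>N. \<forall>R\<in>N. \<phi> (T + R) = \<phi> T + \<phi> R \<and> \<phi> (T o\<^sub>L R) = \<phi> T * \<phi> R) \<and>
     (\<forall>c. \<forall>T\<in>N. \<phi> (c *\<^sub>C T) = c * \<phi> T) \<and>
     (\<forall>T\<in>N. \<phi> (adj T) = cnj (\<phi> T) \<and> cmod (\<phi> T) \<le> norm T)"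

text \<open>The scalar by which \<open>T\<close> acts along a joint eigenfilter is the limit of \<open><\<xi>, T \<xi>>\<close>. It is
  therefore unique, and the relations of a positive character pass to the limit.\<close>

lemma exists_character:
  fixes N :: "'a::chilbert_space op set"
  assumes N: "csubspace N" "N \<subseteq> bop UNIV" "\<And>T. T \<in> N \<Longrightarrow> adj T \<in> N"
      "\<And>T R. T \<in> N \<Longrightarrow> R \<in> N \<Longrightarrow> T o\<^sub>L R \<in> N"
    and J: "J \<subseteq> N" "\<And>T R. T \<in> N \<Longrightarrow> R \<in> N \<Longrightarrow> (T o\<^sub>L R) - (R o\<^sub>L T) \<in> J"
    and x: "x \<in> N" "adj x = x"
    and start: "\<And>F e. finite F \<Longrightarrow> F \<subseteq> J \<Longrightarrow> 0 < e \<Longrightarrow>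
       \<exists>\<xi>. norm \<xi> = 1 \<and> (\<forall>j\<in>F. norm (blinfun_apply j \<xi>) \<le> e) \<and> c \<le> norm (x \<xi>)"
  shows "\<exists>\<phi>. character_on N \<phi> \<and> (\<forall>T\<in>N. positive_op T \<longrightarrow> \<phi> T \<in> \<real>\<^sub>\<ge>\<^sub>0) \<and> c \<le> cmod (\<phi> x)"
proof -
  obtain \<phi> :: "'a op \<Rightarrow> complex" and \<Phi> where \<Phi>: "\<Phi> \<noteq> bot" "eventually (\<lambda>\<xi>. norm \<xi> = 1) \<Phi>"
      and c: "c \<le> cmod (\<phi> x)"
    and lim: "\<And>T. T \<in> N \<Longrightarrow> ((\<lambda>\<xi>. T \<xi> - \<phi> T *\<^sub>C \<xi>) \<longlongrightarrow> 0) \<Phi>"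
    using exists_joint_eigenfilter[OF N(1-3) J x start] by blast
  have vec: "((\<lambda>\<xi>. cinner \<xi> (T \<xi>)) \<longlongrightarrow> \<tau>) \<Phi>" if "((\<lambda>\<xi>. T \<xi> - \<tau> *\<^sub>C \<xi>) \<longlongrightarrow> 0) \<Phi>" for T \<tau>
  proof -
    have "((\<lambda>\<xi>. cinner \<xi> (T \<xi> - \<tau> *\<^sub>C \<xi>)) \<longlongrightarrow> 0) \<Phi>"
    proof (rule Lim_null_comparison[OF eventually_mono[OF \<Phi>(2)] tendsto_norm_zero[OF that]])
      fix \<xi> :: 'a assume "norm \<xi> = 1"
      then show "norm (cinner \<xi> (T \<xi> - \<tau> *\<^sub>C \<xi>)) \<le> norm (T \<xi> - \<tau> *\<^sub>C \<xi>)"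
        using cauchy_schwarz[of \<xi> "T \<xi> - \<tau> *\<^sub>C \<xi>"] by simp
    qed
    from tendsto_add[OF this tendsto_const[of \<tau>]]
    have "((\<lambda>\<xi>. cinner \<xi> (T \<xi> - \<tau> *\<^sub>C \<xi>) + \<tau>) \<longlongrightarrow> \<tau>) \<Phi>" by simp
    then show ?thesis
      by (rule Lim_transform_eventually)
        (rule eventually_mono[OF \<Phi>(2)], simp add: cinner_diff cinner_scaleC_right cinner_self)
  qed
  note vlim = vec[OF lim]
  have uniq: "\<phi> T = \<tau>" if "T \<in> N" "((\<lambda>\<xi>. cinner \<xi> (T \<xi>)) \<longlongrightarrow> \<tau>) \<Phi>" for T \<tau>
    using tendsto_unique[OF \<Phi>(1) vlim[OF that(1)] that(2)] .
  note sub = csubspaceD[OF N(1)]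
  have "character_on N \<phi>"
    unfolding character_on_def
  proof (intro conjI ballI allI impI)
    fix T R assume TR: "T \<in> N" "R \<in> N"
    show "\<phi> (T + R) = \<phi> T + \<phi> R"
      by (rule uniq) (use TR sub tendsto_add[OF vlim[OF TR(1)] vlim[OF TR(2)]] in
          \<open>auto simp: blinfun.add_left cinner_add_right\<close>)
    show "\<phi> (T o\<^sub>L R) = \<phi> T * \<phi> R"
    proof (rule uniq[OF N(4)[OF TR]], rule vec)
      have "((\<lambda>\<xi>. T (R \<xi> - \<phi> R *\<^sub>C \<xi>) + \<phi> R *\<^sub>C (T \<xi> - \<phi> T *\<^sub>C \<xi>)) \<longlongrightarrow> T 0 + \<phi> R *\<^sub>C 0) \<Phi>"
        by (intro tendsto_add scaleC.tendsto blinfun.tendsto lim TR tendsto_const)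
      moreover have "T (R \<xi> - \<phi> R *\<^sub>C \<xi>) + \<phi> R *\<^sub>C (T \<xi> - \<phi> T *\<^sub>C \<xi>) = (T o\<^sub>L R) \<xi>
          - (\<phi> T * \<phi> R) *\<^sub>C \<xi>" for \<xi>
        using N(2) TR(1) by (auto simp: blinfun.diff_right scaleC.diff_right scaleC_scaleC
            mult.commute bop_scaleC)
      ultimately show "((\<lambda>\<xi>. (T o\<^sub>L R) \<xi> - (\<phi> T * \<phi> R) *\<^sub>C \<xi>) \<longlongrightarrow> 0) \<Phi>"
        by (simp add: blinfun.zero_right)
    qed
  next
    fix d T assume T: "T \<in> N"
    show "\<phi> (d *\<^sub>C T) = d * \<phi> T"
      by (rule uniq) (use T sub tendsto_mult[OF tendsto_const[of d] vlim[OF T]]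
          in \<open>auto simp: cinner_scaleC_right\<close>)
  next
    fix T assume T: "T \<in> N"
    have TU: "T \<in> bop UNIV" using N(2) T by blast
    show "\<phi> (adj T) = cnj (\<phi> T)"
    proof (rule uniq[OF N(3)[OF T]])
      have "cinner \<xi> (adj T \<xi>) = cnj (cinner \<xi> (T \<xi>))" for \<xi>
        by (simp add: cinner_adj[OF TU] flip: cinner_commute)
      then show "((\<lambda>\<xi>. cinner \<xi> (adj T \<xi>)) \<longlongrightarrow> cnj (\<phi> T)) \<Phi>"
        using tendsto_cnj[OF vlim[OF T]] by simp
    qed
    show "cmod (\<phi> T) \<le> norm T"
    proof (rule tendsto_upperbound[OF tendsto_norm[OF vlim[OF T]] _ \<Phi>(1)])
      show "eventually (\<lambda>\<xi>. cmod (cinner \<xi> (T \<xi>)) \<le> norm T) \<Phi>"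
      proof (rule eventually_mono[OF \<Phi>(2)])
        fix \<xi> :: 'a assume "norm \<xi> = 1"
        then show "cmod (cinner \<xi> (T \<xi>)) \<le> norm T"
          using cauchy_schwarz[of \<xi> "T \<xi>"] norm_blinfun[of T \<xi>] by simp
      qed
    qed
  qed
  moreover have "\<phi> T \<in> \<real>\<^sub>\<ge>\<^sub>0" if "T \<in> N" "positive_op T" for T
    by (rule Lim_in_closed_set[OF closed_nonneg_Reals_complex _ \<Phi>(1) vlim[OF that(1)]])
      (use that in \<open>auto simp: positive_op_def\<close>)
  ultimately show ?thesis using c by blast
qed

section \<open>Compactness of families of states and completely positive maps\<close>

text \<open>This is Tychonoff's theorem for a product of discs. A finer proper filter plays the role of
  a convergent subnet.\<close>

lemma convergent_refinement:
  fixes g :: "'i \<Rightarrow> 'x \<Rightarrow> complex"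
  assumes F: "F \<noteq> bot" and bd: "eventually (\<lambda>i. \<forall>x. cmod (g i x) \<le> b x) F"
  shows "\<exists>F' l. F' \<noteq> bot \<and> F' \<le> F \<and> (\<forall>x. ((\<lambda>i. g i x) \<longlongrightarrow> l x) F')"
proof -
  let ?K = "PiE UNIV (\<lambda>x. cball (0::complex) (b x))"
  have "compactin (product_topology (\<lambda>_. euclidean) UNIV) ?K"
    by (simp add: compactin_PiE)
  then have "compact ?K" by (simp add: euclidean_product_topology)
  moreover have "eventually (\<lambda>f. f \<in> ?K) (filtermap g F)"
    using bd by (simp add: eventually_filtermap PiE_UNIV_domain Pi_iff)
  moreover have "filtermap g F \<noteq> bot" using F by (simp add: filtermap_bot_iff)
  ultimately obtain l where l: "inf (nhds l) (filtermap g F) \<noteq> bot"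
    using compact_filter[of ?K] by blast
  define F' where "F' = inf F (filtercomap g (nhds l))"
  have "F' \<noteq> bot"
  proof
    assume "F' = bot"
    then have "eventually (\<lambda>_. False) (inf F (filtercomap g (nhds l)))" by (simp add: F'_def)
    then obtain P Q where PQ: "eventually P F" "eventually Q (nhds l)" "\<And>i. P i \<Longrightarrow> \<not> Q (g i)"
      unfolding eventually_inf eventually_filtercomap by blast
    then have "eventually (\<lambda>f. \<not> Q f) (filtermap g F)"
      by (auto simp: eventually_filtermap elim: eventually_mono)
    then have "eventually (\<lambda>_. False) (inf (nhds l) (filtermap g F))"
      using PQ(2) unfolding eventually_inf by blast
    then show False using l by (simp add: trivial_limit_def)
  qed
  moreover have "F' \<le> F" by (simp add: F'_def)
  moreover have "((\<lambda>i. g i x) \<longlongrightarrow> l x) F'" for x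
  proof -
    have "filterlim g (nhds l) F'"
      unfolding F'_def by (simp add: filterlim_filtercomap_iff filterlim_iff eventually_inf)
        (metis eventually_True eventually_filtercomapI)
    then show ?thesis
      using continuous_on_tendsto_compose[OF continuous_on_product_coordinates[of x]] by simp
  qed
  ultimately show ?thesis by blast
qed

definition state_on :: "'a::chilbert_space op set \<Rightarrow> ('a op \<Rightarrow> complex) \<Rightarrow> bool" where
  "state_on A \<omega> \<longleftrightarrow> (\<forall>a\<in>A. \<forall>b\<in>A. \<omega> (a + b) = \<omega> a + \<omega> b) \<and> (\<forall>c. \<forall>a\<in>A. \<omega> (c *\<^sub>C a) = c * \<omega> a) \<and>
     \<omega> id_blinfun = 1 \<and> (\<forall>a\<in>A. cmod (\<omega> a) \<le> norm a \<and> (positive_op a \<longrightarrow> \<omega> a \<in> \<real>\<^sub>\<ge>\<^sub>0))"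

lemma state_on_sum:
  fixes A :: "'a::chilbert_space op set"
  assumes \<omega>: "state_on A \<omega>" and A: "csubspace A" and I: "finite I" "\<And>i. i \<in> I \<Longrightarrow> f i \<in> A"
  shows "(\<Sum>i\<in>I. f i) \<in> A \<and> \<omega> (\<Sum>i\<in>I. f i) = (\<Sum>i\<in>I. \<omega> (f i))"
  using I
proof (induction rule: finite_induct)
  case empty
  have "\<omega> (0 *\<^sub>C 0) = 0 * \<omega> 0" using \<omega> csubspaceD(1)[OF A] unfolding state_on_def by blast
  then show ?case using csubspaceD(1)[OF A] by (simp add: scaleC_op_simps)
next
  case (insert i I)
  then show ?case using \<omega> csubspaceD(2)[OF A] by (simp add: state_on_def)
qed

lemma blinfun_sum_left: "blinfun_apply (\<Sum>i\<in>I. f i) x = (\<Sum>i\<in>I. blinfun_apply (f i) x)"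
  by (induction I rule: infinite_finite_induct) (auto simp: blinfun.add_left)

lemma state_on_limit:
  assumes F: "F \<noteq> bot" and st: "eventually (\<lambda>i. state_on A (\<omega> i)) F" and A: "cstar_algebra A"
    and lim: "\<And>a. a \<in> A \<Longrightarrow> ((\<lambda>i. \<omega> i a) \<longlongrightarrow> l a) F"
  shows "state_on A l"
  unfolding state_on_def
proof (intro conjI ballI allI impI)
  note AD = cstar_algebraD[OF A]
  fix a b assume ab: "a \<in> A" "b \<in> A"
  show "l (a + b) = l a + l b"
    by (rule tendsto_unique[OF F Lim_transform_eventually[OF lim[OF AD(7)[OF ab]]]
          tendsto_add[OF lim[OF ab(1)] lim[OF ab(2)]]])
      (rule eventually_mono[OF st], use ab in \<open>simp add: state_on_def\<close>)
next
  note AD = cstar_algebraD[OF A]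
  fix c a assume a: "a \<in> A"
  show "l (c *\<^sub>C a) = c * l a"
    by (rule tendsto_unique[OF F Lim_transform_eventually[OF lim[OF AD(9)[OF a]]]
          tendsto_mult[OF tendsto_const lim[OF a]]])
      (rule eventually_mono[OF st], use a in \<open>simp add: state_on_def\<close>)
next
  show "l id_blinfun = 1"
    by (rule tendsto_unique[OF F Lim_transform_eventually[OF lim[OF cstar_algebraD(3)[OF A]]]
        tendsto_const])
      (rule eventually_mono[OF st], simp add: state_on_def)
next
  fix a assume a: "a \<in> A"
  show "cmod (l a) \<le> norm a"
    by (rule tendsto_upperbound[OF tendsto_norm[OF lim[OF a]] _ F])
      (rule eventually_mono[OF st], use a in \<open>simp add: state_on_def\<close>)
  show "l a \<in> \<real>\<^sub>\<ge>\<^sub>0" if "positive_op a"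
    by (rule Lim_in_closed_set[OF closed_nonneg_Reals_complex _ F lim[OF a]])
      (rule eventually_mono[OF st], use a that in \<open>simp add: state_on_def\<close>)
qed

lemma character_on_limit:
  assumes F: "F \<noteq> bot" and ch: "eventually (\<lambda>i. character_on A (\<phi> i)) F" and A: "cstar_algebra A"
    and lim: "\<And>a. a \<in> A \<Longrightarrow> ((\<lambda>i. \<phi> i a) \<longlongrightarrow> l a) F"
  shows "character_on A l"
  unfolding character_on_def
proof (intro conjI ballI allI)
  note AD = cstar_algebraD[OF A]
  fix a b assume ab: "a \<in> A" "b \<in> A"
  show "l (a + b) = l a + l b"
    by (rule tendsto_unique[OF F Lim_transform_eventually[OF lim[OF AD(7)[OF ab]]]
          tendsto_add[OF lim[OF ab(1)] lim[OF ab(2)]]])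
      (rule eventually_mono[OF ch], use ab in \<open>simp add: character_on_def\<close>)
  show "l (a o\<^sub>L b) = l a * l b"
    by (rule tendsto_unique[OF F Lim_transform_eventually[OF lim[OF AD(4)[OF ab]]]
          tendsto_mult[OF lim[OF ab(1)] lim[OF ab(2)]]])
      (rule eventually_mono[OF ch], use ab in \<open>simp add: character_on_def\<close>)
next
  note AD = cstar_algebraD[OF A]
  fix c a assume a: "a \<in> A"
  show "l (c *\<^sub>C a) = c * l a"
    by (rule tendsto_unique[OF F Lim_transform_eventually[OF lim[OF AD(9)[OF a]]]
          tendsto_mult[OF tendsto_const lim[OF a]]])
      (rule eventually_mono[OF ch], use a in \<open>simp add: character_on_def\<close>)
next
  note AD = cstar_algebraD[OF A]
  fix a assume a: "a \<in> A"
  show "l (adj a) = cnj (l a)"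
    by (rule tendsto_unique[OF F Lim_transform_eventually[OF lim[OF AD(5)[OF a]]]
          tendsto_cnj[OF lim[OF a]]])
      (rule eventually_mono[OF ch], use a in \<open>simp add: character_on_def\<close>)
  show "cmod (l a) \<le> norm a"
    by (rule tendsto_upperbound[OF tendsto_norm[OF lim[OF a]] _ F])
      (rule eventually_mono[OF ch], use a in \<open>simp add: character_on_def\<close>)
qed

text \<open>The boundary property will be applied to the identity representation and to characters,
  which act on lines in \<open>H\<close>.\<close>

locale boundary_system =
  fixes S :: "'h::chilbert_space op set"
  assumes S_bop: "S \<subseteq> bop UNIV"
    and compact_sub: "compact_ops \<subseteq> cstar S"
    and comm_quot: "commutative_quotient (cstar S) compact_ops"
    and boundary: "\<And>E \<sigma>. closed_csubspace E \<Longrightarrow> irreducible_rep (cstar S) (E :: 'h set) \<sigma>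
        \<Longrightarrow> boundary_rep S E \<sigma>"
begin

lemma A: "cstar_algebra (cstar S)" and SA: "S \<subseteq> cstar S"
  using cstar[OF S_bop] by auto

lemmas AD = cstar_algebraD[OF A]

text \<open>A character acts on a line in \<open>H\<close> as an irreducible representation, and a state as a unital
  completely positive map.\<close>

lemma state_eq_character:
  assumes \<omega>: "state_on (cstar S) \<omega>" and \<phi>: "character_on (cstar S) \<phi>" "\<phi> id_blinfun = 1"
    and eq: "\<And>s. s \<in> S \<Longrightarrow> \<omega> s = \<phi> s" and a: "a \<in> cstar S"
  shows "\<omega> a = \<phi> a"
proof -
  have "\<phi> (0 *\<^sub>C 0) = 0 * \<phi> 0" using \<phi>(1) AD(11) unfolding character_on_def by blast
  then have "(id_blinfun :: 'h op) \<noteq> 0" using \<phi>(2) by (auto simp: scaleC_op_simps)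
  then obtain v :: 'h where "v \<noteq> 0"
    by (metis blinfun_eqI blinfun_apply_id_blinfun zero_blinfun.rep_eq)
  define u where "u = v /\<^sub>R norm v"
  have u: "cinner u u = 1" "u \<noteq> 0" using \<open>v \<noteq> 0\<close> by (simp_all add: u_def cinner_self)
  define E where "E = {x. x = cinner u x *\<^sub>C u}"
  have E: "closed_csubspace E"
    unfolding closed_csubspace_def csubspace_def E_def
  proof (intro conjI)
    show "closed {x. x = cinner u x *\<^sub>C u}"
      by (intro closed_Collect_eq continuous_intros linear_continuous_on
          bounded_linear_compose[OF scaleC.bounded_linear_left cinner.bounded_linear_right])
  qed (auto simp: cinner_add_right scaleC_add_left cinner_scaleC_right simp flip: scaleC_scaleC)
  have uE: "u \<in> E" by (simp add: E_def u)
  have P: "unit_op E x = cinner u x *\<^sub>C u" for x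
    using bop_range[OF unit_op(1)[OF E], of x] unit_op(3)[OF E uE, of x] by (auto simp: E_def)
  let ?P = "unit_op E"
  have PP: "?P o\<^sub>L ?P = ?P"
    by (rule blinfun_eqI) (simp add: unit_op(2)[OF E bop_range[OF unit_op(1)[OF E]]])
  have Padj: "adj ?P = ?P" by (rule adj_eqI) (rule unit_op_selfadjoint[OF E])
  note Pb = unit_op(1)[OF E]
  note PU = bop_subset_UNIV[OF Pb]
  have subE: "csubspace (bop E)" using E by (simp add: closed_csubspace_def csubspace_bop)
  define \<sigma> where "\<sigma> a = \<phi> a *\<^sub>C ?P" for a
  define \<psi> where "\<psi> a = \<omega> a *\<^sub>C ?P" for a
  have "unital_star_rep (cstar S) E \<sigma>"
    unfolding unital_star_rep_def clinear_on_def
  proof (intro conjI ballI allI)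
    show "\<sigma> ` cstar S \<subseteq> bop E" using csubspaceD(3)[OF subE Pb] by (auto simp: \<sigma>_def)
    show "\<sigma> id_blinfun = ?P" by (simp add: \<sigma>_def \<phi> scaleC_op_simps)
    fix b d assume bd: "b \<in> cstar S" "d \<in> cstar S"
    show "\<sigma> (b + d) = \<sigma> b + \<sigma> d" using \<phi>(1) bd by (simp add: \<sigma>_def character_on_def scaleC_op_simps)
    show "\<sigma> (b o\<^sub>L d) = \<sigma> b o\<^sub>L \<sigma> d"
      using \<phi>(1) bd by (simp add: \<sigma>_def character_on_def compose_scaleC(1)
          compose_scaleC(2)[OF Pb] PP scaleC_op_simps)
  next
    fix c b assume b: "b \<in> cstar S"
    show "\<sigma> (c *\<^sub>C b) = c *\<^sub>C \<sigma> b" using \<phi>(1) b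
      by (simp add: \<sigma>_def character_on_def scaleC_op_simps)
  next
    fix b assume b: "b \<in> cstar S"
    show "\<sigma> (adj b) = adj (\<sigma> b)" using \<phi>(1) b
      by (simp add: \<sigma>_def character_on_def adj_scaleC[OF PU] Padj)
  qed
  moreover have "E \<noteq> {0}" using uE u by auto
  moreover have "M = {0} \<or> M = E" if M: "closed_csubspace M" "M \<subseteq> E" for M
  proof (cases "M = {0}")
    case False
    have subM: "csubspace M" using M by (simp add: closed_csubspace_def)
    then obtain m where m: "m \<in> M" "m \<noteq> 0" using False csubspaceD(1)[OF subM] by auto
    then have mu: "m = cinner u m *\<^sub>C u" using M(2) by (auto simp: E_def)
    have "cinner u m \<noteq> 0" using m(2) mu by auto
    then have "u = inverse (cinner u m) *\<^sub>C m" by (subst mu) (simp add: scaleC_scaleC)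
    then have "u \<in> M" using csubspaceD(3)[OF subM m(1)] by metis
    then have "x \<in> M" if "x \<in> E" for x
      using that csubspaceD(3)[OF subM, of u "cinner u x"] by (auto simp: E_def)
    then show ?thesis using M(2) by blast
  qed simp
  ultimately have "irreducible_rep (cstar S) E \<sigma>" by (auto simp: irreducible_rep_def)
  then have "unique_extension_property S E \<sigma>" using boundary[OF E] by (simp add: boundary_rep_def)
  moreover have "ucp (cstar S) E (bop E) \<psi>"
    unfolding ucp_def clinear_on_def
  proof (intro conjI ballI allI impI)
    show "\<psi> ` cstar S \<subseteq> bop E" using csubspaceD(3)[OF subE Pb] by (auto simp: \<psi>_def)
    show "\<psi> id_blinfun = ?P" using \<omega> by (simp add: \<psi>_def state_on_def scaleC_op_simps)
    show "\<psi> (b + d) = \<psi> b + \<psi> d" if "b \<in> cstar S" "d \<in> cstar S" for b d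
      using \<omega> that by (simp add: \<psi>_def state_on_def scaleC_op_simps)
    show "\<psi> (c *\<^sub>C b) = c *\<^sub>C \<psi> b" if "b \<in> cstar S" for c b
      using \<omega> that by (simp add: \<psi>_def state_on_def scaleC_op_simps)
    fix n m assume m: "(\<forall>i<n. \<forall>j<n. m i j \<in> cstar S) \<and> positive_matrix n m"
    show "positive_matrix n (\<lambda>i j. \<psi> (m i j))"
      unfolding positive_matrix_def
    proof
      fix x :: "nat \<Rightarrow> 'h"
      define \<alpha> where "\<alpha> i = cinner u (x i)" for i
      define b where "b = (\<Sum>i<n. \<Sum>j<n. (cnj (\<alpha> i) * \<alpha> j) *\<^sub>C m i j)"
      have in1: "(cnj (\<alpha> i) * \<alpha> j) *\<^sub>C m i j \<in> cstar S" if "i < n" "j < n" for i j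
        using m that AD(9) by blast
      have in2: "(\<Sum>j<n. (cnj (\<alpha> i) * \<alpha> j) *\<^sub>C m i j) \<in> cstar S \<and>
          \<omega> (\<Sum>j<n. (cnj (\<alpha> i) * \<alpha> j) *\<^sub>C m i j) =
              (\<Sum>j<n. (cnj (\<alpha> i) * \<alpha> j) * \<omega> (m i j))" if "i < n" for i
        using state_on_sum[OF \<omega> AD(2), of "{..<n}" "\<lambda>j. (cnj (\<alpha> i) * \<alpha> j) *\<^sub>C m i j"] in1 that m \<omega>
        by (simp add: state_on_def)
      have "b \<in> cstar S \<and> \<omega> b = (\<Sum>i<n. \<Sum>j<n. (cnj (\<alpha> i) * \<alpha> j) * \<omega> (m i j))"
        using state_on_sum[OF \<omega> AD(2), of "{..<n}" "\<lambda>i. \<Sum>j<n. (cnj (\<alpha> i) * \<alpha> j) *\<^sub>C m i j"] in2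
        by (simp add: b_def)
      then have b: "b \<in> cstar S" "\<omega> b = (\<Sum>i<n. \<Sum>j<n. (cnj (\<alpha> i) * \<alpha> j) * \<omega> (m i j))" by auto
      have "positive_op b"
        unfolding positive_op_def
      proof
        fix y
        have "cinner y (b y) = (\<Sum>i<n. \<Sum>j<n. cinner (\<alpha> i *\<^sub>C y) (m i j (\<alpha> j *\<^sub>C y)))"
          unfolding b_def blinfun_sum_left cinner.sum_right
          by (intro sum.cong refl)
            (use m bop_scaleC[OF AD(1)] in \<open>simp add: cinner_scaleC_left cinner_scaleC_right\<close>)
        then show "cinner y (b y) \<in> \<real>\<^sub>\<ge>\<^sub>0" using m by (simp add: positive_matrix_def)
      qed
      then have "\<omega> b \<in> \<real>\<^sub>\<ge>\<^sub>0" using \<omega> b(1) by (simp add: state_on_def)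
      moreover have "(\<Sum>i<n. \<Sum>j<n. cinner (x i) (\<psi> (m i j) (x j))) = \<omega> b"
        unfolding b(2)
        by (intro sum.cong refl)
          (simp add: \<psi>_def P cinner_scaleC_right \<alpha>_def cinner_commute[of _ u])
      ultimately show "(\<Sum>i<n. \<Sum>j<n. cinner (x i) (\<psi> (m i j) (x j))) \<in> \<real>\<^sub>\<ge>\<^sub>0" by simp
    qed
  qed
  moreover have "\<forall>s\<in>S. \<psi> s = \<sigma> s" using eq by (simp add: \<psi>_def \<sigma>_def)
  ultimately have "\<psi> a = \<sigma> a"
    using a unfolding unique_extension_property_def by blast
  then have "(\<omega> a *\<^sub>C ?P) u = (\<phi> a *\<^sub>C ?P) u" by (simp add: \<psi>_def \<sigma>_def)
  then have "\<omega> a *\<^sub>C u = \<phi> a *\<^sub>C u" by (simp add: unit_op(2)[OF E uE])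
  then have "cinner u (\<omega> a *\<^sub>C u) = cinner u (\<phi> a *\<^sub>C u)" by simp
  then show ?thesis by (simp add: cinner_scaleC_right u)
qed

text \<open>Compactness makes the previous lemma uniform in the state and the character.\<close>

lemma state_near_character:
  assumes a: "a \<in> cstar S" and e: "0 < e"
  shows "\<exists>F \<eta>. finite F \<and> F \<subseteq> S \<and> 0 < \<eta> \<and>
    (\<forall>\<omega> \<phi>. state_on (cstar S) \<omega> \<and> character_on (cstar S) \<phi> \<and> \<phi> id_blinfun = 1 \<and>
       (\<forall>s\<in>F. cmod (\<omega> s - \<phi> s) < \<eta>) \<longrightarrow> cmod (\<omega> a - \<phi> a) < e)"
proof (rule ccontr)
  assume neg: "\<not> ?thesis"
  define I where "I = {(F, \<eta>). finite F \<and> F \<subseteq> S \<and> (0::real) < \<eta>}"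
  define X where "X = (\<lambda>(F, \<eta>). {(\<omega>, \<phi>). state_on (cstar S) \<omega> \<and> character_on (cstar S) \<phi> \<and>
    \<phi> id_blinfun = 1 \<and> (\<forall>s\<in>F. cmod (\<omega> s - \<phi> s) < \<eta>) \<and> e \<le> cmod (\<omega> a - \<phi> a)})"
  have Xne: "X p \<noteq> {}" if pI: "p \<in> I" for p
  proof -
    obtain F \<eta> where p: "p = (F, \<eta>)" "finite F" "F \<subseteq> S" "0 < \<eta>" using pI by (auto simp: I_def)
    then have "\<not> (\<forall>\<omega> \<phi>. state_on (cstar S) \<omega> \<and> character_on (cstar S) \<phi> \<and> \<phi> id_blinfun = 1 \<and>
       (\<forall>s\<in>F. cmod (\<omega> s - \<phi> s) < \<eta>) \<longrightarrow> cmod (\<omega> a - \<phi> a) < e)"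
      using neg by metis
    then obtain \<omega> \<phi> where "state_on (cstar S) \<omega>" "character_on (cstar S) \<phi>" "\<phi> id_blinfun = 1"
      "\<forall>s\<in>F. cmod (\<omega> s - \<phi> s) < \<eta>" "e \<le> cmod (\<omega> a - \<phi> a)"
      by (auto simp: not_less)
    then have "(\<omega>, \<phi>) \<in> X p" by (simp add: X_def p)
    then show ?thesis by blast
  qed
  define \<Phi> where "\<Phi> = (INF p\<in>I. principal (X p))"
  have nb: "\<Phi> \<noteq> bot"
    unfolding \<Phi>_def
  proof (subst INF_filter_bot_base)
    show "\<exists>k\<in>I. principal (X k) \<le> inf (principal (X i)) (principal (X j))" if "i \<in> I" "j \<in> I"
        for i j
    proof -
      obtain F \<eta> F' \<eta>' where ij: "i = (F, \<eta>)" "j = (F', \<eta>')" by (cases i, cases j) auto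
      show ?thesis
        by (rule bexI[of _ "(F \<union> F', min \<eta> \<eta>')"]) (use that ij in \<open>auto simp: X_def I_def\<close>)
    qed
    show "\<not> (\<exists>i\<in>I. principal (X i) = bot)" using Xne by (auto simp: principal_eq_bot_iff)
  qed
  have ev: "eventually (\<lambda>q. q \<in> X p) \<Phi>" if "p \<in> I" for p
  proof -
    have "\<Phi> \<le> principal (X p)" unfolding \<Phi>_def by (rule INF_lower[OF that])
    then show ?thesis by (simp add: le_principal)
  qed
  have base: "eventually (\<lambda>q. q \<in> X ({}, 1)) \<Phi>" by (rule ev) (simp add: I_def)
  define g where "g q p = (if fst p
      \<in> cstar S then (if snd p then fst q (fst p) else snd q (fst p)) else 0)"
    for q :: "('h op \<Rightarrow> complex) \<times> ('h op \<Rightarrow> complex)" and p :: "'h op \<times> bool"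
  have "eventually (\<lambda>q. \<forall>p. cmod (g q p) \<le> norm (fst p)) \<Phi>"
    by (rule eventually_mono[OF base]) (auto simp: X_def g_def state_on_def character_on_def)
  from convergent_refinement[OF nb this]
  obtain \<Phi>' l where \<Phi>': "\<Phi>' \<noteq> bot" "\<Phi>' \<le> \<Phi>" and l: "\<And>p. ((\<lambda>q. g q p) \<longlongrightarrow> l p) \<Phi>'"
    by blast
  have l1: "((\<lambda>q. fst q b) \<longlongrightarrow> l (b, True)) \<Phi>'" and l2: "((\<lambda>q. snd q b) \<longlongrightarrow> l (b, False)) \<Phi>'"
    if "b \<in> cstar S" for b
    using l[of "(b, True)"] l[of "(b, False)"] that by (simp_all add: g_def)
  have ev': "eventually (\<lambda>q. q \<in> X p) \<Phi>'" if "p \<in> I" for p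
    using ev[OF that] \<Phi>'(2) by (rule filter_leD[rotated])
  have base': "eventually (\<lambda>q. q \<in> X ({}, 1)) \<Phi>'" by (rule ev') (simp add: I_def)
  have st: "state_on (cstar S) (\<lambda>b. l (b, True))"
    by (rule state_on_limit[OF \<Phi>'(1) _ A l1]) (rule eventually_mono[OF base'], auto simp: X_def)
  have ch: "character_on (cstar S) (\<lambda>b. l (b, False))"
    by (rule character_on_limit[OF \<Phi>'(1) _ A l2]) (rule eventually_mono[OF base'], auto simp: X_def)
  have id: "l (id_blinfun, False) = 1"
    by (rule tendsto_unique[OF \<Phi>'(1) Lim_transform_eventually[OF l2[OF AD(3)]] tendsto_const])
      (rule eventually_mono[OF base'], auto simp: X_def)
  have "l (s, True) = l (s, False)" if s: "s \<in> S" for s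
  proof -
    have "((\<lambda>q. fst q s - snd q s) \<longlongrightarrow> 0) \<Phi>'"
    proof (rule tendstoI)
      fix d :: real assume "d > 0"
      then show "eventually (\<lambda>q. dist (fst q s - snd q s) 0 < d) \<Phi>'"
        by (intro eventually_mono[OF ev'[of "({s}, d)"]]) (use s in \<open>auto simp: I_def X_def\<close>)
    qed
    moreover have "((\<lambda>q. fst q s - snd q s) \<longlongrightarrow> l (s, True) - l (s, False)) \<Phi>'"
      using s SA by (intro tendsto_diff l1 l2) auto
    ultimately show ?thesis using tendsto_unique[OF \<Phi>'(1)] by fastforce
  qed
  then have eq: "l (a, True) = l (a, False)"
    using state_eq_character[OF st ch id _ a] by simp
  have "e \<le> cmod (l (a, True) - l (a, False))"
    by (rule tendsto_lowerbound[OF tendsto_norm[OF tendsto_diff[OF l1[OF a] l2[OF a]]] _ \<Phi>'(1)])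
      (rule eventually_mono[OF base'], auto simp: X_def)
  then show False using eq e by simp
qed

lemma rank1_cstar: "rank1 u v \<in> cstar S"
  using rank1_compact compact_sub by blast

text \<open>The identity representation is irreducible because \<open>A\<close> contains the operators of rank one.\<close>

lemma identity_unique_extension: "unique_extension_property S UNIV (\<lambda>a. a)" if nz: "UNIV \<noteq> {0::'h}"
proof -
  have "irreducible_rep (cstar S) UNIV (\<lambda>a. a)"
    unfolding irreducible_rep_def unital_star_rep_def
  proof (intro conjI allI impI)
    show "(\<lambda>a. a) ` cstar S \<subseteq> bop UNIV" using AD(1) by auto
    show "clinear_on (cstar S) (\<lambda>a. a)" by (simp add: clinear_on_def)
    show "id_blinfun = unit_op UNIV" by (simp add: unit_op_UNIV)
    show "UNIV \<noteq> {0::'h}" by (rule nz)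
    fix M :: "'h set" assume M: "closed_csubspace M \<and> M \<subseteq> UNIV \<and> (\<forall>a\<in>cstar S. a ` M \<subseteq> M)"
    then have sub: "csubspace M" by (simp add: closed_csubspace_def)
    show "M = {0} \<or> M = UNIV"
    proof (cases "M = {0}")
      case False
      then obtain m where m: "m \<in> M" "m \<noteq> 0" using csubspaceD(1)[OF sub] by auto
      have "x \<in> M" for x
      proof -
        have "rank1 x m m \<in> M" using M m(1) rank1_cstar by blast
        then have "cinner m m *\<^sub>C x \<in> M" by simp
        then have "inverse (cinner m m) *\<^sub>C cinner m m *\<^sub>C x \<in> M" by (rule csubspaceD(3)[OF sub])
        then show ?thesis using m(2) by (simp add: scaleC_scaleC)
      qed
      then show ?thesis by blast
    qed simp
  qed auto
  then show ?thesis using boundary[OF closed_csubspace_UNIV] by (simp add: boundary_rep_def)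
qed

text \<open>A cluster point of the compressions \<open>V\<^sup>* \<psi>\<^sub>i V\<close>, given by its sesquilinear forms, is a
  unital completely positive map which extends the identity of \<open>S\<close>.\<close>

lemma compression_converges:
  fixes \<psi> :: "'i \<Rightarrow> 'h op \<Rightarrow> 'l::chilbert_space op"
  assumes L: "closed_csubspace L" and C: "C \<subseteq> bop L"
    and u: "eventually (\<lambda>i. ucp (cstar S) L C (\<psi> i)) F"
    and Vadd: "\<And>x y. V (x + y) = V x + V y" and Vscale: "\<And>c x. V (c *\<^sub>C x) = c *\<^sub>C V x"
    and Viso: "\<And>x y. cinner (V x) (V y) = cinner x y" and VL: "\<And>x. V x \<in> L"
    and lim: "\<And>s x y. s \<in> S \<Longrightarrow> ((\<lambda>i. cinner (V x) (\<psi> i s (V y))) \<longlongrightarrow> cinner x (s y)) F"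
    and a: "a \<in> cstar S"
  shows "((\<lambda>i. cinner (V x) (\<psi> i a (V y))) \<longlongrightarrow> cinner x (a y)) F"
proof (rule ccontr)
  assume "\<not> ((\<lambda>i. cinner (V x) (\<psi> i a (V y))) \<longlongrightarrow> cinner x (a y)) F"
  then obtain e where e: "e > 0" "\<not> eventually
      (\<lambda>i. dist (cinner (V x) (\<psi> i a (V y))) (cinner x (a y)) < e) F"
    by (auto simp: tendsto_iff)
  define F1 where "F1 = inf F (principal
      {i. e \<le> dist (cinner (V x) (\<psi> i a (V y))) (cinner x (a y))})"
  have "F1 \<noteq> bot"
    unfolding F1_def by (rule inf_principal_neq_bot) (use e(2) in \<open>simp add: frequently_def not_le\<close>)
  have nz: "UNIV \<noteq> {0::'h}"
  proof
    assume "UNIV = {0::'h}"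
    then have "x = 0" "a y = 0" by auto
    moreover have "V 0 = 0" using Vadd[of 0 0] by simp
    ultimately show False using e by simp
  qed
  have u1: "eventually (\<lambda>i. ucp (cstar S) L C (\<psi> i)) F1"
    using u by (rule filter_leD[rotated]) (simp add: F1_def)
  define g where "g i p = (case p of (b, v, w) \<Rightarrow> if b
      \<in> cstar S then cinner (V v) (\<psi> i b (V w)) else 0)"
    for i and p :: "'h op \<times> 'h \<times> 'h"
  have form_bound: "cmod (cinner (V v) (\<psi> i b (V w))) \<le> norm b * norm v * norm w"
    if ui: "ucp (cstar S) L C (\<psi> i)" and b: "b \<in> cstar S" for i b v w
  proof -
    have nV: "norm (V z) = norm z" for z by (rule norm_preserves_inner[OF Viso])
    have "cmod (cinner (V v) (\<psi> i b (V w))) \<le> norm (V v) * norm (\<psi> i b (V w))"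
      by (rule cauchy_schwarz)
    also have "\<dots> \<le> norm v * (norm b * norm w)"
      unfolding nV
      by (intro mult_left_mono order_trans[OF norm_blinfun])
        (auto simp: nV intro!: mult_right_mono ucp_adj_norm(2)[OF A L ui C b])
    finally show ?thesis by (simp add: ac_simps)
  qed
  have "eventually (\<lambda>i. \<forall>p. cmod (g i p) \<le> norm (fst p) * norm (fst (snd p)) * norm (snd (snd p)))
      F1"
  proof (rule eventually_mono[OF u1], rule allI)
    fix i and p :: "'h op \<times> 'h \<times> 'h" assume ui: "ucp (cstar S) L C (\<psi> i)"
    obtain b v w where p: "p = (b, v, w)" by (cases p)
    show "cmod (g i p) \<le> norm (fst p) * norm (fst (snd p)) * norm (snd (snd p))"
      using form_bound[OF ui] by (simp add: p g_def)
  qed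
  from convergent_refinement[OF \<open>F1 \<noteq> bot\<close> this]
  obtain F' l where F': "F' \<noteq> bot" "F' \<le> F1" and l: "\<And>p. ((\<lambda>i. g i p) \<longlongrightarrow> l p) F'"
    by blast
  define \<theta> where "\<theta> b v w = l (b, v, w)" for b v w
  have \<theta>: "((\<lambda>i. cinner (V v) (\<psi> i b (V w))) \<longlongrightarrow> \<theta> b v w) F'" if "b \<in> cstar S" for b v w
    using l[of "(b, v, w)"] that by (simp add: g_def \<theta>_def)
  have u': "eventually (\<lambda>i. ucp (cstar S) L C (\<psi> i)) F'" using u1 F'(2)
    by (rule filter_leD[rotated])
  have uniq: "\<theta> b v w = r" if "b \<in> cstar S" "((\<lambda>i. cinner (V v) (\<psi> i b (V w))) \<longlongrightarrow> r) F'" for b v w r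
    using tendsto_unique[OF F'(1) \<theta>[OF that(1)] that(2)] .
  have bopC: "\<psi> i b \<in> bop UNIV" if "ucp (cstar S) L C (\<psi> i)" "b \<in> cstar S" for i b
    by (rule bop_subset_UNIV[of _ L]) (use that C in \<open>auto simp: ucp_def\<close>)
  have "\<exists>T\<in>bop UNIV. \<forall>v w. cinner v (T w) = \<theta> b v w" if b: "b \<in> cstar S" for b
  proof (rule operator_of_form[where K = "norm b"])
    show "\<theta> b (v + v') w = \<theta> b v w + \<theta> b v' w" for v v' w
      by (rule uniq[OF b]) (use tendsto_add[OF \<theta>[OF b] \<theta>[OF b]] in \<open>simp add: Vadd cinner_add_left\<close>)
    show "\<theta> b v (w + w') = \<theta> b v w + \<theta> b v w'" for v w w'
      by (rule uniq[OF b]) (use tendsto_add[OF \<theta>[OF b] \<theta>[OF b]]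
          in \<open>simp add: Vadd cinner_add_right blinfun.add_right\<close>)
    show "\<theta> b (c *\<^sub>C v) w = cnj c * \<theta> b v w" for c v w
      by (rule uniq[OF b]) (use tendsto_mult[OF tendsto_const \<theta>[OF b]]
          in \<open>simp add: Vscale cinner_scaleC_left\<close>)
    show "\<theta> b v (c *\<^sub>C w) = c * \<theta> b v w" for c v w
    proof (rule uniq[OF b], rule Lim_transform_eventually[OF
        tendsto_mult[OF tendsto_const \<theta>[OF b]]])
      show "eventually (\<lambda>i. c * cinner (V v) (\<psi> i b (V w)) = cinner (V v) (\<psi> i b (V (c *\<^sub>C w)))) F'"
        by (rule eventually_mono[OF u'])
            (simp add: Vscale bop_scaleC[OF bopC[OF _ b]] cinner_scaleC_right)
    qed
    show "cmod (\<theta> b v w) \<le> norm b * norm v * norm w" for v w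
      by (rule tendsto_upperbound[OF tendsto_norm[OF \<theta>[OF b]] _ F'(1)], rule eventually_mono[OF u'])
        (rule form_bound[OF _ b])
  qed
  then obtain \<Theta> where \<Theta>: "\<And>b. b \<in> cstar S \<Longrightarrow> \<Theta> b \<in> bop UNIV"
    "\<And>b v w. b \<in> cstar S \<Longrightarrow> cinner v (\<Theta> b w) = \<theta> b v w" by metis
  have "ucp (cstar S) UNIV (bop UNIV) \<Theta>"
    unfolding ucp_def clinear_on_def
  proof (intro conjI ballI allI impI)
    show "\<Theta> ` cstar S \<subseteq> bop UNIV" using \<Theta>(1) by auto
    show "\<Theta> (b + d) = \<Theta> b + \<Theta> d" if bd: "b \<in> cstar S" "d \<in> cstar S" for b d
    proof (rule blinfun_eqI, rule cinner_ext)
      fix v w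
      have "\<theta> (b + d) v w = \<theta> b v w + \<theta> d v w"
      proof (rule uniq[OF AD(7)[OF bd]], rule
          Lim_transform_eventually[OF tendsto_add[OF \<theta>[OF bd(1)] \<theta>[OF bd(2)]]])
        show "eventually (\<lambda>i. cinner (V v) (\<psi> i b (V w)) + cinner (V v) (\<psi> i d (V w))
            = cinner (V v) (\<psi> i (b + d) (V w))) F'"
          by (rule eventually_mono[OF u'])
            (use bd in \<open>simp add: ucp_def clinear_on_def blinfun.add_left cinner_add_right\<close>)
      qed
      then show "cinner v (\<Theta> (b + d) w) = cinner v ((\<Theta> b + \<Theta> d) w)"
        by (simp add: \<Theta> bd AD(7) blinfun.add_left cinner_add_right)
    qed
    show "\<Theta> (c *\<^sub>C b) = c *\<^sub>C \<Theta> b" if b: "b \<in> cstar S" for c b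
    proof (rule blinfun_eqI, rule cinner_ext)
      fix v w
      have "\<theta> (c *\<^sub>C b) v w = c * \<theta> b v w"
      proof (rule uniq[OF AD(9)[OF b]], rule
          Lim_transform_eventually[OF tendsto_mult[OF tendsto_const \<theta>[OF b]]])
        show "eventually (\<lambda>i. c * cinner (V v) (\<psi> i b (V w)) = cinner (V v) (\<psi> i (c *\<^sub>C b) (V w)))
            F'"
          by (rule eventually_mono[OF u'])
            (use b in \<open>simp add: ucp_def clinear_on_def cinner_scaleC_right\<close>)
      qed
      then show "cinner v (\<Theta> (c *\<^sub>C b) w) = cinner v ((c *\<^sub>C \<Theta> b) w)"
        by (simp add: \<Theta> b AD(9) cinner_scaleC_right)
    qed
    show "\<Theta> id_blinfun = unit_op UNIV"
      unfolding unit_op_UNIV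
    proof (rule blinfun_eqI, rule cinner_ext)
      fix v w
      have "\<theta> id_blinfun v w = cinner v w"
      proof (rule uniq[OF AD(3)], rule Lim_transform_eventually[OF tendsto_const])
        show "eventually (\<lambda>i. cinner v w = cinner (V v) (\<psi> i id_blinfun (V w))) F'"
          by (rule eventually_mono[OF u']) (simp add: ucp_def unit_op(2)[OF L VL] Viso)
      qed
      then show "cinner v (\<Theta> id_blinfun w) = cinner v (id_blinfun w)" by (simp add: \<Theta> AD(3))
    qed
    fix n m assume m: "(\<forall>i<n. \<forall>j<n. m i j \<in> cstar S) \<and> positive_matrix n m"
    show "positive_matrix n (\<lambda>i j. \<Theta> (m i j))"
      unfolding positive_matrix_def
    proof
      fix z :: "nat \<Rightarrow> 'h"
      have "((\<lambda>i. \<Sum>j<n. \<Sum>k<n. cinner (V (z j)) (\<psi> i (m j k) (V (z k)))) \<longlongrightarrow>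
          (\<Sum>j<n. \<Sum>k<n. cinner (z j) (\<Theta> (m j k) (z k)))) F'"
        by (intro tendsto_sum) (use m \<theta> \<Theta>(2) in auto)
      moreover have "eventually (\<lambda>i. (\<Sum>j<n. \<Sum>k<n. cinner (V (z j)) (\<psi> i (m j k) (V (z k))))
          \<in> \<real>\<^sub>\<ge>\<^sub>0) F'"
      proof (rule eventually_mono[OF u'])
        fix i assume "ucp (cstar S) L C (\<psi> i)"
        then have "positive_matrix n (\<lambda>j k. \<psi> i (m j k))" using m by (simp add: ucp_def)
        then show "(\<Sum>j<n. \<Sum>k<n. cinner (V (z j)) (\<psi> i (m j k) (V (z k)))) \<in> \<real>\<^sub>\<ge>\<^sub>0"
          unfolding positive_matrix_def by (rule spec)
      qed
      ultimately show "(\<Sum>j<n. \<Sum>k<n. cinner (z j) (\<Theta> (m j k) (z k))) \<in> \<real>\<^sub>\<ge>\<^sub>0"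
        by (intro Lim_in_closed_set[OF closed_nonneg_Reals_complex _ F'(1)])
    qed
  qed
  moreover have "\<Theta> s = s" if s: "s \<in> S" for s
  proof (rule blinfun_eqI, rule cinner_ext)
    fix v w
    have "F' \<le> F" using F'(2) by (simp add: F1_def)
    have sA: "s \<in> cstar S" using s SA by blast
    have "\<theta> s v w = cinner v (s w)"
      by (rule uniq[OF sA tendsto_mono[OF \<open>F' \<le> F\<close> lim[OF s]]])
    then show "cinner v (\<Theta> s w) = cinner v (s w)" by (simp add: \<Theta> sA)
  qed
  ultimately have "\<Theta> a = a"
    using identity_unique_extension[OF nz] a unfolding unique_extension_property_def by blast
  then have "((\<lambda>i. cinner (V x) (\<psi> i a (V y))) \<longlongrightarrow> cinner x (a y)) F'"
    using \<theta>[OF a, of x y] \<Theta>(2)[OF a, of x y] by simp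
  then have "eventually (\<lambda>i. dist (cinner (V x) (\<psi> i a (V y))) (cinner x (a y)) < e) F'"
    using e(1) by (rule tendstoD)
  moreover have "eventually (\<lambda>i. e \<le> dist (cinner (V x) (\<psi> i a (V y))) (cinner x (a y))) F1"
    by (simp add: F1_def eventually_inf_principal)
  then have "eventually (\<lambda>i. e \<le> dist (cinner (V x) (\<psi> i a (V y))) (cinner x (a y))) F'"
    using F'(2) by (rule filter_leD[rotated])
  ultimately have "eventually (\<lambda>i. False) F'" by eventually_elim simp
  then show False using F'(1) by (simp add: trivial_limit_def)
qed

text \<open>\<open>u \<mapsto> \<rho>(|u><y|) \<zeta>\<close> multiplies inner products by \<open><\<zeta>, \<rho>(|y><y|) \<zeta>>\<close>.\<close>

lemma exists_intertwiner:
  assumes L: "closed_csubspace L" and \<rho>: "unital_star_rep (cstar S) L \<rho>"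
    and nz: "\<rho> (rank1 x y) \<zeta> \<noteq> 0"
  shows "\<exists>V. (\<forall>u v. V (u + v) = V u + V v) \<and> (\<forall>c u. V (c *\<^sub>C u) = c *\<^sub>C V u) \<and>
    (\<forall>u v. cinner (V u) (V v) = cinner u v) \<and> (\<forall>u. V u \<in> L) \<and>
    (\<forall>a\<in>cstar S. \<forall>u. V (blinfun_apply a u) = \<rho> a (V u)) \<and> \<rho> (rank1 x y) \<zeta> \<in> range V"
proof -
  note RD = unital_star_repD[OF \<rho> A]
  have sub: "csubspace L" using L by (simp add: closed_csubspace_def)
  define w where "w = cinner \<zeta> (\<rho> (rank1 y y) \<zeta>)"
  define W where "W u = \<rho> (rank1 u y) \<zeta>" for u
  have \<rho>U: "\<rho> a \<in> bop UNIV" if "a \<in> cstar S" for a using RD(1)[OF that] by (rule bop_subset_UNIV)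
  have WW: "cinner (W u) (W v) = cinner u v * w" for u v
  proof -
    have "cinner (W u) (W v) = cinner \<zeta> (adj (\<rho> (rank1 u y)) (\<rho> (rank1 v y) \<zeta>))"
      by (simp add: W_def cinner_adj[OF \<rho>U[OF rank1_cstar]])
    also have "adj (\<rho> (rank1 u y)) (\<rho> (rank1 v y) \<zeta>) = \<rho> (rank1 y u o\<^sub>L rank1 v y) \<zeta>"
      by (simp add: RD(3)[OF rank1_cstar rank1_cstar] RD(4)[OF rank1_cstar, symmetric] adj_rank1)
    also have "rank1 y u o\<^sub>L rank1 v y = cinner u v *\<^sub>C rank1 y y"
      by (simp add: compose_rank1[OF rank1_bop] rank1_scaleC_left)
    finally show ?thesis by (simp add: RD(6)[OF rank1_cstar] cinner_scaleC_right w_def)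
  qed
  have "of_real ((norm (W x))\<^sup>2) = of_real ((norm x)\<^sup>2) * w" using WW[of x x]
    by (simp only: cinner_self)
  moreover have "norm (W x) > 0" using nz by (simp add: W_def)
  ultimately have x0: "norm x > 0" and w: "w = of_real ((norm (W x))\<^sup>2 / (norm x)\<^sup>2)"
    by (auto simp: field_simps)
  define r where "r = norm (W x) / norm x"
  have r: "r > 0" "w = of_real (r\<^sup>2)" using x0 \<open>norm (W x) > 0\<close> w
    by (simp_all add: r_def power_divide)
  have W1: "W (u + v) = W u + W v" for u v
    by (simp add: W_def rank1_add_left RD(5)[OF rank1_cstar rank1_cstar] blinfun.add_left)
  have W2: "W (c *\<^sub>C u) = c *\<^sub>C W u" for c u
    by (simp add: W_def rank1_scaleC_left RD(6)[OF rank1_cstar])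
  have W3: "W u \<in> L" for u using bop_range[OF RD(1)[OF rank1_cstar]] by (simp add: W_def)
  have W4: "W (a u) = \<rho> a (W u)" if "a \<in> cstar S" for a u
    by (simp add: W_def compose_rank1[OF AD(1)[OF that], symmetric] RD(3)[OF that rank1_cstar])
  define V where "V u = inverse r *\<^sub>R W u" for u
  have "cinner (V u) (V v) = cinner u v" for u v
    using r(1)
    by (simp add: V_def cinner_scaleR_left cinner_scaleR_right WW r(2) scaleR_conv_of_real)
      (simp add: power2_eq_square field_simps)
  moreover have "V (r *\<^sub>R x) = \<rho> (rank1 x y) \<zeta>"
    using r(1) by (simp add: V_def scaleR_scaleC[of r x] W2) (simp add: W_def flip: scaleR_scaleC)
  then have "\<rho> (rank1 x y) \<zeta> \<in> range V" by (metis rangeI)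
  moreover have "V (u + v) = V u + V v" for u v by (simp add: V_def W1 scaleR_right_distrib)
  moreover have "V (c *\<^sub>C u) = c *\<^sub>C V u" for c u by (simp add: V_def W2 scaleC.scaleR_right)
  moreover have "V u \<in> L" for u using csubspaceD(3)[OF sub W3] by (simp add: V_def scaleR_scaleC)
  moreover have "V (a u) = \<rho> a (V u)" if "a \<in> cstar S" for a u
    by (simp add: V_def W4[OF that] blinfun.scaleR_right)
  ultimately show ?thesis by blast
qed

end

section \<open>The Hahn-Banach theorem and convex combinations\<close>

definition sublinear :: "('v::real_vector \<Rightarrow> real) \<Rightarrow> bool" where
  "sublinear q \<longleftrightarrow> (\<forall>x y. q (x + y) \<le> q x + q y) \<and> (\<forall>t x. 0 \<le> t \<longrightarrow> q (t *\<^sub>R x) = t * q x)"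

lemma sublinearD:
  assumes "sublinear q"
  shows "q (x + y) \<le> q x + q y" "0 \<le> t \<Longrightarrow> q (t *\<^sub>R x) = t * q x" "q 0 = 0" "- q (- x) \<le> q x"
proof -
  show 1: "q (x + y) \<le> q x + q y" and 2: "0 \<le> t \<Longrightarrow> q (t *\<^sub>R x) = t * q x" for x y t
    using assms by (auto simp: sublinear_def)
  show 3: "q 0 = 0" using 2[of 0 0] by simp
  show "- q (- x) \<le> q x" using 1[of x "- x"] 3 by simp
qed

text \<open>Lower bounds of chains, the lowering of a sublinear functional in one direction, and the
  gauge used for separation are all infima of this form.\<close>

lemma sublinear_INF:
  fixes g :: "'i \<Rightarrow> 'v::real_vector \<Rightarrow> real"
  assumes I: "I \<noteq> {}" and low: "\<And>i x. i \<in> I \<Longrightarrow> b x \<le> g i x"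
    and add: "\<And>i j x y. i \<in> I \<Longrightarrow> j \<in> I \<Longrightarrow> \<exists>k\<in>I. g k (x + y) \<le> g i x + g j y"
    and scale: "\<And>i t x. i \<in> I \<Longrightarrow> 0 < t \<Longrightarrow> \<exists>k\<in>I. g k (t *\<^sub>R x) \<le> t * g i x"
  shows "sublinear (\<lambda>x. INF i\<in>I. g i x)"
proof -
  let ?u = "\<lambda>x. INF i\<in>I. g i x"
  have lower: "?u x \<le> g i x" if "i \<in> I" for i x
    by (rule cINF_lower[OF _ that]) (use low in \<open>auto intro!: bdd_belowI2\<close>)
  have pos: "?u (t *\<^sub>R x) \<le> t * ?u x" if t: "0 < t" for t x
  proof -
    have "?u (t *\<^sub>R x) / t \<le> g i x" if i: "i \<in> I" for i
    proof -
      obtain k where k: "k \<in> I" "g k (t *\<^sub>R x) \<le> t * g i x" using scale[OF i t] by blast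
      then have "?u (t *\<^sub>R x) \<le> t * g i x" using lower[of k "t *\<^sub>R x"] by linarith
      then show ?thesis using t by (simp add: divide_le_eq mult.commute)
    qed
    then have "?u (t *\<^sub>R x) / t \<le> ?u x" by (rule cINF_greatest[OF I])
    then show ?thesis using t by (simp add: divide_le_eq mult.commute)
  qed
  have zero: "?u 0 = 0" using pos[of 2 0] pos[of "1/2" 0] by simp
  show ?thesis
    unfolding sublinear_def
  proof (intro conjI allI impI)
    fix x y
    have "?u (x + y) - g j y \<le> ?u x" if j: "j \<in> I" for j
    proof (rule cINF_greatest[OF I])
      fix i assume i: "i \<in> I"
      obtain k where k: "k \<in> I" "g k (x + y) \<le> g i x + g j y" using add[OF i j] by blast
      then show "?u (x + y) - g j y \<le> g i x" using lower[of k "x + y"] by linarith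
    qed
    then have "?u (x + y) - ?u x \<le> ?u y" by (intro cINF_greatest[OF I]) (simp add: algebra_simps)
    then show "?u (x + y) \<le> ?u x + ?u y" by simp
  next
    fix t :: real and x :: 'v assume "0 \<le> t"
    show "?u (t *\<^sub>R x) = t * ?u x"
    proof (cases "t = 0")
      case False
      then have t: "0 < t" using \<open>0 \<le> t\<close> by simp
      have "?u x \<le> inverse t * ?u (t *\<^sub>R x)" using pos[of "inverse t" "t *\<^sub>R x"] t by simp
      then have "t * ?u x \<le> ?u (t *\<^sub>R x)" using t by (simp add: field_simps)
      then show ?thesis using pos[OF t, of x] by simp
    qed (simp add: zero)
  qed
qed

text \<open>A minimal sublinear functional is linear: lowering it in a direction \<open>y\<close> as far as
  sublinearity permits gives \<open>x \<mapsto> inf\<^sub>t q(x + t y) - t q(y)\<close>, which by minimality is \<open>q\<close> again.\<close>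

lemma hahn_banach:
  fixes p :: "'v::real_vector \<Rightarrow> real"
  assumes p: "sublinear p"
  shows "\<exists>f. linear f \<and> (\<forall>x. f x \<le> p x)"
proof -
  define Q where "Q = {q. sublinear q \<and> (\<forall>x. q x \<le> p x)}"
  define below where "below q r \<longleftrightarrow> (\<forall>x. r x \<le> q x)" for q r :: "'v \<Rightarrow> real"
  have low: "- p (- x) \<le> q x" if "q \<in> Q" for q x
  proof -
    have "q (- x) \<le> p (- x)" "- q (- x) \<le> q x" using that sublinearD(4)[of q x]
      by (auto simp: Q_def)
    then show ?thesis by linarith
  qed
  have "\<exists>m\<in>Q. \<forall>a\<in>Q. below m a \<longrightarrow> a = m"
  proof (rule predicate_Zorn)
    show "partial_order_on Q (relation_of below Q)"
      by (rule partial_order_on_relation_ofI)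
        (auto simp: below_def intro: order_trans antisym intro!: ext)
    fix C assume "C \<in> Chains (relation_of below Q)"
    then have CQ: "C \<subseteq> Q" and lin: "\<And>q r. q \<in> C \<Longrightarrow> r \<in> C \<Longrightarrow> below q r \<or> below r q"
      by (auto simp: Chains_def relation_of_def)
    show "\<exists>u\<in>Q. \<forall>a\<in>C. below a u"
    proof (cases "C = {}")
      case True
      then show ?thesis using p by (auto simp: Q_def)
    next
      case False
      let ?u = "\<lambda>x. INF q\<in>C. q x"
      have lowC: "- p (- x) \<le> q x" if "q \<in> C" for q x using low CQ that by blast
      have "sublinear ?u"
      proof (rule sublinear_INF[OF False lowC])
        fix q r x y assume qr: "q \<in> C" "r \<in> C"
        have sl: "sublinear q" "sublinear r" using qr CQ by (auto simp: Q_def)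
        show "\<exists>k\<in>C. k (x + y) \<le> q x + r y"
          using lin[OF qr]
        proof
          assume "below q r"
          then have "r (x + y) \<le> q x + r y" using sublinearD(1)[OF sl(2), of x y]
            by (auto simp: below_def intro: order_trans)
          then show ?thesis using qr by blast
        next
          assume "below r q"
          then have "q (x + y) \<le> q x + r y" using sublinearD(1)[OF sl(1), of x y]
            by (auto simp: below_def intro: order_trans)
          then show ?thesis using qr by blast
        qed
      next
        fix q and t :: real and x assume q: "q \<in> C" "0 < t"
        then have "q (t *\<^sub>R x) = t * q x" using CQ sublinearD(2)[of q t x] by (auto simp: Q_def)
        then show "\<exists>k\<in>C. k (t *\<^sub>R x) \<le> t * q x" using q(1) by (intro bexI[of _ q]) simp
      qed
      moreover have ule: "?u x \<le> q x" if "q \<in> C" for q x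
        by (rule cINF_lower[OF _ that]) (use lowC in \<open>auto intro!: bdd_belowI2\<close>)
      moreover obtain q0 where "q0 \<in> C" using False by blast
      then have "?u x \<le> p x" for x
        using ule[of q0 x] CQ by (auto simp: Q_def intro: order_trans)
      ultimately show ?thesis by (intro bexI[of _ ?u]) (auto simp: Q_def below_def)
    qed
  qed
  then obtain q where q: "q \<in> Q" and min: "\<And>r. r \<in> Q \<Longrightarrow> below q r \<Longrightarrow> r = q" by blast
  have slq: "sublinear q" using q by (simp add: Q_def)
  note qD = sublinearD[OF slq]
  have super: "q x + q y \<le> q (x + y)" for x y
  proof -
    let ?g = "\<lambda>t x. q (x + t *\<^sub>R y) - t * q y"
    let ?r = "\<lambda>x. INF t\<in>{0..}. ?g t x"
    have lowr: "- q (- x) \<le> ?g t x" if "t \<in> {0..}" for t x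
    proof -
      have "q (t *\<^sub>R y) \<le> q (x + t *\<^sub>R y) + q (- x)" using qD(1)[of "x + t *\<^sub>R y" "- x"] by simp
      then show ?thesis using qD(2)[of t y] that by simp
    qed
    have "sublinear ?r"
    proof (rule sublinear_INF[OF _ lowr])
      fix s t :: real and u v assume "s \<in> {0..}" "t \<in> {0..}"
      then show "\<exists>k\<in>{0..}. ?g k (u + v) \<le> ?g s u + ?g t v"
        using qD(1)[of "u + s *\<^sub>R y" "v + t *\<^sub>R y"]
        by (intro bexI[of _ "s + t"]) (auto simp: algebra_simps)
    next
      fix s t :: real and u assume st: "s \<in> {0..}" "0 < t"
      have "q (t *\<^sub>R u + (t * s) *\<^sub>R y) = t * q (u + s *\<^sub>R y)"
        using qD(2)[of t "u + s *\<^sub>R y"] st by (simp add: scaleR_add_right)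
      then show "\<exists>k\<in>{0..}. ?g k (t *\<^sub>R u) \<le> t * ?g s u"
        using st by (intro bexI[of _ "t * s"]) (auto simp: algebra_simps)
    qed simp
    moreover have rle: "?r x \<le> ?g t x" if "t \<in> {0..}" for t x
      by (rule cINF_lower[OF _ that]) (use lowr in \<open>auto intro!: bdd_belowI2\<close>)
    then have rq: "?r x \<le> q x" for x using rle[of 0 x] by simp
    then have "?r x \<le> p x" for x using q by (auto simp: Q_def intro: order_trans)
    ultimately have "?r \<in> Q" by (simp add: Q_def)
    moreover have "below q ?r" unfolding below_def using rq by blast
    ultimately have "?r = q" by (rule min)
    from fun_cong[OF this[symmetric]] have "q x = ?r x" .
    also have "\<dots> \<le> q (x + y) - q y" using rle[of 1 x] by simp
    finally show ?thesis by simp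
  qed
  have addq: "q (x + y) = q x + q y" for x y using super[of x y] qD(1)[of x y] by simp
  have neg: "q (- x) = - q x" for x using addq[of x "- x"] qD(3) by simp
  have "linear q"
  proof (rule linearI)
    show "q (x + y) = q x + q y" for x y by (rule addq)
    show "q (r *\<^sub>R x) = r *\<^sub>R q x" for r x
    proof (cases "0 \<le> r")
      case False
      then show ?thesis using qD(2)[of "- r" "- x"] by (simp add: neg)
    qed (simp add: qD(2))
  qed
  then show ?thesis using q by (auto simp: Q_def)
qed

text \<open>The functional \<open>x \<mapsto> inf \<parallel>x + t c\<parallel> - t \<eta>\<close>, over \<open>t \<ge> 0\<close> and \<open>c \<in> C\<close>, is sublinear by
  convexity of \<open>C\<close>, bounded by the norm, and at most \<open>-\<eta>\<close> on \<open>-C\<close>. A linear functional below it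
  separates.\<close>

lemma separate_convex_from_ball:
  fixes C :: "'v::real_normed_vector set"
  assumes C: "convex C" "C \<noteq> {}" and far: "\<And>c. c \<in> C \<Longrightarrow> \<eta> \<le> norm c"
  shows "\<exists>f. linear f \<and> (\<forall>x. f x \<le> norm x) \<and> (\<forall>c\<in>C. \<eta> \<le> f c)"
proof -
  define I where "I = {0::real..} \<times> C"
  define g where "g i x = norm (x + fst i *\<^sub>R snd i) - fst i * \<eta>" for i :: "real \<times> 'v" and x :: 'v
  let ?p = "\<lambda>x. INF i\<in>I. g i x"
  have low: "- norm x \<le> g i x" if "i \<in> I" for i x
  proof -
    have "fst i * \<eta> \<le> norm (fst i *\<^sub>R snd i)" using that far
      by (auto simp: I_def intro!: mult_left_mono)
    also have "\<dots> \<le> norm (x + fst i *\<^sub>R snd i) + norm x"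
      using norm_triangle_ineq4[of "x + fst i *\<^sub>R snd i" x] by simp
    finally show ?thesis by (simp add: g_def)
  qed
  have "sublinear ?p"
  proof (rule sublinear_INF[OF _ low])
    show "I \<noteq> {}" using C(2) by (auto simp: I_def)
    fix i j x y assume ij: "i \<in> I" "j \<in> I"
    obtain s c where i: "i = (s, c)" "0 \<le> s" "c \<in> C" using ij by (auto simp: I_def)
    obtain t d where j: "j = (t, d)" "0 \<le> t" "d \<in> C" using ij by (auto simp: I_def)
    obtain e where e: "e \<in> C" "(s + t) *\<^sub>R e = s *\<^sub>R c + t *\<^sub>R d"
    proof (cases "s + t = 0")
      case True
      then have "s = 0" "t = 0" using i j by auto
      then show ?thesis using that[of c] i by simp
    next
      case False
      then have "0 < s + t" using i j by simp
      then have "(s / (s + t)) *\<^sub>R c + (t / (s + t)) *\<^sub>R d \<in> C"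
        using i j by (intro convexD[OF C(1)]) (auto simp flip: add_divide_distrib)
      then show ?thesis using that[of "(s / (s + t)) *\<^sub>R c + (t / (s + t)) *\<^sub>R d"] False
        by (simp add: scaleR_add_right)
    qed
    have "x + y + (s + t) *\<^sub>R e = (x + s *\<^sub>R c) + (y + t *\<^sub>R d)" unfolding e(2) by simp
    then have "norm (x + y + (s + t) *\<^sub>R e) \<le> norm (x + s *\<^sub>R c) + norm (y + t *\<^sub>R d)"
      by (metis norm_triangle_ineq)
    then show "\<exists>k\<in>I. g k (x + y) \<le> g i x + g j y"
      using i j e(1) by (intro bexI[of _ "(s + t, e)"]) (auto simp: g_def I_def distrib_right)
  next
    fix i and t :: real and x assume i: "i \<in> I" "0 < t"
    have "norm (t *\<^sub>R x + (t * fst i) *\<^sub>R snd i) = t * norm (x + fst i *\<^sub>R snd i)"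
      using i(2) norm_scaleR[of t "x + fst i *\<^sub>R snd i"] by (simp add: scaleR_add_right)
    then show "\<exists>k\<in>I. g k (t *\<^sub>R x) \<le> t * g i x"
      using i by (intro bexI[of _ "(t * fst i, snd i)"]) (auto simp: g_def I_def algebra_simps)
  qed
  then obtain f where f: "linear f" "\<And>x. f x \<le> ?p x" using hahn_banach by blast
  have ple: "?p x \<le> g i x" if "i \<in> I" for i x
    by (rule cINF_lower[OF _ that]) (use low in \<open>auto intro!: bdd_belowI2\<close>)
  have "f x \<le> norm x" for x
  proof -
    obtain c where "c \<in> C" using C(2) by blast
    then show ?thesis using order_trans[OF f(2) ple[of "(0, c)" x]] by (simp add: g_def I_def)
  qed
  moreover have "\<eta> \<le> f c" if "c \<in> C" for c
  proof -
    have "f (- c) \<le> - \<eta>"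
      using order_trans[OF f(2) ple[of "(1, c)" "- c"]] that by (simp add: g_def I_def)
    then show ?thesis using linear_neg[OF f(1), of c] by simp
  qed
  ultimately show ?thesis using f(1) by blast
qed

text \<open>Tuples are bounded functions on the discrete space of natural numbers, which form a normed
  space.\<close>

lemma separate_convex_tuples:
  fixes C :: "(nat \<Rightarrow> 'v::real_normed_vector) set"
  assumes C: "C \<noteq> {}" "\<And>f g t. f \<in> C \<Longrightarrow> g \<in> C \<Longrightarrow> 0 \<le> t \<Longrightarrow> t \<le> 1 \<Longrightarrow>
      (\<lambda>j. (1 - t) *\<^sub>R f j + t *\<^sub>R g j) \<in> C"
    and far: "\<And>f. f \<in> C \<Longrightarrow> \<exists>j<n. \<eta> \<le> norm (f j)"
  shows "\<exists>l. (\<forall>j. linear (l j) \<and> (\<forall>x. \<bar>l j x\<bar> \<le> norm x)) \<and> (\<forall>f\<in>C. \<eta> \<le> (\<Sum>j<n. l j (f j)))"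
proof -
  define T where "T f = Bcontfun (\<lambda>j. if j < n then f j else 0)" for f :: "nat \<Rightarrow> 'v"
  define e where "e k x = T (\<lambda>j. if j = k then x else 0)" for k :: nat and x :: 'v
  have T: "apply_bcontfun (T f) j = (if j < n then f j else 0)" for f j
  proof -
    have "range (\<lambda>j. if j < n then f j else 0) \<subseteq> insert 0 (f ` {..<n})" by auto
    then have "finite (range (\<lambda>j. if j < n then f j else 0))" by (rule finite_subset) simp
    then have "(\<lambda>j. if j < n then f j else 0) \<in> bcontfun"
      by (simp add: bcontfun_def finite_imp_bounded)
    then show ?thesis by (simp add: T_def Bcontfun_inverse)
  qed
  have sum: "apply_bcontfun (\<Sum>k\<in>K. h k) j = (\<Sum>k\<in>K. apply_bcontfun (h k) j)"
      for h :: "nat \<Rightarrow> nat \<Rightarrow>\<^sub>C 'v" and K j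
    by (induction K rule: infinite_finite_induct) auto
  have eT: "apply_bcontfun (e k x) j = (if k = j \<and> j < n then x else 0)" for k j x
    by (simp add: e_def T)
  have Te: "T f = (\<Sum>k<n. e k (f k))" for f
  proof (rule bcontfun_eqI)
    fix j
    have "(\<Sum>k<n. if k = j \<and> j < n then f k else 0)
        = (\<Sum>k<n. if k = j then (if j < n then f j else 0) else 0)"
      by (intro sum.cong) auto
    then show "apply_bcontfun (T f) j = apply_bcontfun (\<Sum>k<n. e k (f k)) j"
      by (simp add: sum eT T)
  qed
  have conv: "convex (T ` C)"
    unfolding convex_alt
  proof (intro ballI allI impI, clarify)
    fix f g and t :: real assume fg: "f \<in> C" "g \<in> C" and t: "0 \<le> t" "t \<le> 1"
    have "(1 - t) *\<^sub>R T f + t *\<^sub>R T g = T (\<lambda>j. (1 - t) *\<^sub>R f j + t *\<^sub>R g j)"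
      by (rule bcontfun_eqI) (simp add: T)
    then show "(1 - t) *\<^sub>R T f + t *\<^sub>R T g \<in> T ` C" using C(2)[OF fg t] by simp
  qed
  have far': "\<eta> \<le> norm w" if "w \<in> T ` C" for w
  proof -
    obtain f where f: "f \<in> C" "w = T f" using \<open>w \<in> T ` C\<close> by blast
    then obtain j where j: "j < n" "\<eta> \<le> norm (f j)" using far by blast
    then show ?thesis using norm_bounded[of w j] f by (simp add: T)
  qed
  have "T ` C \<noteq> {}" using C(1) by simp
  from separate_convex_from_ball[OF conv this far']
  obtain l where l: "linear l" "\<And>w. l w \<le> norm w" "\<And>f. f \<in> C \<Longrightarrow> \<eta> \<le> l (T f)"
    by auto
  have lin: "linear (\<lambda>x. l (e j x))" for j
  proof (rule linearI)
    have "e j (x + y) = e j x + e j y" for x y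
      by (rule bcontfun_eqI) (simp add: e_def T)
    then show "l (e j (x + y)) = l (e j x) + l (e j y)" for x y by (simp add: linear_add[OF l(1)])
    have "e j (r *\<^sub>R x) = r *\<^sub>R e j x" for r x
      by (rule bcontfun_eqI) (simp add: e_def T)
    then show "l (e j (r *\<^sub>R x)) = r *\<^sub>R l (e j x)" for r x by (simp add: linear_scale[OF l(1)])
  qed
  have le: "l (e j x) \<le> norm x" for j x
    by (rule order_trans[OF l(2) norm_bound]) (simp add: e_def T)
  have "\<bar>l (e j x)\<bar> \<le> norm x" for j x
    using le[of j x] le[of j "- x"] linear_neg[OF lin, of j x] by simp
  moreover have "\<eta> \<le> (\<Sum>j<n. l (e j (f j)))" if "f \<in> C" for f
    using l(3)[OF that] by (simp add: Te linear_sum[OF l(1)])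
  ultimately show ?thesis using lin by (intro exI[of _ "\<lambda>j x. l (e j x)"]) auto
qed

lemma complexify_functional:
  fixes l :: "'a::chilbert_space op \<Rightarrow> real"
  assumes l: "linear l" and bd: "\<And>x. \<bar>l x\<bar> \<le> norm x"
  shows "\<exists>f. bounded_functional_on V f \<and> (\<forall>x. Re (f x) = l x)"
proof -
  define f where "f x = complex_of_real (l x) - \<i> * complex_of_real (l (\<i> *\<^sub>C x))" for x
  have add: "f (x + y) = f x + f y" for x y
    by (simp add: f_def scaleC_op_simps linear_add[OF l] algebra_simps)
  have scale: "f (c *\<^sub>C x) = c * f x" for c x
  proof -
    have 1: "c *\<^sub>C x = Re c *\<^sub>R x + Im c *\<^sub>R (\<i> *\<^sub>C x)"
    proof -
      have "c *\<^sub>C x = (of_real (Re c) + of_real (Im c) * \<i>) *\<^sub>C x"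
        by (metis complex_eq mult.commute)
      then show ?thesis by (simp only: scaleC_op_simps(3) scaleC_op_simps(4)[symmetric]
          scaleC_op_simps(9))
    qed
    have 2: "\<i> *\<^sub>C c *\<^sub>C x = Re c *\<^sub>R (\<i> *\<^sub>C x) - Im c *\<^sub>R x"
    proof -
      have "\<i> * c = of_real (Re c) * \<i> + (- of_real (Im c))" by (simp add: complex_eq_iff)
      then have "\<i> *\<^sub>C c *\<^sub>C x = (of_real (Re c) * \<i> + of_real (- Im c)) *\<^sub>C x"
        by (simp add: scaleC_op_simps(4))
      then show ?thesis
        by (simp only: scaleC_op_simps(3) scaleC_op_simps(4)[symmetric] scaleC_op_simps(9)) simp
    qed
    show ?thesis
      unfolding f_def 2 unfolding 1
      by (simp add: linear_add[OF l] linear_diff[OF l] linear_scale[OF l] complex_eq_iff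
          algebra_simps)
  qed
  have "cmod (f x) \<le> 2 * norm x" for x
  proof -
    have "cmod (f x) \<le> \<bar>l x\<bar> + \<bar>l (\<i> *\<^sub>C x)\<bar>"
      unfolding f_def by (rule order_trans[OF norm_triangle_ineq4]) (simp add: norm_mult)
    also have "\<dots> \<le> norm x + norm x"
      using bd[of x] order_trans[OF bd norm_scaleC_op, of \<i> x] by simp
    finally show ?thesis by simp
  qed
  then have "bounded_functional_on V f"
    using add scale by (auto simp: bounded_functional_on_def clinear_on_def scaleC_complex_def)
  moreover have "Re (f x) = l x" for x by (simp add: f_def)
  ultimately show ?thesis by blast
qed

section \<open>Unique tight extension\<close>

lemma finite_rank_dense:
  assumes "k \<in> compact_ops" "0 < e"
  shows "\<exists>q\<in>finite_rank. norm (k - q) \<le> e"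
proof -
  obtain Q where Q: "Q \<in> finite_rank" "norm (k - (Q o\<^sub>L k)) \<le> e"
    using compact_finite_rank_approximation[of "{k}" e] assms by auto
  then show ?thesis using finite_rank_compose_right[OF Q(1) compact_ops_bop[OF assms(1)]] by blast
qed

lemma character_on_diff:
  assumes "character_on N \<phi>" "csubspace N" "T \<in> N" "R \<in> N"
  shows "\<phi> (T - R) = \<phi> T - \<phi> R"
proof -
  have "\<phi> (T + (-1) *\<^sub>C R) = \<phi> T + (-1) * \<phi> R"
    using assms csubspaceD(3)[OF assms(2,4), of "-1"] by (simp add: character_on_def)
  then show ?thesis by (simp add: scaleC_op_simps)
qed

lemma ucp_positive_op:
  assumes u: "ucp A E C \<psi>" and a: "a \<in> A" "positive_op a"
  shows "positive_op (\<psi> a)"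
proof -
  have "positive_matrix 1 (\<lambda>_ _. a)" using a(2) by (simp add: positive_matrix_def positive_op_def)
  moreover have "\<forall>n m. (\<forall>i<n. \<forall>j<n. m i j \<in> A) \<and> positive_matrix n m \<longrightarrow>
      positive_matrix n (\<lambda>i j. \<psi> (m i j))"
    using u unfolding ucp_def by (elim conjE)
  ultimately have pos: "positive_matrix 1 (\<lambda>_ _. \<psi> a)"
    using a(1) by (elim allE[where x = 1] allE[where x = "\<lambda>_ _. a"]) simp
  show ?thesis
    unfolding positive_op_def
  proof
    fix y
    show "cinner y (\<psi> a y) \<in> \<real>\<^sub>\<ge>\<^sub>0"
      using pos[unfolded positive_matrix_def, THEN spec, of "\<lambda>_. y"] by simp
  qed
qed

lemma state_on_compose_ucp:
  assumes A: "cstar_algebra A" and E: "closed_csubspace E" and u: "ucp A E C \<psi>"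
    and C: "C \<subseteq> N" "C \<subseteq> bop E"
    and \<phi>: "character_on N \<phi>" "\<And>T. T \<in> N \<Longrightarrow> positive_op T \<Longrightarrow> \<phi> T \<in> \<real>\<^sub>\<ge>\<^sub>0" "\<phi> (unit_op E) = 1"
  shows "state_on A (\<lambda>a. \<phi> (\<psi> a))"
proof -
  have N: "\<psi> a \<in> N" if "a \<in> A" for a using u C that by (auto simp: ucp_def)
  have "cmod (\<phi> (\<psi> a)) \<le> norm a" if "a \<in> A" for a
    using \<phi>(1) N[OF that] ucp_adj_norm(2)[OF A E u C(2) that]
        by (auto simp: character_on_def intro: order_trans)
  moreover have "\<phi> (\<psi> (a + b)) = \<phi> (\<psi> a) + \<phi> (\<psi> b)" if "a \<in> A" "b \<in> A" for a b
    using u \<phi>(1) N that by (simp add: ucp_def clinear_on_def character_on_def)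
  moreover have "\<phi> (\<psi> (c *\<^sub>C a)) = c * \<phi> (\<psi> a)" if "a \<in> A" for a c
    using u \<phi>(1) N that by (simp add: ucp_def clinear_on_def character_on_def)
  moreover have "\<phi> (\<psi> id_blinfun) = 1" using u \<phi>(3) by (simp add: ucp_def)
  moreover have "\<phi> (\<psi> a) \<in> \<real>\<^sub>\<ge>\<^sub>0" if "a \<in> A" "positive_op a" for a
    using \<phi>(2)[OF N ucp_positive_op[OF u]] that by blast
  ultimately show ?thesis by (simp add: state_on_def)
qed

lemma character_on_compose_rep:
  assumes A: "cstar_algebra A" and E: "closed_csubspace E" and \<rho>: "unital_star_rep A E \<rho>"
    and N: "\<rho> ` A \<subseteq> N" and \<phi>: "character_on N \<phi>"
  shows "character_on A (\<lambda>a. \<phi> (\<rho> a))"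
proof -
  note RD = unital_star_repD[OF \<rho> A]
  have N': "\<rho> a \<in> N" if "a \<in> A" for a using N that by blast
  have "cmod (\<phi> (\<rho> a)) \<le> norm a" if "a \<in> A" for a
    using \<phi> N'[OF that] star_rep_contractive[OF A E \<rho> that]
        by (auto simp: character_on_def intro: order_trans)
  then show ?thesis using \<phi> N' by (simp add: character_on_def RD)
qed

text \<open>With the unit \<open>P\<close> of the corner, \<open>x P = x\<close> gives \<open>\<phi>(x) \<phi>(P) = \<phi>(x)\<close>.\<close>

lemma character_on_unit:
  assumes E: "closed_csubspace E" and N: "N \<subseteq> bop E" "unit_op E \<in> N"
    and \<phi>: "character_on N \<phi>" and x: "x \<in> N" "\<phi> x \<noteq> 0"
  shows "\<phi> (unit_op E) = 1"
proof -
  have "x o\<^sub>L unit_op E = x"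
    using N x by (intro blinfun_eqI) (auto simp: bop_unit_right[OF E])
  moreover have "\<phi> (x o\<^sub>L unit_op E) = \<phi> x * \<phi> (unit_op E)"
    using \<phi> x N(2) by (simp add: character_on_def)
  ultimately show ?thesis using x(2) by simp
qed

context boundary_system
begin

lemma commutator_compact: "a \<in> cstar S \<Longrightarrow> b \<in> cstar S \<Longrightarrow> (a o\<^sub>L b) - (b o\<^sub>L a) \<in> compact_ops"
proof -
  assume ab: "a \<in> cstar S" "b \<in> cstar S"
  have "(a o\<^sub>L b) \<in> op_coset compact_ops (a o\<^sub>L b)"
    using csubspaceD(1)[OF csubspace_compact_ops] by (auto simp: op_coset_def intro: exI[of _ 0])
  also have "\<dots> = op_coset compact_ops (b o\<^sub>L a)" using comm_quot ab
    by (simp add: commutative_quotient_def)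
  finally show ?thesis by (auto simp: op_coset_def)
qed

lemma rep_range:
  assumes L: "closed_csubspace L" and \<rho>: "unital_star_rep (cstar S) L \<rho>"
  shows "csubspace (\<rho> ` cstar S)" "\<rho> ` cstar S \<subseteq> bop L" "T \<in> \<rho> ` cstar S \<Longrightarrow> adj T \<in> \<rho> ` cstar S"
    "T \<in> \<rho> ` cstar S \<Longrightarrow> R \<in> \<rho> ` cstar S \<Longrightarrow> T o\<^sub>L R \<in> \<rho> ` cstar S" "unit_op L \<in> \<rho> ` cstar S"
proof -
  note RD = unital_star_repD[OF \<rho> A]
  show "csubspace (\<rho> ` cstar S)"
    unfolding csubspace_def
  proof (intro conjI ballI allI)
    show "0 \<in> \<rho> ` cstar S" using AD(11) RD(8) by (metis imageI)
    show "x + y \<in> \<rho> ` cstar S" if "x \<in> \<rho> ` cstar S" "y \<in> \<rho> ` cstar S" for x y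
      using that AD(7) by (auto simp flip: RD(5))
    show "c *\<^sub>C x \<in> \<rho> ` cstar S" if "x \<in> \<rho> ` cstar S" for c x
      using that AD(9) by (auto simp flip: RD(6))
  qed
  show "\<rho> ` cstar S \<subseteq> bop L" using RD(1) by blast
  show "T \<in> \<rho> ` cstar S \<Longrightarrow> adj T \<in> \<rho> ` cstar S" using AD(5) by (auto simp flip: RD(4))
  show "T \<in> \<rho> ` cstar S \<Longrightarrow> R \<in> \<rho> ` cstar S \<Longrightarrow> T o\<^sub>L R \<in> \<rho> ` cstar S" using AD(4)
    by (auto simp flip: RD(3))
  show "unit_op L \<in> \<rho> ` cstar S" using AD(3) RD(2) by (metis imageI)
qed

text \<open>The finite-rank operators are dense in the compact operators, and \<open>\<rho>\<close> is contractive.\<close>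

lemma rep_compact_zero:
  assumes L: "closed_csubspace L" and \<rho>: "unital_star_rep (cstar S) L \<rho>"
    and zero: "\<And>u v. D o\<^sub>L \<rho> (rank1 u v) o\<^sub>L D' = 0" and k: "k \<in> compact_ops"
  shows "D o\<^sub>L \<rho> k o\<^sub>L D' = 0"
proof -
  note RD = unital_star_repD[OF \<rho> A]
  have fr: "q \<in> cstar S \<and> D o\<^sub>L \<rho> q o\<^sub>L D' = 0" if "q \<in> finite_rank" for q
    using that
  proof (induction rule: finite_rank.induct)
    case zero
    then show ?case by (auto simp: RD(8) AD(11) blinfun.zero_right intro!: blinfun_eqI)
  next
    case (add q u v)
    have "(D o\<^sub>L \<rho> (rank1 u v + q) o\<^sub>L D') = (D o\<^sub>L \<rho> (rank1 u v) o\<^sub>L D') + (D o\<^sub>L \<rho> q o\<^sub>L D')"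
      using add by (simp add: RD(5)[OF rank1_cstar] compose_add)
    then show ?case using add zero AD(7)[OF rank1_cstar] by simp
  qed
  have "norm (D o\<^sub>L \<rho> k o\<^sub>L D') \<le> e * (norm D * norm D')" if e: "0 < e" for e
  proof -
    obtain q where q: "q \<in> finite_rank" "norm (k - q) \<le> e" using finite_rank_dense[OF k e] by blast
    have kA: "k \<in> cstar S" and qA: "q \<in> cstar S" using k compact_sub fr[OF q(1)] by auto
    have "D o\<^sub>L \<rho> k o\<^sub>L D' = D o\<^sub>L \<rho> (k - q) o\<^sub>L D'"
      using fr[OF q(1)] by (simp add: RD(7)[OF kA qA] compose_add)
    then have "norm (D o\<^sub>L \<rho> k o\<^sub>L D') \<le> norm D * norm (\<rho> (k - q)) * norm D'"
      by (metis (no_types) mult_right_mono norm_blinfun_compose norm_ge_zero order_trans)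
    also have "\<dots> \<le> norm D * e * norm D'"
      by (intro mult_right_mono mult_left_mono
          order_trans[OF star_rep_contractive[OF A L \<rho> AD(8)[OF kA qA]] q(2)]) auto
    finally show ?thesis by (simp add: ac_simps)
  qed
  from this[of "inverse (real (Suc n))" for n]
  have "norm (D o\<^sub>L \<rho> k o\<^sub>L D') \<le> inverse (real (Suc n)) * (norm D * norm D')" for n by simp
  moreover have "(\<lambda>n. inverse (real (Suc n)) * (norm D * norm D')) \<longlonglongrightarrow> 0 * (norm D * norm D')"
    by (intro tendsto_mult LIMSEQ_inverse_real_of_nat tendsto_const)
  ultimately have "norm (D o\<^sub>L \<rho> k o\<^sub>L D') \<le> 0"
    by (intro LIMSEQ_le_const[of _ 0]) auto
  then show ?thesis by simp
qed

lemma isometric_range_closed: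
  fixes V :: "'h \<Rightarrow> 'l::chilbert_space"
  assumes "\<And>x y. V (x + y) = V x + V y" "\<And>c x. V (c *\<^sub>C x) = c *\<^sub>C V x"
      "\<And>x y. cinner (V x) (V y) = cinner x y"
  shows "closed_csubspace (range V)"
proof -
  have diff: "V (x - y) = V x - V y" for x y using assms(1)[of "x - y" y]
    by (simp add: algebra_simps)
  have V0: "V 0 = 0" using assms(1)[of 0 0] by simp
  have dist: "dist (V x) (V y) = dist x y" for x y
    by (simp add: dist_norm norm_preserves_inner[where V = V, OF assms(3)] flip: diff)
  have "closed (range V)"
    unfolding closed_sequential_limits
  proof (intro allI impI, elim conjE)
    fix s l assume sV: "\<forall>n. s n \<in> range V" and lim: "s \<longlonglongrightarrow> l"
    have "\<forall>n. \<exists>y. s n = V y" using sV by auto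
    then obtain x where "\<forall>n. s n = V (x n)" using choice[of "\<lambda>n y. s n = V y"] by blast
    then have sx: "s = (\<lambda>n. V (x n))" by auto
    have "Cauchy s" using lim by (rule LIMSEQ_imp_Cauchy)
    then have "Cauchy x" by (simp add: Cauchy_def sx dist)
    then obtain z where z: "x \<longlonglongrightarrow> z" by (auto simp: Cauchy_convergent_iff convergent_def)
    then have "s \<longlonglongrightarrow> V z" unfolding sx tendsto_iff by (simp add: dist)
    then show "l \<in> range V" using lim LIMSEQ_unique by blast
  qed
  moreover have "csubspace (range V)"
    unfolding csubspace_def using V0 rangeI[of V 0] by (auto simp flip: assms(1,2))
  ultimately show ?thesis by (simp add: closed_csubspace_def)
qed

text \<open>Let \<open>D = \<psi> - \<rho>\<close> for a map \<open>\<psi>\<close> into the bicommutant extending \<open>\<rho>\<close> on \<open>S\<close>. On the part of \<open>L\<close>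
  generated by the compact operators, \<open>\<rho>\<close> is a multiple of the identity representation and \<open>D\<close>
  respects the copies of \<open>H\<close>, so \<open>D\<close> vanishes there. On the orthogonal complement the bicommutant
  acts commutatively; a character detecting \<open>D(a)\<close> would turn \<open>\<psi>\<close> into a state and \<open>\<rho>\<close> into a
  different character agreeing with it on \<open>S\<close>.\<close>

theorem unique_tight_extension:
  fixes L :: "'l::chilbert_space set"
  assumes L: "closed_csubspace L" and \<rho>: "unital_star_rep (cstar S) L \<rho>"
  shows "unique_tight_extension_property S L \<rho>"
  unfolding unique_tight_extension_property_def
proof (intro allI impI, elim conjE)
  let ?X = "\<rho> ` cstar S"
  let ?N = "bicommutant L ?X"
  fix \<psi> assume u: "ucp (cstar S) L ?N \<psi>" and ext: "\<forall>s\<in>S. \<psi> s = \<rho> s"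
  note RD = unital_star_repD[OF \<rho> A] and X = rep_range[OF L \<rho>]
  have subL: "csubspace L" using L by (simp add: closed_csubspace_def)
  have CX: "commutant L ?X \<subseteq> bop L" using commutant_bop by blast
  have CXadj: "adj T \<in> commutant L ?X" if "T \<in> commutant L ?X" for T
    using commutant_adj[OF L X(2,3) that] .
  have Nsub: "csubspace ?N" by (rule csubspace_commutant[OF subL CX])
  have Nb: "?N \<subseteq> bop L" using commutant_bop by blast
  have NU: "?N \<subseteq> bop UNIV" using Nb bop_subset_UNIV by blast
  have Nadj: "adj T \<in> ?N" if "T \<in> ?N" for T by (rule commutant_adj[OF L CX CXadj that])
  have Ncomp: "T o\<^sub>L R \<in> ?N" if "T \<in> ?N" "R \<in> ?N" for T R by (rule commutant_compose[OF that])
  have XN: "?X \<subseteq> ?N" by (rule subset_bicommutant[OF X(2)])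
  have \<psi>N: "\<psi> a \<in> ?N" if "a \<in> cstar S" for a using u that by (auto simp: ucp_def)
  define D where "D a = \<psi> a - \<rho> a" for a
  have DN: "D a \<in> ?N" if "a \<in> cstar S" for a
    unfolding D_def by (rule csubspace_op_diff[OF Nsub \<psi>N[OF that]]) (use XN that in blast)
  have DU: "D a \<in> bop UNIV" if "a \<in> cstar S" for a using DN[OF that] NU by blast
  have \<rho>U: "\<rho> a \<in> bop UNIV" and \<psi>U: "\<psi> a \<in> bop UNIV" if "a \<in> cstar S" for a
    using RD(1)[OF that] bop_subset_UNIV \<psi>N[OF that] NU by auto
  have Dadj: "D (adj a) = adj (D a)" if "a \<in> cstar S" for a
    by (simp add: D_def RD(4)[OF that] ucp_adj_norm(1)[OF A L u Nb that] adj_diff \<rho>U \<psi>U that)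
  \<comment> \<open>On the subspace generated by the compact operators: \<open>\<psi>(a)\<close> leaves the range of an intertwiner
    \<open>V\<close> invariant, and its compression to this range is that of \<open>\<rho>(a)\<close>.\<close>
  have Dr: "D a (\<rho> (rank1 x y) \<zeta>) = 0" if a: "a \<in> cstar S" for a x y \<zeta>
  proof (cases "\<rho> (rank1 x y) \<zeta> = 0")
    case False
    from exists_intertwiner[OF L \<rho> False]
    obtain V where V: "\<And>u v. V (u + v) = V u + V v" "\<And>c u. V (c *\<^sub>C u) = c *\<^sub>C V u"
      "\<And>u v. cinner (V u) (V v) = cinner u v" "\<And>u. V u \<in> L"
      and inter: "\<And>b u. b \<in> cstar S \<Longrightarrow> V (blinfun_apply b u) = \<rho> b (V u)"
      and in_range: "\<rho> (rank1 x y) \<zeta> \<in> range V"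
      by blast
    have M: "closed_csubspace (range V)" by (rule isometric_range_closed[OF V(1-3)])
    have subM: "csubspace (range V)" using M by (simp add: closed_csubspace_def)
    have "unit_op (range V) \<in> commutant L ?X"
      by (rule invariant_projection_commutant[OF L M _ X(2,3)])
          (use V(4) in \<open>auto simp flip: inter\<close>)
    then have comm: "\<psi> a (unit_op (range V) z) = unit_op (range V) (\<psi> a z)" for z
      using commutantD[OF \<psi>N[OF a]] by blast
    have form: "cinner (V v) (\<psi> a (V w)) = cinner v (a w)" for v w
    proof -
      have "((\<lambda>_::nat. cinner (V v) (\<psi> a (V w))) \<longlongrightarrow> cinner v (a w)) sequentially"
      proof (rule compression_converges[OF L Nb always_eventually V(1-4) _ a])
        show "\<forall>i::nat. ucp (cstar S) L ?N \<psi>" using u by simp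
        fix s v w assume s: "s \<in> S"
        then show "((\<lambda>_::nat. cinner (V v) (\<psi> s (V w))) \<longlongrightarrow> cinner v (s w)) sequentially"
          using ext SA inter[of s w, symmetric] by (auto simp: V(3))
      qed
      then show ?thesis using LIMSEQ_const_iff by blast
    qed
    have "D a (V w) = 0" for w
    proof -
      have "\<psi> a (V w) \<in> range V"
        using comm[of "V w"] unit_op(2)[OF M rangeI] bop_range[OF unit_op(1)[OF M]] by metis
      moreover have "\<rho> a (V w) \<in> range V" using inter[OF a] by (metis rangeI)
      ultimately have "D a (V w) \<in> range V" unfolding D_def blinfun.diff_left
        by (rule csubspace_diff[OF subM])
      then obtain v where v: "D a (V w) = V v" by blast
      have "cinner (V v) (D a (V w)) = 0"
        by (simp add: D_def blinfun.diff_left cinner_diff form V(3) flip: inter[OF a])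
      then show ?thesis by (simp add: v[symmetric])
    qed
    then show ?thesis using in_range by auto
  qed simp
  \<comment> \<open>Passing to adjoints, the range of \<open>D a\<close> lies in the orthogonal complement \<open>M\<close> of that
    subspace.\<close>
  have Dk: "\<rho> k (D a z) = 0" if a: "a \<in> cstar S" and k: "k \<in> compact_ops" for a k z
  proof -
    have "id_blinfun o\<^sub>L \<rho> k o\<^sub>L D a = 0"
    proof (rule rep_compact_zero[OF L \<rho> _ k], rule blinfun_eqI)
      fix v w z
      have "\<rho> (rank1 v w) (D a z) = 0"
      proof (rule cinner_ext)
        fix y
        have "cinner y (\<rho> (rank1 v w) (D a z)) = cinner (D (adj a) (\<rho> (rank1 w v) y)) z"
          using RD(4)[OF rank1_cstar, of w v]
          by (simp add: adj_rank1 Dadj[OF a] cinner_adj[OF DU[OF a]]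
              cinner_adj[OF \<rho>U[OF rank1_cstar]])
        then show "cinner y (\<rho> (rank1 v w) (D a z)) = cinner y 0" using Dr[OF AD(5)[OF a]] by simp
      qed
      then show "(id_blinfun o\<^sub>L \<rho> (rank1 v w) o\<^sub>L D a) z = blinfun_apply 0 z" by simp
    qed
    from arg_cong[OF this, of "\<lambda>T. blinfun_apply T z"] show ?thesis by simp
  qed
  define M where "M = {\<eta>\<in>L. \<forall>k\<in>compact_ops. \<rho> k \<eta> = 0}"
  have kA: "k \<in> cstar S" if "k \<in> compact_ops" for k using that compact_sub by blast
  have M: "closed_csubspace M"
  proof -
    have "M = L \<inter> (\<Inter>k\<in>compact_ops. {\<eta>. \<rho> k \<eta> = 0})" by (auto simp: M_def)
    moreover have "closed {\<eta>. \<rho> k \<eta> = 0}" for k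
      by (intro closed_Collect_eq linear_continuous_on blinfun.bounded_linear_right
          continuous_intros)
    ultimately have "closed M" using L by (auto simp: closed_csubspace_def)
    moreover have "csubspace M"
      using csubspaceD[OF subL] bop_scaleC[OF \<rho>U[OF kA]]
      by (auto simp: csubspace_def M_def blinfun.zero_right blinfun.add_right)
    ultimately show ?thesis by (simp add: closed_csubspace_def)
  qed
  let ?q = "unit_op M"
  have qM: "?q z \<in> M" for z by (rule bop_range[OF unit_op(1)[OF M]])
  have M_sub: "M \<subseteq> L" by (auto simp: M_def)
  have qC: "?q \<in> commutant L ?X"
  proof (rule invariant_projection_commutant[OF L M M_sub X(2,3)])
    fix R z assume "R \<in> ?X" and z: "z \<in> M"
    then obtain b where b: "b \<in> cstar S" "R = \<rho> b" by blast
    have "\<rho> k (\<rho> b z) = 0" if k: "k \<in> compact_ops" for k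
    proof -
      have "\<rho> (k o\<^sub>L b) z = 0" using z compact_compose_right[OF AD(1)[OF b(1)] k]
        by (auto simp: M_def)
      then show ?thesis by (simp add: RD(3)[OF kA[OF k] b(1)])
    qed
    then show "R z \<in> M" using bop_range[OF RD(1)[OF b(1)]] b(2) by (simp add: M_def)
  qed
  have Nq: "T (?q z) = ?q (T z)" if "T \<in> ?N" for T z using commutantD[OF that qC] .
  \<comment> \<open>The range of \<open>\<rho>\<close> is commutative on \<open>M\<close>, hence its bicommutant is, in two steps: \<open>\<rho> b o\<^sub>L ?q\<close>
    belongs to the commutant, therefore so does \<open>R o\<^sub>L ?q\<close> for \<open>R\<close> in the bicommutant.\<close>
  have \<rho>q: "\<rho> b o\<^sub>L ?q \<in> commutant L ?X" if b: "b \<in> cstar S" for b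
  proof (rule commutantI)
    show "\<rho> b o\<^sub>L ?q \<in> bop L"
      using RD(1)[OF b] commutant_bop[OF qC] by (auto simp: bop_def blinfun.zero_right)
    fix R z assume "R \<in> ?X"
    then obtain c where c: "c \<in> cstar S" "R = \<rho> c" by blast
    have cb: "b o\<^sub>L c \<in> cstar S" "c o\<^sub>L b \<in> cstar S" using b c AD(4) by auto
    have "\<rho> ((b o\<^sub>L c) - (c o\<^sub>L b)) (?q z) = 0"
      using qM[of z] commutator_compact[OF b c(1)] by (simp add: M_def)
    then have "\<rho> b (\<rho> c (?q z)) = \<rho> c (\<rho> b (?q z))"
      by (simp add: RD(7)[OF cb] RD(3)[OF b c(1)] RD(3)[OF c(1) b] blinfun.diff_left)
    then show "(\<rho> b o\<^sub>L ?q) (R z) = R ((\<rho> b o\<^sub>L ?q) z)"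
      using commutantD[OF qC, of R z] c by simp
  qed
  have Ncomm: "T (R z) = R (T z)" if T: "T \<in> ?N" and R: "R \<in> ?N" and z: "z \<in> M" for T R z
  proof -
    have "R o\<^sub>L ?q \<in> commutant L ?X"
    proof (rule commutantI)
      show "R o\<^sub>L ?q \<in> bop L"
        using commutant_bop[OF R] commutant_bop[OF qC] by (auto simp: bop_def blinfun.zero_right)
      fix Y z assume "Y \<in> ?X"
      then obtain b where b: "b \<in> cstar S" "Y = \<rho> b" by blast
      have "R (?q (\<rho> b z)) = R (\<rho> b (?q z))" using commutantD[OF qC, of "\<rho> b" z] b by simp
      also have "\<dots> = \<rho> b (?q (R z))" using commutantD[OF R \<rho>q[OF b(1)], of z] by simp
      finally show "(R o\<^sub>L ?q) (Y z) = Y ((R o\<^sub>L ?q) z)" using b by (simp add: Nq[OF R])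
    qed
    from commutantD[OF T this, of z] show ?thesis
      by (simp add: unit_op(2)[OF M z] flip: Nq[OF T])
  qed
  have DM: "D a z \<in> M" if "a \<in> cstar S" for a z
    using Dk[OF that] bop_range[of "D a" L] DN[OF that] Nb by (auto simp: M_def)
  have sa: "D a = 0" if a: "a \<in> cstar S" "adj a = a" for a
  proof (rule ccontr)
    assume "D a \<noteq> 0"
    then obtain z where z: "D a z \<noteq> 0" by (metis blinfun_eqI zero_blinfun.rep_eq)
    have Dq: "D a (?q z) = D a z" using Nq[OF DN[OF a(1)], of z] unit_op(2)[OF M DM[OF a(1)]]
      by simp
    then have qz: "?q z \<noteq> 0" using z by (auto simp: blinfun.zero_right)
    define \<xi> where "\<xi> = ?q z /\<^sub>R norm (?q z)"
    have \<xi>: "norm \<xi> = 1" "D a \<xi> \<noteq> 0" using qz Dq z by (auto simp: \<xi>_def blinfun.scaleR_right)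
    have \<xi>M: "\<xi> \<in> M"
      using csubspaceD(3)[of M "?q z"] M qM by (auto simp: \<xi>_def closed_csubspace_def scaleR_scaleC)
    \<comment> \<open>The operators vanishing on \<open>M\<close> contain the commutators, and \<open>\<xi>\<close> is a vector of \<open>M\<close>.\<close>
    define J where "J = {T \<in> ?N. \<forall>\<eta>\<in>M. T \<eta> = 0}"
    have "\<exists>\<phi>. character_on ?N \<phi> \<and> (\<forall>T\<in>?N. positive_op T \<longrightarrow> \<phi> T \<in> \<real>\<^sub>\<ge>\<^sub>0)
        \<and> norm (D a \<xi>) \<le> cmod (\<phi> (D a))"
    proof (rule exists_character[OF Nsub NU Nadj Ncomp _ _ DN[OF a(1)]])
      show "J \<subseteq> ?N" by (auto simp: J_def)
      show "(T o\<^sub>L R) - (R o\<^sub>L T) \<in> J" if "T \<in> ?N" "R \<in> ?N" for T R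
        using Ncomm[OF that] csubspace_op_diff[OF Nsub Ncomp[OF that] Ncomp[OF that(2,1)]]
        by (simp add: J_def blinfun.diff_left)
      show "adj (D a) = D a" using Dadj[OF a(1)] a(2) by simp
      fix F :: "'l op set" and e :: real assume "F \<subseteq> J" "0 < e"
      then show "\<exists>\<xi>'. norm \<xi>' = 1 \<and> (\<forall>j\<in>F. norm (blinfun_apply j \<xi>') \<le> e)
          \<and> norm (D a \<xi>) \<le> norm (D a \<xi>')"
        using \<xi>(1) \<xi>M by (intro exI[of _ \<xi>]) (auto simp: J_def)
    qed
    then obtain \<phi> where \<phi>: "character_on ?N \<phi>" "\<And>T. T \<in> ?N \<Longrightarrow> positive_op T \<Longrightarrow> \<phi> T \<in> \<real>\<^sub>\<ge>\<^sub>0"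
      "norm (D a \<xi>) \<le> cmod (\<phi> (D a))" by blast
    have nz: "\<phi> (D a) \<noteq> 0" using \<phi>(3) \<xi>(2) by auto
    have unit: "\<phi> (unit_op L) = 1"
      by (rule character_on_unit[OF L Nb unit_op_commutant[OF L CX] \<phi>(1) DN[OF a(1)] nz])
    have "\<phi> (\<psi> a) = \<phi> (\<rho> a)"
      by (rule state_eq_character[OF state_on_compose_ucp[OF A L u order_refl Nb \<phi>(1,2) unit]
            character_on_compose_rep[OF A L \<rho> XN \<phi>(1)] _ _ a(1)])
        (use ext unit RD(2) in auto)
    moreover have "\<phi> (D a) = \<phi> (\<psi> a) - \<phi> (\<rho> a)"
      unfolding D_def by (rule character_on_diff[OF \<phi>(1) Nsub \<psi>N[OF a(1)]]) (use XN a in blast)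
    ultimately show False using nz by simp
  qed
  show "\<forall>a\<in>cstar S. \<psi> a = \<rho> a"
  proof
    fix a assume a: "a \<in> cstar S"
    obtain h k where hk: "h \<in> cstar S" "k \<in> cstar S" "adj h = h" "adj k = k" "a = h + \<i> *\<^sub>C k"
      using selfadjoint_decomposition[OF AD(2) _ AD(5) a] AD(1) by blast
    have "\<psi> h = \<rho> h" "\<psi> k = \<rho> k" using sa[of h] sa[of k] hk by (auto simp: D_def)
    moreover have "\<psi> (h + \<i> *\<^sub>C k) = \<psi> h + \<i> *\<^sub>C \<psi> k"
      using u hk(1,2) AD(9) by (simp add: ucp_def clinear_on_def)
    ultimately show "\<psi> a = \<rho> a" using hk(1,2) AD(9) by (simp add: hk(5) RD(5,6))
  qed
qed

section \<open>Strong rigidity modulo the compact operators\<close>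

text \<open>A self-adjoint element of the range of \<open>\<rho>\<close> at distance \<open>e\<close> from the image of the compact
  operators has norm at least \<open>e\<close> on the complement of every finite-rank projection. A suitable
  projection makes prescribed compact operators small there, and the range of \<open>\<rho>\<close> is commutative
  modulo the image of these, so a character detects the element.\<close>

lemma ucp_near_rep:
  fixes L :: "'l::chilbert_space set"
  assumes L: "closed_csubspace L" and \<rho>: "unital_star_rep (cstar S) L \<rho>"
    and a: "a \<in> cstar S" "adj a = a" and e: "0 < e"
  shows "\<exists>F \<eta>. finite F \<and> F \<subseteq> S \<and> 0 < \<eta> \<and>
    (\<forall>\<psi>. ucp (cstar S) L (\<rho> ` cstar S) \<psi> \<and> (\<forall>s\<in>F. norm (\<psi> s - \<rho> s) < \<eta>) \<longrightarrow>
       (\<exists>k\<in>compact_ops. norm (\<psi> a - \<rho> a - \<rho> k) < e))"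
proof -
  obtain F \<eta> where F: "finite F" "F \<subseteq> S" "0 < \<eta>"
    and near: "\<And>\<omega> \<phi>. state_on (cstar S) \<omega> \<Longrightarrow> character_on (cstar S) \<phi> \<Longrightarrow> \<phi> id_blinfun = 1 \<Longrightarrow>
       (\<And>s. s \<in> F \<Longrightarrow> cmod (\<omega> s - \<phi> s) < \<eta>) \<Longrightarrow> cmod (\<omega> a - \<phi> a) < e / 2"
    using state_near_character[OF a(1), of "e / 2"] e by (metis half_gt_zero)
  note RD = unital_star_repD[OF \<rho> A] and X = rep_range[OF L \<rho>]
  let ?X = "\<rho> ` cstar S"
  have XU: "?X \<subseteq> bop UNIV" using X(2) bop_subset_UNIV by blast
  have kA: "k \<in> cstar S" if "k \<in> compact_ops" for k using that compact_sub by blast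
  have main: "\<exists>k\<in>compact_ops. norm (\<psi> a - \<rho> a - \<rho> k) < e"
    if u: "ucp (cstar S) L ?X \<psi>" and close: "\<forall>s\<in>F. norm (\<psi> s - \<rho> s) < \<eta>" for \<psi>
  proof (rule ccontr)
    assume "\<not> ?thesis"
    then have far: "e \<le> norm (\<psi> a - \<rho> a - \<rho> k)" if "k \<in> compact_ops" for k using that
      by (auto simp: not_less)
    have \<psi>X: "\<psi> b \<in> ?X" if "b \<in> cstar S" for b using u that by (auto simp: ucp_def)
    obtain b where b: "b \<in> cstar S" "\<psi> a - \<rho> a = \<rho> b"
      using csubspace_op_diff[OF X(1) \<psi>X[OF a(1)], of "\<rho> a"] a(1) by blast
    have "adj (\<psi> a - \<rho> a) = adj (\<psi> a) - adj (\<rho> a)"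
      using \<psi>X[OF a(1)] a(1) XU by (intro adj_diff) auto
    then have sa: "adj (\<rho> b) = \<rho> b"
      using ucp_adj_norm(1)[OF A L u X(2) a(1)] RD(4)[OF a(1)] by (simp add: a(2) flip: b(2))
    have "\<exists>\<phi>. character_on ?X \<phi> \<and> (\<forall>T\<in>?X. positive_op T \<longrightarrow> \<phi> T \<in> \<real>\<^sub>\<ge>\<^sub>0) \<and> e / 2 \<le> cmod (\<phi> (\<rho> b))"
    proof (rule exists_character[OF X(1) XU X(3,4) _ _ _ sa])
      show "\<rho> ` compact_ops \<subseteq> ?X" using compact_sub by auto
      show "\<rho> b \<in> ?X" using b by blast
      show "(T o\<^sub>L R) - (R o\<^sub>L T) \<in> \<rho> ` compact_ops" if TR: "T \<in> ?X" "R \<in> ?X" for T R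
      proof -
        obtain c d where cd: "c \<in> cstar S" "d \<in> cstar S" "T = \<rho> c" "R = \<rho> d" using TR by blast
        have "(T o\<^sub>L R) - (R o\<^sub>L T) = \<rho> ((c o\<^sub>L d) - (d o\<^sub>L c))"
          using cd AD(4) by (simp add: RD(3,7))
        then show ?thesis using commutator_compact[OF cd(1,2)] by blast
      qed
      fix G :: "'l op set" and d :: real assume "finite G" "G \<subseteq> \<rho> ` compact_ops" and d: "0 < d"
      then obtain G' where G': "finite G'" "G' \<subseteq> compact_ops" "G = \<rho> ` G'"
        by (metis finite_subset_image)
      obtain Q where Q: "Q \<in> finite_rank" "is_projection Q" "\<And>k. k \<in> G' \<Longrightarrow> norm (k - (k o\<^sub>L Q)) \<le> d"
        using compact_finite_rank_approximation[OF G'(1,2) d] by blast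
      have QK: "Q \<in> compact_ops" by (rule finite_rank_compact[OF Q(1)])
      have QA: "Q \<in> cstar S" by (rule kA[OF QK])
      let ?R = "id_blinfun - Q"
      have RA: "?R \<in> cstar S" by (rule AD(8)[OF AD(3) QA])
      have RR: "?R o\<^sub>L ?R = ?R"
        by (rule blinfun_eqI) (simp add: blinfun.diff_left blinfun.diff_right
            is_projectionD[OF Q(2)])
      have R1: "norm ?R \<le> 1"
        by (rule norm_blinfun_bound) (simp_all add: blinfun.diff_left norm_projection[OF Q(2)])
      have bQ: "b o\<^sub>L Q \<in> compact_ops" by (rule compact_compose_left[OF AD(1)[OF b(1)] QK])
      have "e / 2 < norm (\<rho> b - \<rho> (b o\<^sub>L Q))" using far[OF bQ] e by (simp add: b(2))
      moreover have "\<rho> b - \<rho> (b o\<^sub>L Q) = \<rho> (b o\<^sub>L ?R)"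
      proof -
        have "b o\<^sub>L ?R = b - (b o\<^sub>L Q)"
          by (rule blinfun_eqI) (simp add: blinfun.diff_left blinfun.diff_right)
        then show ?thesis by (simp add: RD(7)[OF b(1) kA[OF bQ]])
      qed
      ultimately have "e / 2 < norm (\<rho> b o\<^sub>L \<rho> ?R)" by (simp add: RD(3)[OF b(1) RA])
      then obtain \<eta>0 where \<eta>0: "e / 2 * norm \<eta>0 < norm ((\<rho> b o\<^sub>L \<rho> ?R) \<eta>0)"
        using norm_blinfun_less[of "e / 2"] e by (metis half_gt_zero less_imp_le)
      define \<zeta> where "\<zeta> = \<rho> ?R \<eta>0"
      have b\<zeta>: "e / 2 * norm \<eta>0 < norm (\<rho> b \<zeta>)" using \<eta>0 by (simp add: \<zeta>_def)
      then have \<zeta>0: "\<zeta> \<noteq> 0" using e by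
          (auto simp: blinfun.zero_right mult_less_0_iff not_less[symmetric])
      have "norm \<zeta> \<le> norm (\<rho> ?R) * norm \<eta>0" unfolding \<zeta>_def by (rule norm_blinfun)
      also have "\<dots> \<le> 1 * norm \<eta>0"
        by (intro mult_right_mono order_trans[OF star_rep_contractive[OF A L \<rho> RA] R1]) simp
      finally have "e / 2 * norm \<zeta> \<le> e / 2 * norm \<eta>0" using e by (intro mult_left_mono) auto
      then have low: "e / 2 * norm \<zeta> \<le> norm (\<rho> b \<zeta>)" using b\<zeta> by linarith
      have up: "norm (\<rho> k \<zeta>) \<le> d * norm \<zeta>" if k: "k \<in> G'" for k
      proof -
        have kA': "k \<in> cstar S" using k G' kA by blast
        have kQ: "k o\<^sub>L Q \<in> cstar S" by (rule AD(4)[OF kA' QA])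
        have "\<zeta> = \<rho> ?R \<zeta>"
          using arg_cong[OF RD(3)[OF RA RA], of "\<lambda>T. blinfun_apply T \<eta>0"] by (simp add: RR \<zeta>_def)
        then have "\<rho> k \<zeta> = (\<rho> k o\<^sub>L \<rho> ?R) \<zeta>" by simp
        also have "\<rho> k o\<^sub>L \<rho> ?R = \<rho> (k - (k o\<^sub>L Q))"
        proof -
          have "k o\<^sub>L ?R = k - (k o\<^sub>L Q)"
            by (rule blinfun_eqI) (simp add: blinfun.diff_left blinfun.diff_right)
          then show ?thesis by (simp flip: RD(3)[OF kA' RA])
        qed
        finally have "norm (\<rho> k \<zeta>) \<le> norm (\<rho> (k - (k o\<^sub>L Q))) * norm \<zeta>" by (simp add: norm_blinfun)
        also have "\<dots> \<le> d * norm \<zeta>"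
          by (intro mult_right_mono order_trans[OF star_rep_contractive[OF A L \<rho> AD(8)[OF kA' kQ]]
              Q(3)[OF k]]) simp
        finally show ?thesis .
      qed
      show "\<exists>\<xi>. norm \<xi> = 1 \<and> (\<forall>j\<in>G. norm (blinfun_apply j \<xi>) \<le> d) \<and> e / 2 \<le> norm (\<rho> b \<xi>)"
      proof (intro exI[of _ "\<zeta> /\<^sub>R norm \<zeta>"] conjI ballI)
        show "norm (\<zeta> /\<^sub>R norm \<zeta>) = 1" using \<zeta>0 by simp
        show "norm (j (\<zeta> /\<^sub>R norm \<zeta>)) \<le> d" if "j \<in> G" for j
          using up \<zeta>0 that G'(3) by (auto simp: blinfun.scaleR_right divide_simps mult.commute)
        show "e / 2 \<le> norm (\<rho> b (\<zeta> /\<^sub>R norm \<zeta>))"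
          using low \<zeta>0 by (simp add: blinfun.scaleR_right divide_simps mult.commute)
      qed
    qed
    then obtain \<phi> where \<phi>: "character_on ?X \<phi>" "\<And>T. T \<in> ?X \<Longrightarrow> positive_op T \<Longrightarrow> \<phi> T \<in> \<real>\<^sub>\<ge>\<^sub>0"
      "e / 2 \<le> cmod (\<phi> (\<rho> b))" by blast
    have nz: "\<phi> (\<rho> b) \<noteq> 0" using \<phi>(3) e by auto
    have unit: "\<phi> (unit_op L) = 1"
      by (rule character_on_unit[OF L X(2,5) \<phi>(1) _ nz]) (use b in blast)
    have diff: "\<phi> (\<psi> c) - \<phi> (\<rho> c) = \<phi> (\<psi> c - \<rho> c)" if "c \<in> cstar S" for c
      by (rule character_on_diff[OF \<phi>(1) X(1) \<psi>X[OF that], symmetric]) (use that in blast)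
    have "cmod (\<phi> (\<psi> a) - \<phi> (\<rho> a)) < e / 2"
    proof (rule near[OF state_on_compose_ucp[OF A L u order_refl X(2) \<phi>(1,2) unit]
          character_on_compose_rep[OF A L \<rho> order_refl \<phi>(1)]])
      show "\<phi> (\<rho> id_blinfun) = 1" by (simp add: RD(2) unit)
      fix s assume s: "s \<in> F"
      then have sA: "s \<in> cstar S" using F(2) SA by blast
      have "\<psi> s - \<rho> s \<in> ?X" using csubspace_op_diff[OF X(1) \<psi>X[OF sA], of "\<rho> s"] sA by blast
      then have "cmod (\<phi> (\<psi> s - \<rho> s)) \<le> norm (\<psi> s - \<rho> s)"
        using \<phi>(1) unfolding character_on_def by blast
      then show "cmod (\<phi> (\<psi> s) - \<phi> (\<rho> s)) < \<eta>" using close s by (auto simp: diff[OF sA])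
    qed
    then show False using \<phi>(3) by (simp add: diff[OF a(1)] b(2))
  qed
  show ?thesis
  proof (rule exI[of _ F], rule exI[of _ \<eta>], intro conjI allI impI F, elim conjE)
    show "\<exists>k\<in>compact_ops. norm (\<psi> a - \<rho> a - \<rho> k) < e"
      if "ucp (cstar S) L ?X \<psi>" "\<forall>s\<in>F. norm (\<psi> s - \<rho> s) < \<eta>" for \<psi>
      by (rule main[OF that])
  qed
qed

end

lemma bounded_linear_scaleC_op:
  "bounded_linear (\<lambda>T :: 'a::real_normed_vector \<Rightarrow>\<^sub>L 'b::chilbert_space. c *\<^sub>C T)"
proof (rule bounded_linear_intro[where K = "cmod c"])
  fix r and T :: "'a \<Rightarrow>\<^sub>L 'b"
  show "c *\<^sub>C r *\<^sub>R T = r *\<^sub>R c *\<^sub>C T"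
    by (rule blinfun_eqI) (simp add: blinfun.scaleR_left scaleC.scaleR_right)
  show "norm (c *\<^sub>C T) \<le> norm T * cmod c" using norm_scaleC_op[of c T] by (simp add: mult.commute)
qed (rule scaleC_op_simps(1))

lemma eventually_tails_mem:
  assumes "directed_set I le"
  shows "eventually (\<lambda>i. i \<in> I) (tails I le)"
proof -
  obtain i where "i \<in> I" using assms unfolding directed_set_def by blast
  then show ?thesis unfolding eventually_tails[OF assms] by blast
qed

context boundary_system
begin

text \<open>If \<open>\<rho>\<close> annihilates the compact operators, nearness modulo their image is nearness in norm.\<close>

lemma strong_korovkin_rigidity:
  fixes L :: "'l::chilbert_space set"
  assumes L: "closed_csubspace L" and \<rho>: "unital_star_rep (cstar S) L \<rho>"
    and kills: "\<forall>k\<in>compact_ops. \<rho> k = 0"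
  shows "strongly_korovkin_rigid TYPE('i) S L \<rho>"
  unfolding strongly_korovkin_rigid_def
proof (intro allI impI ballI, elim conjE)
  fix I :: "'i set" and le and \<psi> :: "'i \<Rightarrow> 'h op \<Rightarrow> 'l op" and a
  assume dir: "directed_set I le" and u: "\<forall>i\<in>I. ucp (cstar S) L (\<rho> ` cstar S) (\<psi> i)"
    and lim: "\<forall>s\<in>S. ((\<lambda>i. \<psi> i s) \<longlongrightarrow> \<rho> s) (tails I le)" and a: "a \<in> cstar S"
  note RD = unital_star_repD[OF \<rho> A]
  have evI: "eventually (\<lambda>i. i \<in> I) (tails I le)" by (rule eventually_tails_mem[OF dir])
  have sa: "((\<lambda>i. \<psi> i h) \<longlongrightarrow> \<rho> h) (tails I le)" if h: "h \<in> cstar S" "adj h = h" for h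
  proof (rule tendstoI)
    fix e :: real assume e: "e > 0"
    obtain F \<eta> where F: "finite F" "F \<subseteq> S" "0 < \<eta>"
      and near: "\<And>\<psi>. ucp (cstar S) L (\<rho> ` cstar S) \<psi> \<Longrightarrow> \<forall>s\<in>F. norm (\<psi> s - \<rho> s) < \<eta> \<Longrightarrow>
         \<exists>k\<in>compact_ops. norm (\<psi> h - \<rho> h - \<rho> k) < e"
      using ucp_near_rep[OF L \<rho> h e] by blast
    have "eventually (\<lambda>i. norm (\<psi> i s - \<rho> s) < \<eta>) (tails I le)" if "s \<in> F" for s
      using tendstoD[OF bspec[OF lim] F(3)] that F(2) by (auto simp: dist_norm)
    then have "eventually (\<lambda>i. \<forall>s\<in>F. norm (\<psi> i s - \<rho> s) < \<eta>) (tails I le)"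
      by (intro eventually_ball_finite F) auto
    then show "eventually (\<lambda>i. dist (\<psi> i h) (\<rho> h) < e) (tails I le)"
      using evI
    proof eventually_elim
      case (elim i)
      then obtain k where "k \<in> compact_ops" "norm (\<psi> i h - \<rho> h - \<rho> k) < e" using near u by blast
      then show ?case using kills by (simp add: dist_norm)
    qed
  qed
  obtain h k where hk: "h \<in> cstar S" "k \<in> cstar S" "adj h = h" "adj k = k" "a = h + \<i> *\<^sub>C k"
    using selfadjoint_decomposition[OF AD(2) _ AD(5) a] AD(1) by blast
  have "((\<lambda>i. \<psi> i h + \<i> *\<^sub>C \<psi> i k) \<longlongrightarrow> \<rho> h + \<i> *\<^sub>C \<rho> k) (tails I le)"
    by (rule tendsto_add[OF sa[OF hk(1,3)]
          bounded_linear.tendsto[OF bounded_linear_scaleC_op sa[OF hk(2,4)]]])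
  moreover have "\<rho> h + \<i> *\<^sub>C \<rho> k = \<rho> a" using hk AD(9) by (simp add: RD)
  ultimately have "((\<lambda>i. \<psi> i h + \<i> *\<^sub>C \<psi> i k) \<longlongrightarrow> \<rho> a) (tails I le)" by simp
  then show "((\<lambda>i. \<psi> i a) \<longlongrightarrow> \<rho> a) (tails I le)"
    by (rule Lim_transform_eventually)
      (rule eventually_mono[OF evI], use u hk AD(9) in \<open>simp add: ucp_def clinear_on_def\<close>)
qed

end

section \<open>Rigidity in the weak topology\<close>

lemma ucp_convex_combination:
  assumes C: "csubspace C" and u: "ucp A E C \<phi>" "ucp A E C \<psi>" and A: "csubspace A"
    and t: "0 \<le> t" "t \<le> 1"
  shows "ucp A E C (\<lambda>a. (1 - t) *\<^sub>R \<phi> a + t *\<^sub>R \<psi> a)"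
  unfolding ucp_def clinear_on_def
proof (intro conjI ballI allI impI)
  note CD = csubspaceD[OF C]
  have \<phi>: "\<phi> a \<in> C" and \<psi>: "\<psi> a \<in> C" if "a \<in> A" for a using u that by (auto simp: ucp_def)
  show "(\<lambda>a. (1 - t) *\<^sub>R \<phi> a + t *\<^sub>R \<psi> a) ` A \<subseteq> C"
    using \<phi> \<psi> CD by (auto simp flip: scaleC_op_simps(9))
  show "(1 - t) *\<^sub>R \<phi> (a + b) + t *\<^sub>R \<psi> (a + b) =
      ((1 - t) *\<^sub>R \<phi> a + t *\<^sub>R \<psi> a) + ((1 - t) *\<^sub>R \<phi> b + t *\<^sub>R \<psi> b)" if "a \<in> A" "b \<in> A" for a b
    using u that by (simp add: ucp_def clinear_on_def scaleR_add_right)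
  show "(1 - t) *\<^sub>R \<phi> (c *\<^sub>C a) + t *\<^sub>R \<psi> (c *\<^sub>C a) = c *\<^sub>C ((1 - t) *\<^sub>R \<phi> a + t *\<^sub>R \<psi> a)"
      if "a \<in> A" for c a
    using u that
    by (simp add: ucp_def clinear_on_def scaleC_op_simps(1,4) mult.commute flip: scaleC_op_simps(9))
  show "(1 - t) *\<^sub>R \<phi> id_blinfun + t *\<^sub>R \<psi> id_blinfun = unit_op E"
    using u by (simp add: ucp_def flip: scaleR_add_left)
  fix n m assume m: "(\<forall>i<n. \<forall>j<n. m i j \<in> A) \<and> positive_matrix n m"
  have "positive_matrix n (\<lambda>i j. \<phi> (m i j))" "positive_matrix n (\<lambda>i j. \<psi> (m i j))"
    using u m by (simp_all add: ucp_def)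
  then have pos: "(\<Sum>i<n. \<Sum>j<n. cinner (x i) (\<phi> (m i j) (x j))) \<in> \<real>\<^sub>\<ge>\<^sub>0"
    "(\<Sum>i<n. \<Sum>j<n. cinner (x i) (\<psi> (m i j) (x j))) \<in> \<real>\<^sub>\<ge>\<^sub>0" for x
    unfolding positive_matrix_def by blast+
  have coeff: "complex_of_real (1 - t) \<in> \<real>\<^sub>\<ge>\<^sub>0" "complex_of_real t \<in> \<real>\<^sub>\<ge>\<^sub>0"
    using t by (subst nonneg_Reals_of_real_iff, simp)+
  show "positive_matrix n (\<lambda>i j. (1 - t) *\<^sub>R \<phi> (m i j) + t *\<^sub>R \<psi> (m i j))"
    unfolding positive_matrix_def
  proof
    fix x
    have "(\<Sum>i<n. \<Sum>j<n. cinner (x i) (((1 - t) *\<^sub>R \<phi> (m i j) + t *\<^sub>R \<psi> (m i j)) (x j))) =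
        of_real (1 - t) * (\<Sum>i<n. \<Sum>j<n. cinner (x i) (\<phi> (m i j) (x j))) +
        of_real t * (\<Sum>i<n. \<Sum>j<n. cinner (x i) (\<psi> (m i j) (x j)))"
      by (simp only: blinfun.add_left blinfun.scaleR_left cinner_add_right cinner_scaleR_right
          scaleR_conv_of_real sum.distrib sum_distrib_left)
    also have "\<dots> \<in> \<real>\<^sub>\<ge>\<^sub>0"
      by (intro nonneg_Reals_add_I nonneg_Reals_mult_I pos coeff)
    finally show "(\<Sum>i<n. \<Sum>j<n. cinner (x i) (((1 - t) *\<^sub>R \<phi> (m i j) + t *\<^sub>R \<psi> (m i j)) (x j)))
        \<in> \<real>\<^sub>\<ge>\<^sub>0" .
  qed
qed

lemma bounded_functional_onD:
  fixes V :: "'a::chilbert_space op set"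
  assumes f: "bounded_functional_on V f" and V: "csubspace V"
  shows "x \<in> V \<Longrightarrow> y \<in> V \<Longrightarrow> f (x + y) = f x + f y" "x \<in> V \<Longrightarrow> f (c *\<^sub>C x) = c * f x"
    "x \<in> V \<Longrightarrow> y \<in> V \<Longrightarrow> f (x - y) = f x - f y" "f 0 = 0"
    "\<exists>K>0. \<forall>x\<in>V. cmod (f x) \<le> K * norm x"
proof -
  show 1: "x \<in> V \<Longrightarrow> y \<in> V \<Longrightarrow> f (x + y) = f x + f y"
    and 2: "x \<in> V \<Longrightarrow> f (c *\<^sub>C x) = c * f x" for x y c
    using f by (auto simp: bounded_functional_on_def clinear_on_def scaleC_complex_def)
  show "f (x - y) = f x - f y" if "x \<in> V" "y \<in> V"
    using 1[OF that(1) csubspaceD(3)[OF V that(2), of "-1"]] 2[OF that(2), of "-1"]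
    by (simp add: scaleC_op_simps)
  show "f 0 = 0" using 2[OF csubspaceD(1)[OF V], of 0] by (simp add: scaleC_op_simps)
  obtain K where K: "\<forall>x\<in>V. cmod (f x) \<le> K * norm x" using f
    by (auto simp: bounded_functional_on_def)
  show "\<exists>K>0. \<forall>x\<in>V. cmod (f x) \<le> K * norm x"
  proof (intro exI[of _ "max K 1"] conjI ballI)
    fix x assume "x \<in> V"
    then have "cmod (f x) \<le> K * norm x" using K by blast
    also have "\<dots> \<le> max K 1 * norm x" by (intro mult_right_mono) auto
    finally show "cmod (f x) \<le> max K 1 * norm x" .
  qed simp
qed

lemma unit_phase: "\<exists>u. cmod u = 1 \<and> u * z = complex_of_real (cmod z)"
proof (cases "z = 0")
  case False
  then show ?thesis
    by (intro exI[of _ "cnj z / complex_of_real (cmod z)"])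
      (simp add: norm_divide complex_norm_square[symmetric] mult.commute power2_eq_square)
qed (auto intro: exI[of _ 1])

lemma half_cmod_le_part:
  assumes "d \<le> cmod z"
  shows "\<exists>u\<in>{1, -1, \<i>, -\<i>}. d / 2 \<le> Re (u * z)"
proof -
  have "d \<le> \<bar>Re z\<bar> + \<bar>Im z\<bar>" using assms cmod_le[of z] by linarith
  then have "d / 2 \<le> Re z \<or> d / 2 \<le> - Re z \<or> d / 2 \<le> - Im z \<or> d / 2 \<le> Im z" by linarith
  then show ?thesis by auto
qed

context boundary_system
begin

text \<open>Choose \<open>y\<^sub>0\<close> in the image of the compact operators at which \<open>f\<close> nearly attains its norm
  there, and a finite-rank projection \<open>Q\<close> nearly fixing \<open>y\<^sub>0\<close>. By orthogonality \<open>Q y\<^sub>0 + t (1 - Q)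
  y\<close> has norm at most \<open>sqrt (1 + t\<^sup>2)\<close>, a gain of second order in \<open>t\<close> only, so \<open>f((1 - Q) y)\<close> must
  be small.\<close>

lemma functional_nearly_vanishes_on_compacts:
  fixes L :: "'l::chilbert_space set"
  assumes L: "closed_csubspace L" and \<rho>: "unital_star_rep (cstar S) L \<rho>"
    and f: "bounded_functional_on (\<rho> ` cstar S) f" and e: "0 < e"
  shows "\<exists>Q\<in>finite_rank. is_projection Q \<and>
    (\<forall>y\<in>\<rho> ` compact_ops. cmod (f (y - (\<rho> Q o\<^sub>L y))) \<le> e * norm y)"
proof -
  note RD = unital_star_repD[OF \<rho> A] and X = rep_range[OF L \<rho>]
  note fD = bounded_functional_onD[OF f X(1)]
  let ?X = "\<rho> ` cstar S" and ?Y = "\<rho> ` compact_ops"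
  have kA: "k \<in> cstar S" if "k \<in> compact_ops" for k using that compact_sub by blast
  have YX: "y \<in> ?X" if "y \<in> ?Y" for y using that kA by blast
  have Y0: "0 \<in> ?Y" using csubspaceD(1)[OF csubspace_compact_ops] RD(8) by (metis imageI)
  have Yadd: "y + z \<in> ?Y" if "y \<in> ?Y" "z \<in> ?Y" for y z
    using that csubspaceD(2)[OF csubspace_compact_ops] kA by (auto intro!: imageI simp flip: RD(5))
  have Yscale: "c *\<^sub>C y \<in> ?Y" if "y \<in> ?Y" for c y
    using that csubspaceD(3)[OF csubspace_compact_ops] kA by (auto intro!: imageI simp flip: RD(6))
  have Yleft: "\<rho> b o\<^sub>L y \<in> ?Y" if "b \<in> cstar S" "y \<in> ?Y" for b y
    using that compact_compose_left[OF AD(1)[OF that(1)]] kA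
        by (auto intro!: imageI simp flip: RD(3))
  obtain \<kappa> where \<kappa>: "\<kappa> > 0" "\<And>x. x \<in> ?X \<Longrightarrow> cmod (f x) \<le> \<kappa> * norm x" using fD(5) by blast
  define V where "V = {cmod (f y) | y. y \<in> ?Y \<and> norm y \<le> 1}"
  have Vbd: "v \<le> \<kappa>" if v: "v \<in> V" for v
  proof -
    obtain y where y: "v = cmod (f y)" "y \<in> ?Y" "norm y \<le> 1" using v by (auto simp: V_def)
    have "cmod (f y) \<le> \<kappa> * norm y" by (rule \<kappa>(2)[OF YX[OF y(2)]])
    also have "\<dots> \<le> \<kappa>" using \<kappa>(1) y(3) by (simp add: mult_left_le)
    finally show ?thesis using y(1) by simp
  qed
  have V0: "0 \<in> V" using Y0 fD(4) by (force simp: V_def)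
  define n where "n = Sup V"
  have bdd: "bdd_above V" using Vbd by (rule bdd_aboveI)
  have n0: "0 \<le> n" unfolding n_def by (rule cSup_upper[OF V0 bdd])
  have fn: "cmod (f y) \<le> n * norm y" if y: "y \<in> ?Y" for y
  proof (cases "y = 0")
    case False
    define z where "z = complex_of_real (inverse (norm y)) *\<^sub>C y"
    have "z = inverse (norm y) *\<^sub>R y" unfolding z_def by (rule scaleC_op_simps(9))
    then have z1: "norm z \<le> 1" using False by simp
    have zY: "z \<in> ?Y" unfolding z_def by (rule Yscale[OF y])
    note z = zY z1
    then have "cmod (f z) \<le> n" unfolding n_def by (intro cSup_upper[OF _ bdd]) (auto simp: V_def)
    moreover have "cmod (f z) = inverse (norm y) * cmod (f y)"
      by (simp add: z_def fD(2)[OF YX[OF y]] norm_mult norm_inverse)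
    ultimately show ?thesis using False by (simp add: field_simps)
  qed (simp add: fD(4))
  \<comment> \<open>With this \<open>t\<close> the second order gain \<open>n t\<^sup>2 / 2\<close> is at most \<open>t e / 2\<close>. The choices of \<open>y0\<close> and
    \<open>Q\<close> cost \<open>t e / 4\<close> each, which leaves \<open>t |f z| \<le> t e\<close> in the end.\<close>
  define t where "t = e / (n + 1)"
  have t: "t > 0" "n * t \<le> e" using e n0 by (simp_all add: t_def field_simps)
  obtain y0 where y0: "y0 \<in> ?Y" "norm y0 \<le> 1" "n - t * e / 4 < cmod (f y0)"
  proof -
    have "n - t * e / 4 < Sup V" using t e by (simp add: n_def)
    then obtain v where v: "v \<in> V" "n - t * e / 4 < v" using less_cSup_iff[OF _ bdd] V0 by blast
    then show thesis using that by (auto simp: V_def)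
  qed
  obtain k0 where k0: "k0 \<in> compact_ops" "y0 = \<rho> k0" using y0(1) by blast
  obtain Q where Q: "Q \<in> finite_rank" "is_projection Q" "norm (k0 - (Q o\<^sub>L k0)) \<le> t * e / (4 * \<kappa>)"
    using compact_finite_rank_approximation[of "{k0}" "t * e / (4 * \<kappa>)"] k0(1) t e \<kappa>(1) by auto
  have QA: "Q \<in> cstar S" by (rule kA[OF finite_rank_compact[OF Q(1)]])
  let ?q = "\<rho> Q"
  have q: "is_projection ?q"
    using Q(2) RD(1)[OF QA] RD(3)[OF QA QA] RD(4)[OF QA] bop_subset_UNIV
        by (auto simp: is_projection_def)
  have Qk0: "Q o\<^sub>L k0 \<in> cstar S" using AD(4)[OF QA kA[OF k0(1)]] .
  have fq: "n - t * e / 2 \<le> cmod (f (?q o\<^sub>L y0))"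
  proof -
    have "y0 - (?q o\<^sub>L y0) = \<rho> (k0 - (Q o\<^sub>L k0))"
      by (simp add: k0(2) RD(7)[OF kA[OF k0(1)] Qk0] RD(3)[OF QA kA[OF k0(1)]])
    then have "norm (y0 - (?q o\<^sub>L y0)) \<le> t * e / (4 * \<kappa>)"
      using order_trans[OF star_rep_contractive[OF A L \<rho> AD(8)[OF kA[OF k0(1)] Qk0]] Q(3)] by simp
    then have "\<kappa> * norm (y0 - (?q o\<^sub>L y0)) \<le> t * e / 4"
      using \<kappa>(1) by (simp add: field_simps)
    moreover have "cmod (f (y0 - (?q o\<^sub>L y0))) \<le> \<kappa> * norm (y0 - (?q o\<^sub>L y0))"
      by (rule \<kappa>(2)) (use csubspace_op_diff[OF X(1) YX YX] y0(1) Yleft[OF QA] in blast)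
    then have "cmod (f y0 - f (?q o\<^sub>L y0)) \<le> \<kappa> * norm (y0 - (?q o\<^sub>L y0))"
      using fD(3)[OF YX[OF y0(1)] YX[OF Yleft[OF QA y0(1)]]] by simp
    moreover have "cmod (f y0) \<le> cmod (f y0 - f (?q o\<^sub>L y0)) + cmod (f (?q o\<^sub>L y0))"
      using norm_triangle_ineq[of "f y0 - f (?q o\<^sub>L y0)" "f (?q o\<^sub>L y0)"] by simp
    ultimately show ?thesis using y0(3) by linarith
  qed
  have small: "cmod (f (y - (?q o\<^sub>L y))) \<le> e" if y: "y \<in> ?Y" "norm y \<le> 1" for y
  proof -
    define z where "z = y - (?q o\<^sub>L y)"
    have zY: "z \<in> ?Y"
      using Yadd[OF y(1) Yscale[OF Yleft[OF QA y(1)], of "-1"]] by (simp add: z_def scaleC_op_simps)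
    have qyY: "?q o\<^sub>L y0 \<in> ?Y" by (rule Yleft[OF QA y0(1)])
    obtain \<alpha> where \<alpha>: "cmod \<alpha> = 1" "\<alpha> * f (?q o\<^sub>L y0) = of_real (cmod (f (?q o\<^sub>L y0)))"
      using unit_phase by blast
    obtain \<beta> where \<beta>: "cmod \<beta> = 1" "\<beta> * f z = of_real (cmod (f z))" using unit_phase by blast
    \<comment> \<open>The phases \<open>\<alpha>\<close> and \<open>\<beta>\<close> prevent cancellation in \<open>f W\<close>.\<close>
    define W where "W = \<alpha> *\<^sub>C (?q o\<^sub>L y0) + (of_real t * \<beta>) *\<^sub>C z"
    have WY: "W \<in> ?Y" unfolding W_def by (intro Yadd Yscale qyY zY)
    have fW: "f W = of_real (cmod (f (?q o\<^sub>L y0)) + t * cmod (f z))"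
      unfolding W_def using fD(1)[OF YX[OF Yscale[OF qyY]] YX[OF Yscale[OF zY]]]
      by (simp add: fD(2)[OF YX[OF qyY]] fD(2)[OF YX[OF zY]] \<alpha> mult.assoc \<beta>)
    have "norm W \<le> sqrt (1 + t\<^sup>2)"
    proof (rule norm_blinfun_bound)
      fix x
      let ?a = "\<alpha> *\<^sub>C ?q (y0 x)" and ?b = "(of_real t * \<beta>) *\<^sub>C (y x - ?q (y x))"
      have "cinner ?a ?b = 0"
        by (simp add: cinner_scaleC_left cinner_scaleC_right is_projectionD[OF q]
            blinfun.diff_right)
      then have "(norm (?a + ?b))\<^sup>2 = (norm (?q (y0 x)))\<^sup>2 + t\<^sup>2 * (norm (y x - ?q (y x)))\<^sup>2"
        by (simp add: norm_add_sq norm_scaleC \<alpha> norm_mult \<beta> power_mult_distrib)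
      also have "\<dots> \<le> (norm x)\<^sup>2 + t\<^sup>2 * (norm x)\<^sup>2"
      proof (intro add_mono mult_left_mono power_mono)
        have 1: "norm (y0 x) \<le> norm x" "norm (y x) \<le> norm x"
          using norm_blinfun[of y0 x] norm_blinfun[of y x] y0(2) y(2)
          by (meson mult_left_le_one_le norm_ge_zero order_trans)+
        show "norm (?q (y0 x)) \<le> norm x" "norm (y x - ?q (y x)) \<le> norm x"
          using norm_projection[OF q] 1 order_trans by blast+
      qed auto
      also have "\<dots> = (1 + t\<^sup>2) * (norm x)\<^sup>2" by (simp add: algebra_simps)
      finally have "norm (?a + ?b) \<le> sqrt ((1 + t\<^sup>2) * (norm x)\<^sup>2)" by (rule real_le_rsqrt)
      then show "norm (W x) \<le> sqrt (1 + t\<^sup>2) * norm x"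
        by (simp add: W_def z_def blinfun.add_left blinfun.diff_left real_sqrt_mult)
    qed simp
    also have "sqrt (1 + t\<^sup>2) \<le> 1 + t\<^sup>2 / 2"
      using t(1) by (intro real_le_lsqrt) (auto simp: power2_eq_square algebra_simps)
    finally have "n * norm W \<le> n * (1 + t\<^sup>2 / 2)" using n0 by (intro mult_left_mono)
    moreover have "cmod (f W) = cmod (f (?q o\<^sub>L y0)) + t * cmod (f z)"
      unfolding fW by (subst norm_of_real) (use t in simp)
    moreover have "n * (1 + t\<^sup>2 / 2) \<le> n + t * e / 2"
      using mult_right_mono[OF t(2), of t] t(1) by (simp add: power2_eq_square algebra_simps)
    ultimately have "t * cmod (f z) \<le> t * e" using fn[OF WY] fq by linarith
    then show ?thesis using t(1) by (simp add: z_def)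
  qed
  have "cmod (f (y - (?q o\<^sub>L y))) \<le> e * norm y" if y: "y \<in> ?Y" for y
  proof (cases "y = 0")
    case False
    define z where "z = complex_of_real (inverse (norm y)) *\<^sub>C y"
    have "z = inverse (norm y) *\<^sub>R y" unfolding z_def by (rule scaleC_op_simps(9))
    then have z1: "norm z \<le> 1" using False by simp
    have zY: "z \<in> ?Y" unfolding z_def by (rule Yscale[OF y])
    note z = zY z1
    have "z - (?q o\<^sub>L z) = complex_of_real (inverse (norm y)) *\<^sub>C (y - (?q o\<^sub>L y))"
      unfolding z_def by (subst compose_scaleC(2)[OF is_projectionD(1)[OF q]])
          (simp only: scaleC_op_simps(2))
    moreover have "y - (?q o\<^sub>L y) \<in> ?X"
      using csubspace_op_diff[OF X(1) YX[OF y] YX[OF Yleft[OF QA y]]] .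
    ultimately have "cmod (f (z - (?q o\<^sub>L z))) = inverse (norm y) * cmod (f (y - (?q o\<^sub>L y)))"
      by (simp add: fD(2) norm_mult norm_inverse)
    then have "cmod (f (y - (?q o\<^sub>L y))) = norm y * cmod (f (z - (?q o\<^sub>L z)))"
      using False by (simp add: field_simps)
    also have "\<dots> \<le> norm y * e" using small[OF z] by (intro mult_left_mono) auto
    finally show ?thesis by (simp add: mult.commute)
  next
    case True
    have "0 - (?q o\<^sub>L 0) = 0" by (rule blinfun_eqI) (simp add: blinfun.zero_right blinfun.diff_left)
    then show ?thesis using True fD(4) by simp
  qed
  then show ?thesis using Q by blast
qed

text \<open>By the Riesz theorem \<open>f(\<rho>(|u><v|) \<rho>(b)) = f(\<rho>(|u><b\<^sup>* v|))\<close> has the form \<open><v, b \<zeta>>\<close>, so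
  finite-rank multiples of a functional are controlled by the compression to \<open>H\<close>.\<close>

lemma finite_rank_functional_converges:
  fixes L :: "'l::chilbert_space set" and \<psi> :: "'i \<Rightarrow> 'h op \<Rightarrow> 'l op"
  assumes L: "closed_csubspace L" and \<rho>: "unital_star_rep (cstar S) L \<rho>"
    and u: "eventually (\<lambda>i. ucp (cstar S) L (\<rho> ` cstar S) (\<psi> i)) F"
    and weak: "\<And>s. s \<in> S \<Longrightarrow> weakly_tendsto_in (\<rho> ` cstar S) (\<lambda>i. \<psi> i s) (\<rho> s) F"
    and f: "bounded_functional_on (\<rho> ` cstar S) f" and a: "a \<in> cstar S" and q: "q \<in> finite_rank"
  shows "((\<lambda>i. f (\<rho> q o\<^sub>L \<psi> i a)) \<longlongrightarrow> f (\<rho> q o\<^sub>L \<rho> a)) F"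
proof -
  note RD = unital_star_repD[OF \<rho> A] and X = rep_range[OF L \<rho>]
  note fD = bounded_functional_onD[OF f X(1)]
  let ?X = "\<rho> ` cstar S"
  have \<rho>U: "\<rho> b \<in> bop UNIV" if "b \<in> cstar S" for b using RD(1)[OF that] by (rule bop_subset_UNIV)
  have evX: "eventually (\<lambda>i. \<psi> i a \<in> ?X) F"
    by (rule eventually_mono[OF u]) (use a in \<open>auto simp: ucp_def\<close>)
  obtain \<kappa> where \<kappa>: "\<kappa> > 0" "\<And>x. x \<in> ?X \<Longrightarrow> cmod (f x) \<le> \<kappa> * norm x" using fD(5) by blast
  have one: "((\<lambda>i. f (\<rho> (rank1 v w) o\<^sub>L \<psi> i a)) \<longlongrightarrow> f (\<rho> (rank1 v w) o\<^sub>L \<rho> a)) F" for v w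
  proof (cases "\<rho> (rank1 v w) = 0")
    case True
    have "0 o\<^sub>L T = 0" for T :: "'l op" by (rule blinfun_eqI) simp
    then show ?thesis by (simp add: True)
  next
    case False
    then obtain z where "\<rho> (rank1 v w) z \<noteq> 0" by (metis blinfun_eqI zero_blinfun.rep_eq)
    from exists_intertwiner[OF L \<rho> this]
    obtain V where V: "\<And>u v. V (u + v) = V u + V v" "\<And>c u. V (c *\<^sub>C u) = c *\<^sub>C V u"
      "\<And>u v. cinner (V u) (V v) = cinner u v" "\<And>u. V u \<in> L"
      and inter: "\<And>b u. b \<in> cstar S \<Longrightarrow> V (blinfun_apply b u) = \<rho> b (V u)" by blast
    have nV: "norm (V x) = norm x" for x by (rule norm_preserves_inner[OF V(3)])
    have "\<exists>\<zeta>. \<forall>y. cnj (f (\<rho> (rank1 v y))) = cinner \<zeta> y"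
    proof (rule riesz_representation)
      note r = rank1_cstar
      show "cnj (f (\<rho> (rank1 v (x + y)))) = cnj (f (\<rho> (rank1 v x))) + cnj (f (\<rho> (rank1 v y)))"
          for x y
        by (simp add: rank1_add_right RD(5)[OF r r] fD(1)[OF imageI[OF r] imageI[OF r]])
      show "cnj (f (\<rho> (rank1 v (c *\<^sub>C x)))) = c * cnj (f (\<rho> (rank1 v x)))" for c x
        by (simp add: rank1_scaleC_right RD(6)[OF r] fD(2)[OF imageI[OF r]])
      show "cmod (cnj (f (\<rho> (rank1 v x)))) \<le> (\<kappa> * norm v) * norm x" for x
      proof -
        have "cmod (f (\<rho> (rank1 v x))) \<le> \<kappa> * norm (\<rho> (rank1 v x))" by (rule \<kappa>(2)[OF imageI[OF r]])
        also have "\<dots> \<le> \<kappa> * (norm v * norm x)"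
          using \<kappa>(1) order_trans[OF star_rep_contractive[OF A L \<rho> r] norm_rank1]
              by (intro mult_left_mono) auto
        finally show ?thesis by (simp add: mult.assoc)
      qed
    qed
    then obtain \<zeta> where "\<And>y. cnj (f (\<rho> (rank1 v y))) = cinner \<zeta> y" by blast
    then have \<zeta>: "f (\<rho> (rank1 v y)) = cinner y \<zeta>" for y by (metis cinner_commute complex_cnj_cnj)
    have form: "f (\<rho> (rank1 v w) o\<^sub>L T) = cinner (V w) (T (V \<zeta>))" if T: "T \<in> ?X" for T
    proof -
      obtain b where b: "b \<in> cstar S" "T = \<rho> b" using T by blast
      have "f (\<rho> (rank1 v w) o\<^sub>L T) = f (\<rho> (rank1 v (adj b w)))"
        by (simp add: b(2) RD(3)[OF rank1_cstar b(1), symmetric] rank1_compose[OF AD(1)[OF b(1)]])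
      also have "\<dots> = cinner w (b \<zeta>)" by (simp add: \<zeta> cinner_adj[OF AD(1)[OF b(1)]])
      also have "\<dots> = cinner (V w) (T (V \<zeta>))" by (simp add: V(3) b flip: inter[OF b(1)])
      finally show ?thesis .
    qed
    have "((\<lambda>i. cinner (V w) (\<psi> i a (V \<zeta>))) \<longlongrightarrow> cinner w (a \<zeta>)) F"
    proof (rule compression_converges[OF L X(2) u V(1-4) _ a])
      fix s x y assume s: "s \<in> S"
      have "bounded_functional_on ?X (\<lambda>T. cinner (V x) (T (V y)))"
        unfolding bounded_functional_on_def clinear_on_def
      proof (intro conjI ballI allI exI[of _ "norm x * norm y"])
        fix T :: "'l op"
        have "cmod (cinner (V x) (T (V y))) \<le> norm (V x) * norm (T (V y))" by (rule cauchy_schwarz)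
        also have "\<dots> \<le> norm (V x) * (norm T * norm (V y))"
          by (intro mult_left_mono norm_blinfun) simp
        finally show "cmod (cinner (V x) (T (V y))) \<le> norm x * norm y * norm T"
          by (simp add: nV ac_simps)
      qed (simp_all add: blinfun.add_left cinner_add_right cinner_scaleC_right scaleC_complex_def)
      then have "((\<lambda>i. cinner (V x) (\<psi> i s (V y))) \<longlongrightarrow> cinner (V x) (\<rho> s (V y))) F"
        using weak[OF s] unfolding weakly_tendsto_in_def by blast
      moreover have "cinner (V x) (\<rho> s (V y)) = cinner x (s y)"
        using s SA by (subst inter[symmetric]) (auto simp: V(3))
      ultimately show "((\<lambda>i. cinner (V x) (\<psi> i s (V y))) \<longlongrightarrow> cinner x (s y)) F" by simp
    qed
    moreover have "cinner w (a \<zeta>) = f (\<rho> (rank1 v w) o\<^sub>L \<rho> a)"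
      using form[OF imageI[OF a]] by (simp add: V(3) flip: inter[OF a])
    ultimately have "((\<lambda>i. cinner (V w) (\<psi> i a (V \<zeta>))) \<longlongrightarrow> f (\<rho> (rank1 v w) o\<^sub>L \<rho> a)) F" by simp
    then show ?thesis
      by (rule Lim_transform_eventually) (rule eventually_mono[OF evX], simp add: form)
  qed
  have "q \<in> cstar S \<and> ((\<lambda>i. f (\<rho> q o\<^sub>L \<psi> i a)) \<longlongrightarrow> f (\<rho> q o\<^sub>L \<rho> a)) F"
    using q
  proof (induction rule: finite_rank.induct)
    case zero
    have "0 o\<^sub>L T = 0" for T :: "'l op" by (rule blinfun_eqI) simp
    then show ?case by (simp add: RD(8) AD(11))
  next
    case (add q v w)
    have split: "f (\<rho> (rank1 v w + q) o\<^sub>L T) = f (\<rho> (rank1 v w) o\<^sub>L T) + f (\<rho> q o\<^sub>L T)"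
        if "T \<in> ?X" for T
      using add.IH fD(1)[OF X(4)[OF imageI[OF rank1_cstar] that] X(4)[OF imageI that], of q v w]
      by (simp add: RD(5)[OF rank1_cstar] compose_add)
    have "((\<lambda>i. f (\<rho> (rank1 v w) o\<^sub>L \<psi> i a) + f (\<rho> q o\<^sub>L \<psi> i a)) \<longlongrightarrow> f (\<rho> (rank1 v w + q) o\<^sub>L \<rho> a)) F"
      unfolding split[OF imageI[OF a]] using add.IH by (intro tendsto_add one) auto
    then have "((\<lambda>i. f (\<rho> (rank1 v w + q) o\<^sub>L \<psi> i a)) \<longlongrightarrow> f (\<rho> (rank1 v w + q) o\<^sub>L \<rho> a)) F"
      by (rule Lim_transform_eventually) (rule eventually_mono[OF evX], simp add: split)
    then show ?case using add.IH AD(7)[OF rank1_cstar] by blast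
  qed
  then show ?thesis by blast
qed

text \<open>This is Mazur's theorem for maps: the weak closure of the convex set \<open>\<C>\<close> contains \<open>\<rho>\<close>, and if
  no member of \<open>\<C>\<close> were close to \<open>\<rho>\<close> in norm on the finite set, functionals on the tuples of
  values would separate them.\<close>

lemma norm_close_on_finite_set:
  fixes L :: "'l::chilbert_space set" and \<psi> :: "'i \<Rightarrow> 'h op \<Rightarrow> 'l op" and \<C> :: "('h op \<Rightarrow> 'l op) set"
  assumes conv: "\<And>\<phi> \<psi> t. \<phi> \<in> \<C> \<Longrightarrow> \<psi> \<in> \<C> \<Longrightarrow> 0 \<le> t \<Longrightarrow> t \<le> 1 \<Longrightarrow> (\<lambda>a. (1 - t) *\<^sub>R \<phi> a + t *\<^sub>R \<psi> a) \<in> \<C>"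
    and freq: "frequently (\<lambda>i. \<psi> i \<in> \<C>) F"
    and val: "\<And>\<phi> s. \<phi> \<in> \<C> \<Longrightarrow> s \<in> G \<Longrightarrow> \<phi> s \<in> V" "\<And>s. s \<in> G \<Longrightarrow> \<rho> s \<in> V"
    and weak: "\<And>s. s \<in> G \<Longrightarrow> weakly_tendsto_in V (\<lambda>i. \<psi> i s) (\<rho> s) F"
    and G: "finite G" and \<eta>: "0 < \<eta>"
  shows "\<exists>\<phi>\<in>\<C>. \<forall>s\<in>G. norm (\<phi> s - \<rho> s) < \<eta>"
proof (rule ccontr)
  assume neg: "\<not> ?thesis"
  obtain g where g: "bij_betw g {..<card G} G"
    using ex_bij_betw_nat_finite[OF G] by (auto simp: atLeast0LessThan)
  then have gG: "g j \<in> G" if "j < card G" for j using that by (auto simp: bij_betw_def)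
  define T where "T \<phi> j = \<phi> (g j) - \<rho> (g j)" for \<phi> :: "'h op \<Rightarrow> 'l op" and j
  have "\<exists>l. (\<forall>j. linear (l j) \<and> (\<forall>x. \<bar>l j x\<bar> \<le> norm x)) \<and> (\<forall>f\<in>T ` \<C>. \<eta> \<le> (\<Sum>j<card G. l j (f j)))"
  proof (rule separate_convex_tuples)
    have "\<exists>i. \<psi> i \<in> \<C>" using frequently_ex[OF freq] .
    then show "T ` \<C> \<noteq> {}" by blast
    fix f h and t :: real assume "f \<in> T ` \<C>" "h \<in> T ` \<C>" and t: "0 \<le> t" "t \<le> 1"
    then obtain \<phi> \<phi>' where \<phi>: "\<phi> \<in> \<C>" "f = T \<phi>" "\<phi>' \<in> \<C>" "h = T \<phi>'" by blast
    have "(\<lambda>j. (1 - t) *\<^sub>R f j + t *\<^sub>R h j) = T (\<lambda>a. (1 - t) *\<^sub>R \<phi> a + t *\<^sub>R \<phi>' a)"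
      by (rule ext) (simp add: \<phi>(2,4) T_def algebra_simps)
    then show "(\<lambda>j. (1 - t) *\<^sub>R f j + t *\<^sub>R h j) \<in> T ` \<C>" using conv[OF \<phi>(1,3) t] by blast
  next
    fix f assume "f \<in> T ` \<C>"
    then obtain \<phi> where \<phi>: "\<phi> \<in> \<C>" "f = T \<phi>" by blast
    then obtain s where s: "s \<in> G" "\<eta> \<le> norm (\<phi> s - \<rho> s)" using neg by (auto simp: not_less)
    have "s \<in> g ` {..<card G}" using g s(1) by (simp add: bij_betw_def)
    then obtain j where "j < card G" "g j = s" by blast
    then show "\<exists>j<card G. \<eta> \<le> norm (f j)" using s \<phi>(2) by (auto simp: T_def)
  qed
  then obtain l where l: "\<And>j. linear (l j)" "\<And>j x. \<bar>l j x\<bar> \<le> norm x"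
    and sep: "\<And>\<phi>. \<phi> \<in> \<C> \<Longrightarrow> \<eta> \<le> (\<Sum>j<card G. l j (T \<phi> j))" by blast
  have "((\<lambda>i. l j (T (\<psi> i) j)) \<longlongrightarrow> 0) F" if j: "j < card G" for j
  proof -
    obtain f where f: "bounded_functional_on V f" "\<And>x. Re (f x) = l j x"
      using complexify_functional[OF l(1,2), of V j] by blast
    have "((\<lambda>i. f (\<psi> i (g j))) \<longlongrightarrow> f (\<rho> (g j))) F"
      using weak[OF gG[OF j]] f(1) by (simp add: weakly_tendsto_in_def)
    from tendsto_Re[OF this] have "((\<lambda>i. l j (\<psi> i (g j)) - l j (\<rho> (g j))) \<longlongrightarrow> 0) F"
      by (simp add: f(2) LIM_zero_iff)
    then show ?thesis by (simp add: T_def linear_diff[OF l(1)])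
  qed
  then have "((\<lambda>i. \<Sum>j<card G. l j (T (\<psi> i) j)) \<longlongrightarrow> (\<Sum>j<card G. 0)) F" by (intro tendsto_sum) auto
  then have "eventually (\<lambda>i. (\<Sum>j<card G. l j (T (\<psi> i) j)) < \<eta>) F"
    using \<eta> by (intro order_tendstoD(2)[of _ 0]) auto
  from frequently_eventually_frequently[OF freq this]
  obtain i where "\<psi> i \<in> \<C>" "(\<Sum>j<card G. l j (T (\<psi> i) j)) < \<eta>" using frequently_ex by blast
  then show False using sep[of "\<psi> i"] by simp
qed

text \<open>Split \<open>f\<close> by a finite-rank projection \<open>Q\<close>. The part \<open>f(\<rho>(Q) \<cdot>)\<close> converges by compression to
  \<open>H\<close>. The other part almost vanishes on the image of the compact operators; there a failure of
  convergence would persist for convex combinations of the \<open>\<psi>\<^sub>i\<close>, some of which are close to \<open>\<rho>\<close>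
  in norm on a finite subset of \<open>S\<close> and hence, modulo the compact operators, at \<open>a\<close>.\<close>

lemma weak_rigidity_selfadjoint:
  fixes L :: "'l::chilbert_space set" and \<psi> :: "'i \<Rightarrow> 'h op \<Rightarrow> 'l op"
  assumes L: "closed_csubspace L" and \<rho>: "unital_star_rep (cstar S) L \<rho>"
    and u: "eventually (\<lambda>i. ucp (cstar S) L (\<rho> ` cstar S) (\<psi> i)) F"
    and weak: "\<And>s. s \<in> S \<Longrightarrow> weakly_tendsto_in (\<rho> ` cstar S) (\<lambda>i. \<psi> i s) (\<rho> s) F"
    and f: "bounded_functional_on (\<rho> ` cstar S) f" and a: "a \<in> cstar S" "adj a = a"
  shows "((\<lambda>i. f (\<psi> i a)) \<longlongrightarrow> f (\<rho> a)) F"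
proof (rule tendstoI)
  note RD = unital_star_repD[OF \<rho> A] and X = rep_range[OF L \<rho>]
  note fD = bounded_functional_onD[OF f X(1)]
  let ?X = "\<rho> ` cstar S"
  fix d0 :: real assume "d0 > 0"
  define d where "d = d0 / 2"
  have d: "d > 0" using \<open>d0 > 0\<close> by (simp add: d_def)
  obtain \<kappa> where \<kappa>: "\<kappa> > 0" "\<And>x. x \<in> ?X \<Longrightarrow> cmod (f x) \<le> \<kappa> * norm x" using fD(5) by blast
  \<comment> \<open>The bound \<open>m\<close> is for elements \<open>\<rho> k\<close> within distance \<open>1\<close> of \<open>\<phi> a - \<rho> a\<close>. The tolerances make
    both parts of \<open>g (\<phi> a - \<rho> a)\<close>, at \<open>\<rho> k\<close> and at the remainder, at most \<open>d / 8\<close>.\<close>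
  define e1 where "e1 = min 1 (d / (8 * \<kappa>))"
  define m where "m = 2 * norm a + 1"
  have m: "m > 0" by (simp add: m_def add_nonneg_pos)
  define e where "e = d / (8 * m)"
  have e1: "e1 > 0" "e1 \<le> 1" "\<kappa> * e1 \<le> d / 8"
    using d \<kappa>(1) by (auto simp: e1_def min_def field_simps)
  have e: "e > 0" "e * m = d / 8" using d m by (auto simp: e_def)
  obtain Q where Q: "Q \<in> finite_rank" "is_projection Q"
    and small: "\<And>y. y \<in> \<rho> ` compact_ops \<Longrightarrow> cmod (f (y - (\<rho> Q o\<^sub>L y))) \<le> e * norm y"
    using functional_nearly_vanishes_on_compacts[OF L \<rho> f e(1)] by blast
  have QA: "Q \<in> cstar S" using finite_rank_compact[OF Q(1)] compact_sub by blast
  have kA: "k \<in> cstar S" if "k \<in> compact_ops" for k using that compact_sub by blast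
  define g where "g T = f (T - (\<rho> Q o\<^sub>L T))" for T
  have q: "is_projection (\<rho> Q)"
    using Q(2) RD(1)[OF QA] RD(3)[OF QA QA] RD(4)[OF QA] bop_subset_UNIV
        by (auto simp: is_projection_def)
  have QX: "\<rho> Q o\<^sub>L T \<in> ?X" if "T \<in> ?X" for T by (rule X(4)[OF imageI[OF QA] that])
  have gX: "T - (\<rho> Q o\<^sub>L T) \<in> ?X" if "T \<in> ?X" for T
    by (rule csubspace_op_diff[OF X(1) that QX[OF that]])
  have gadd: "g (T + R) = g T + g R" if "T \<in> ?X" "R \<in> ?X" for T R
  proof -
    have "T + R - (\<rho> Q o\<^sub>L (T + R)) = (T - (\<rho> Q o\<^sub>L T)) + (R - (\<rho> Q o\<^sub>L R))"
      by (simp add: compose_add algebra_simps)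
    then show ?thesis unfolding g_def using fD(1)[OF gX[OF that(1)] gX[OF that(2)]] by (simp only:)
  qed
  have gscale: "g (r *\<^sub>R T) = r *\<^sub>R g T" if "T \<in> ?X" for r T
  proof -
    have "r *\<^sub>R T - (\<rho> Q o\<^sub>L (r *\<^sub>R T)) = complex_of_real r *\<^sub>C (T - (\<rho> Q o\<^sub>L T))"
      by (rule blinfun_eqI) (simp add: blinfun.diff_left blinfun.scaleR_left blinfun.scaleR_right
          scaleR_right_diff_distrib flip: scaleR_scaleC)
    then show ?thesis unfolding g_def by (simp add: fD(2)[OF gX[OF that]] scaleR_conv_of_real)
  qed
  have gbd: "cmod (g T) \<le> \<kappa> * norm T" if "T \<in> ?X" for T
  proof -
    have "norm (T - (\<rho> Q o\<^sub>L T)) \<le> norm T"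
      by (rule norm_blinfun_bound)
        (auto simp: blinfun.diff_left intro: order_trans[OF norm_projection(2)[OF q] norm_blinfun])
    then show ?thesis unfolding g_def using \<kappa>(1)
      by (intro order_trans[OF \<kappa>(2)[OF gX[OF that]]] mult_left_mono) auto
  qed
  have scX: "r *\<^sub>R T \<in> ?X" if "T \<in> ?X" for r T
    using csubspaceD(3)[OF X(1) that, of "of_real r"] by (simp add: scaleC_op_simps(9))
  have \<rho>aX: "\<rho> a \<in> ?X" using a(1) by blast
  obtain G \<eta> where G: "finite G" "G \<subseteq> S" "0 < \<eta>"
    and near: "\<And>\<psi>. ucp (cstar S) L ?X \<psi> \<Longrightarrow> \<forall>s\<in>G. norm (\<psi> s - \<rho> s) < \<eta> \<Longrightarrow>
       \<exists>k\<in>compact_ops. norm (\<psi> a - \<rho> a - \<rho> k) < e1"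
    using ucp_near_rep[OF L \<rho> a e1(1)] by blast
  have gsmall: "cmod (g (\<phi> a - \<rho> a)) < d / 2"
    if \<phi>: "ucp (cstar S) L ?X \<phi>" "\<forall>s\<in>G. norm (\<phi> s - \<rho> s) < \<eta>" for \<phi>
  proof -
    obtain k where k: "k \<in> compact_ops" "norm (\<phi> a - \<rho> a - \<rho> k) < e1" using near[OF \<phi>] by blast
    have kX: "\<rho> k \<in> ?X" using kA[OF k(1)] by blast
    have xX: "\<phi> a - \<rho> a \<in> ?X"
      by (rule csubspace_op_diff[OF X(1) _ \<rho>aX]) (use \<phi>(1) a in \<open>auto simp: ucp_def\<close>)
    have yX: "\<phi> a - \<rho> a - \<rho> k \<in> ?X" by (rule csubspace_op_diff[OF X(1) xX kX])
    have "norm (\<phi> a - \<rho> a) \<le> 2 * norm a"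
      using norm_triangle_ineq4[of "\<phi> a" "\<rho> a"] ucp_adj_norm(2)[OF A L \<phi>(1) X(2) a(1)]
        star_rep_contractive[OF A L \<rho> a(1)] by linarith
    moreover have "norm (\<rho> k) \<le> norm (\<phi> a - \<rho> a) + norm (\<phi> a - \<rho> a - \<rho> k)"
      using norm_triangle_ineq4[of "\<phi> a - \<rho> a" "\<phi> a - \<rho> a - \<rho> k"] by simp
    ultimately have "norm (\<rho> k) \<le> m" using k(2) e1(2) unfolding m_def by linarith
    then have "e * norm (\<rho> k) \<le> d / 8" using e(1) unfolding e(2)[symmetric]
      by (intro mult_left_mono) auto
    then have 1: "cmod (g (\<rho> k)) \<le> d / 8" using small[of "\<rho> k"] k(1) by (auto simp: g_def)
    have "\<kappa> * norm (\<phi> a - \<rho> a - \<rho> k) \<le> \<kappa> * e1" using k(2) \<kappa>(1) by (intro mult_left_mono) auto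
    then have 2: "cmod (g (\<phi> a - \<rho> a - \<rho> k)) \<le> d / 8" using gbd[OF yX] e1(3) by linarith
    have "g (\<phi> a - \<rho> a) = g (\<phi> a - \<rho> a - \<rho> k) + g (\<rho> k)" using gadd[OF yX kX] by simp
    then have "cmod (g (\<phi> a - \<rho> a)) \<le> d / 8 + d / 8"
      using norm_triangle_ineq[of "g (\<phi> a - \<rho> a - \<rho> k)" "g (\<rho> k)"] 1 2 by simp
    then show ?thesis using d by simp
  qed
  \<comment> \<open>A half-plane condition is preserved under convex combinations; the four half-planes given by
    \<open>\<beta> \<in> {1, -1, \<i>, -\<i>}\<close> together cover the complement of a disc.\<close>
  have no_freq: "\<not> frequently (\<lambda>i. ucp (cstar S) L ?X (\<psi> i) \<and> d / 2 \<le> Re (\<beta> * g (\<psi> i a - \<rho> a))) F"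
    if \<beta>: "cmod \<beta> = 1" for \<beta>
  proof
    assume freq: "frequently (\<lambda>i. ucp (cstar S) L ?X (\<psi> i) \<and> d / 2 \<le> Re (\<beta> * g (\<psi> i a - \<rho> a))) F"
    define \<C> where "\<C> = {\<phi>. ucp (cstar S) L ?X \<phi> \<and> d / 2 \<le> Re (\<beta> * g (\<phi> a - \<rho> a))}"
    have "\<exists>\<phi>\<in>\<C>. \<forall>s\<in>G. norm (\<phi> s - \<rho> s) < \<eta>"
    proof (rule norm_close_on_finite_set[where V = ?X and \<psi> = \<psi> and F = F])
      show "frequently (\<lambda>i. \<psi> i \<in> \<C>) F" using freq by (simp add: \<C>_def)
      show "\<phi> s \<in> ?X" if "\<phi> \<in> \<C>" "s \<in> G" for \<phi> s
      proof -
        have "\<phi> ` cstar S \<subseteq> ?X" using that(1) by (simp add: \<C>_def ucp_def)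
        then show ?thesis using that(2) G(2) SA by blast
      qed
      show "\<rho> s \<in> ?X" if "s \<in> G" for s using that G(2) SA by blast
      show "weakly_tendsto_in ?X (\<lambda>i. \<psi> i s) (\<rho> s) F" if "s \<in> G" for s using that G(2) weak by blast
      fix \<phi> \<phi>' and t :: real assume \<phi>: "\<phi> \<in> \<C>" "\<phi>' \<in> \<C>" and t: "0 \<le> t" "t \<le> 1"
      have val: "\<phi> a - \<rho> a \<in> ?X" "\<phi>' a - \<rho> a \<in> ?X"
        by (rule csubspace_op_diff[OF X(1) _ \<rho>aX], use \<phi> a in \<open>auto simp: ucp_def \<C>_def\<close>)+
      have "((1 - t) *\<^sub>R \<phi> a + t *\<^sub>R \<phi>' a) - \<rho> a = (1 - t) *\<^sub>R (\<phi> a - \<rho> a) + t *\<^sub>R (\<phi>' a - \<rho> a)"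
        by (simp add: algebra_simps)
      then have "\<beta> * g (((1 - t) *\<^sub>R \<phi> a + t *\<^sub>R \<phi>' a) - \<rho> a) =
          (1 - t) *\<^sub>R (\<beta> * g (\<phi> a - \<rho> a)) + t *\<^sub>R (\<beta> * g (\<phi>' a - \<rho> a))"
        using gadd[OF scX[OF val(1)] scX[OF val(2)]] by (simp add: gscale val distrib_left)
      then have "Re (\<beta> * g (((1 - t) *\<^sub>R \<phi> a + t *\<^sub>R \<phi>' a) - \<rho> a)) =
          (1 - t) * Re (\<beta> * g (\<phi> a - \<rho> a)) + t * Re (\<beta> * g (\<phi>' a - \<rho> a))" by simp
      moreover have "(1 - t) * (d / 2) + t * (d / 2) \<le>
          (1 - t) * Re (\<beta> * g (\<phi> a - \<rho> a)) + t * Re (\<beta> * g (\<phi>' a - \<rho> a))"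
        using \<phi> t by (intro add_mono mult_left_mono) (auto simp: \<C>_def)
      moreover have "(1 - t) * (d / 2) + t * (d / 2) = d / 2" by (simp add: field_simps)
      ultimately have "d / 2 \<le> Re (\<beta> * g (((1 - t) *\<^sub>R \<phi> a + t *\<^sub>R \<phi>' a) - \<rho> a))" by linarith
      then show "(\<lambda>b. (1 - t) *\<^sub>R \<phi> b + t *\<^sub>R \<phi>' b) \<in> \<C>"
        using ucp_convex_combination[OF X(1) _ _ AD(2) t] \<phi> by (simp add: \<C>_def)
    qed (use G in auto)
    then obtain \<phi> where \<phi>: "ucp (cstar S) L ?X \<phi>" "d / 2 \<le> Re (\<beta> * g (\<phi> a - \<rho> a))"
      "\<forall>s\<in>G. norm (\<phi> s - \<rho> s) < \<eta>" by (auto simp: \<C>_def)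
    have "Re (\<beta> * g (\<phi> a - \<rho> a)) \<le> cmod (g (\<phi> a - \<rho> a))"
      using complex_Re_le_cmod[of "\<beta> * g (\<phi> a - \<rho> a)"] by (simp add: norm_mult \<beta>)
    then show False using gsmall[OF \<phi>(1,3)] \<phi>(2) by linarith
  qed
  have "eventually (\<lambda>i. \<not> (ucp (cstar S) L ?X (\<psi> i) \<and> d / 2 \<le> Re (\<beta> * g (\<psi> i a - \<rho> a)))) F"
    if "\<beta> \<in> {1, -1, \<i>, -\<i>}" for \<beta>
    using no_freq[of \<beta>] that by (auto simp: frequently_def)
  then have "eventually (\<lambda>i. \<forall>\<beta>\<in>{1, -1, \<i>, -\<i>}. \<not>
      (ucp (cstar S) L ?X (\<psi> i) \<and> d / 2 \<le> Re (\<beta> * g (\<psi> i a - \<rho> a)))) F"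
    by (intro eventually_ball_finite) auto
  then have part2: "eventually (\<lambda>i. cmod (g (\<psi> i a - \<rho> a)) < d) F"
    using u
  proof eventually_elim
    case (elim i)
    then show ?case using half_cmod_le_part[of d "g (\<psi> i a - \<rho> a)"] by (meson not_le)
  qed
  have part1: "eventually (\<lambda>i. dist (f (\<rho> Q o\<^sub>L \<psi> i a)) (f (\<rho> Q o\<^sub>L \<rho> a)) < d) F"
    by (rule tendstoD[OF finite_rank_functional_converges[OF L \<rho> u weak f a(1) Q(1)] d])
  show "eventually (\<lambda>i. dist (f (\<psi> i a)) (f (\<rho> a)) < d0) F"
    using part1 part2 u
  proof eventually_elim
    case (elim i)
    have \<psi>X: "\<psi> i a \<in> ?X" using elim(3) a by (auto simp: ucp_def)
    have xX: "\<psi> i a - \<rho> a \<in> ?X" by (rule csubspace_op_diff[OF X(1) \<psi>X \<rho>aX])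
    have "f (\<psi> i a) - f (\<rho> a) = f (\<psi> i a - \<rho> a)" by (rule fD(3)[OF \<psi>X \<rho>aX, symmetric])
    also have "\<psi> i a - \<rho> a = (\<psi> i a - \<rho> a - (\<rho> Q o\<^sub>L (\<psi> i a - \<rho> a))) + (\<rho> Q o\<^sub>L (\<psi> i a - \<rho> a))"
      by simp
    also have "f \<dots> = g (\<psi> i a - \<rho> a) + f (\<rho> Q o\<^sub>L (\<psi> i a - \<rho> a))"
      unfolding g_def by (rule fD(1)[OF gX[OF xX] QX[OF xX]])
    also have "f (\<rho> Q o\<^sub>L (\<psi> i a - \<rho> a)) = f (\<rho> Q o\<^sub>L \<psi> i a) - f (\<rho> Q o\<^sub>L \<rho> a)"
      unfolding compose_add by (rule fD(3)[OF QX[OF \<psi>X] QX[OF \<rho>aX]])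
    finally have "cmod (f (\<psi> i a) - f (\<rho> a)) \<le> cmod (g (\<psi> i a - \<rho> a))
        + cmod (f (\<rho> Q o\<^sub>L \<psi> i a) - f (\<rho> Q o\<^sub>L \<rho> a))"
      by (simp add: norm_triangle_ineq)
    then show ?case using elim(1,2) by (simp add: dist_norm d_def)
  qed
qed

lemma korovkin_rigidity:
  fixes L :: "'l::chilbert_space set"
  assumes L: "closed_csubspace L" and \<rho>: "unital_star_rep (cstar S) L \<rho>"
  shows "korovkin_rigid TYPE('i) S L \<rho>"
  unfolding korovkin_rigid_def
proof (intro allI impI ballI, elim conjE)
  fix I :: "'i set" and le and \<psi> :: "'i \<Rightarrow> 'h op \<Rightarrow> 'l op" and a
  assume dir: "directed_set I le" and u: "\<forall>i\<in>I. ucp (cstar S) L (\<rho> ` cstar S) (\<psi> i)"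
    and weak: "\<forall>s\<in>S. weakly_tendsto_in (\<rho> ` cstar S) (\<lambda>i. \<psi> i s) (\<rho> s) (tails I le)"
    and a: "a \<in> cstar S"
  note RD = unital_star_repD[OF \<rho> A] and X = rep_range[OF L \<rho>]
  have "eventually (\<lambda>i. i \<in> I) (tails I le)" by (rule eventually_tails_mem[OF dir])
  then have ev: "eventually (\<lambda>i. ucp (cstar S) L (\<rho> ` cstar S) (\<psi> i)) (tails I le)"
    by (rule eventually_mono) (use u in blast)
  obtain h k where hk: "h \<in> cstar S" "k \<in> cstar S" "adj h = h" "adj k = k" "a = h + \<i> *\<^sub>C k"
    using selfadjoint_decomposition[OF AD(2) _ AD(5) a] AD(1) by blast
  show "weakly_tendsto_in (\<rho> ` cstar S) (\<lambda>i. \<psi> i a) (\<rho> a) (tails I le)"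
    unfolding weakly_tendsto_in_def
  proof (intro allI impI)
    fix f assume f: "bounded_functional_on (\<rho> ` cstar S) f"
    note fD = bounded_functional_onD[OF f X(1)]
    have sa: "((\<lambda>i. f (\<psi> i b)) \<longlongrightarrow> f (\<rho> b)) (tails I le)" if "b \<in> cstar S" "adj b = b" for b
      by (rule weak_rigidity_selfadjoint[OF L \<rho> ev _ f that]) (use weak in blast)
    have "((\<lambda>i. f (\<psi> i h) + \<i> * f (\<psi> i k)) \<longlongrightarrow> f (\<rho> h) + \<i> * f (\<rho> k)) (tails I le)"
      by (intro tendsto_intros sa hk)
    moreover have "f (\<rho> h) + \<i> * f (\<rho> k) = f (\<rho> a)"
      using hk AD(9) csubspaceD(3)[OF X(1) imageI[OF hk(2)]]
      by (simp add: hk(5) RD(5,6) fD(1,2) imageI)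
    moreover have "eventually (\<lambda>i. f (\<psi> i h) + \<i> * f (\<psi> i k) = f (\<psi> i a)) (tails I le)"
    proof (rule eventually_mono[OF ev])
      fix i assume ui: "ucp (cstar S) L (\<rho> ` cstar S) (\<psi> i)"
      then have m: "\<psi> i h \<in> \<rho> ` cstar S" "\<psi> i k \<in> \<rho> ` cstar S" using hk by (auto simp: ucp_def)
      have "\<psi> i a = \<psi> i h + \<i> *\<^sub>C \<psi> i k"
        using ui hk AD(9) by (simp add: ucp_def clinear_on_def)
      then show "f (\<psi> i h) + \<i> * f (\<psi> i k) = f (\<psi> i a)"
        using fD(1)[OF m(1) csubspaceD(3)[OF X(1) m(2)]] fD(2)[OF m(2)] by simp
    qed
    ultimately show "((\<lambda>i. f (\<psi> i a)) \<longlongrightarrow> f (\<rho> a)) (tails I le)"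
      by (simp only:) (rule Lim_transform_eventually)
  qed
qed

end


theorem theorem3:
  fixes S B :: "'h::chilbert_space op set"
    and H' :: "'k::chilbert_space set"
    and \<pi> :: "'h op \<Rightarrow> 'k op"
  assumes "separable (UNIV :: 'h set)"
    and "unital_subalgebra B" and "closed B"
    and "operator_system S" and "S = generated_operator_system B" and "separable S"
    and "compact_ops \<subseteq> cstar S" and "commutative_quotient (cstar S) compact_ops"
    and "\<forall>(E :: 'h set) \<sigma>. closed_csubspace E \<and> irreducible_rep (cstar S) E \<sigma> \<longrightarrow>
           boundary_rep S E \<sigma>"
    and "closed_csubspace H'" and "separable H'"
    and "unital_star_rep (cstar S) H' \<pi>"
    and "\<not> unique_extension_property S H' \<pi>"
    and "\<forall>T\<in>compact_ops. \<pi> T = 0"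
  shows "(\<forall>(L :: 'l::chilbert_space set) \<rho>.
            closed_csubspace L \<and> unital_star_rep (cstar S) L \<rho> \<longrightarrow>
            unique_tight_extension_property S L \<rho>) \<and>
         (\<forall>(L :: 'l set) \<rho>.
            closed_csubspace L \<and> unital_star_rep (cstar S) L \<rho> \<longrightarrow>
            korovkin_rigid TYPE('i) S L \<rho>) \<and>
         strongly_korovkin_rigid TYPE('i) S H' \<pi>"
proof -
  have bs: "boundary_system S"
  proof (rule boundary_system.intro)
    show "S \<subseteq> bop UNIV" using assms(4) by (simp add: operator_system_def)
  qed (use assms(7-9) in blast)+
  show ?thesis
    using boundary_system.unique_tight_extension[OF bs] boundary_system.korovkin_rigidity[OF bs]
      boundary_system.strong_korovkin_rigidity[OF bs assms(10,12,14)]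
    by blast
qed

end
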